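(* Let $(x_i(t))_{i\ge1}$, $t\ge 0$, be the solution of the system of ordinary differential equations $$x_1'(t)=-x_1(t)-x_1^2(t)+x_1^3(t),$$ $$x_2'(t)=2x_1^2(t)-x_1^4(t)-2(1-x_1^2(t))x_2(t),$$ $$x_i'(t)=\frac i2(1-x_1^2(t))\sum_{k<i}x_k(t)x_{i-k}(t)-i(1-x_1^2(t))x_i(t),\qquad i\ge3,$$ with initial conditions $x_1(0)=1$ and $x_i(0)=0$ for $i\ge2$, and let $t_c$ be the critical point of the Bohman-Frieze process. Then there are absolute constants $c,d$ such that for all sufficiently small $\epsilon>0$ and either choice of the sign $\pm$, $$x_i(t_c\pm\epsilon)=C(\epsilon)\,i^{-3/2}e^{-D(\epsilon)\epsilon^2 i}\,(1+O(1/i)),$$ where the $O(1/i)$ is as $i\to\infty$ with implied constant not depending on $\epsilon$, and where $C(\epsilon)=c+O(\epsilon)$ and $D(\epsilon)=d+O(\epsilon)$ as $\epsilon\to0$ (the functions $C,D$ may depend on the choice of sign, the constants $c,d$ do not).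
   Context: The critical point $t_c$: let $s$ be the solution of $s'(t)=x_1^2(t)+(1-x_1^2(t))s^2(t)$, $s(0)=1$, with $x_1$ as in the claim. Then $t_c$ is the (finite) time at which $s$ blows up; numerically $t_c\approx1.176$. It coincides with the critical point of the Bohman-Frieze random graph process on $n$ vertices, in which at each step two edges are chosen uniformly at random (with replacement) among the edges not yet present, the first being added if it joins two isolated vertices and the second being added otherwise: when the graph has $tn/2$ edges, with probability tending to $1$ as $n\to\infty$ its largest component has size $O(\log n)$ for each fixed $t<t_c$ and $\Theta(n)$ for each fixed $t>t_c$. The function $x_i(t)$ is the limiting proportion of vertices in components of size $i$, but the claim concerns only the deterministic functions $x_i$ and does not involve $n$. *)

theory Defs
  imports Complex_Main "HOL-Library.Landau_Symbols"
begin

text \<open>Component sizes start at 1; the value of a family at index 0 is never used.\<close>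

definition bf_rhs :: "(nat \<Rightarrow> real) \<Rightarrow> nat \<Rightarrow> real" where
  "bf_rhs y i =
     (if i = 1 then - y 1 - (y 1)\<^sup>2 + (y 1) ^ 3
      else if i = 2 then 2 * (y 1)\<^sup>2 - (y 1) ^ 4 - 2 * (1 - (y 1)\<^sup>2) * y 2
      else real i / 2 * (1 - (y 1)\<^sup>2) * (\<Sum>k = 1..<i. y k * y (i - k))
           - real i * (1 - (y 1)\<^sup>2) * y i)"

definition bf_solution :: "(nat \<Rightarrow> real \<Rightarrow> real) \<Rightarrow> bool" where
  "bf_solution x \<longleftrightarrow>
     (\<forall>i\<ge>1. x i 0 = (if i = 1 then 1 else 0) \<and>
        (\<forall>t\<ge>0. (x i has_real_derivative bf_rhs (\<lambda>j. x j t) i) (at t within {0..})))"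

text \<open>The critical time is the blow-up time of the susceptibility \<open>s\<close>, whose equation
  is driven by the proportion \<open>x1\<close> of isolated vertices.\<close>

definition bf_critical_time :: "(real \<Rightarrow> real) \<Rightarrow> real \<Rightarrow> bool" where
  "bf_critical_time x1 tc \<longleftrightarrow>
     0 < tc \<and>
     (\<exists>s. s 0 = 1 \<and>
        (\<forall>t\<in>{0..<tc}. (s has_real_derivative
            (x1 t)\<^sup>2 + (1 - (x1 t)\<^sup>2) * (s t)\<^sup>2) (at t within {0..<tc})) \<and>
        filterlim s at_top (at_left tc))"

end

(*
  For U = 1 - (sum over i of x i t * z ^ i) the system is a forced Burgers equation, solved along characteristics
  z' = p U z, U' = q (z - z^2) with p = 1 - (x 1)^2 and q = (x 1)^2.  Started at a time a shortly before tc, the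
  characteristic map w -> z(t, w) is holomorphic on a disc around 0 of radius greater than 1, and Lagrange inversion gives
  i * x i t as the i-th contour integral of - U'(w) z(t, w)^(-i).  Since the interval of time is short and the
  coefficients x i a are nonnegative, the modulus of z(t, w) on a circle around 0 is smallest at the positive real point, with a
  quadratic lower bound uniform near tc.  Choosing the circle through the real critical point of z(t, .), Laplace's
  method yields i^(-3/2) with a uniform relative error O(1/i).  The exponent is the logarithm of the critical value; the
  critical point is 1 exactly when the linearised characteristic through (1, 0) vanishes, that is when s blows
  up, so the exponent is quadratic in t - tc.
*)

theory Submission
  imports Defs "HOL-Complex_Analysis.Complex_Analysis" "HOL-Probability.Distributions" "HOL-Real_Asymp.Real_Asymp"
begin

section \<open>Laplace's method with a uniform error term\<close>

text \<open>The obstacle is uniformity in \<open>t\<close>: estimates on the disc of convergence in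
  \<open>z\<close> degenerate at \<open>tc\<close>. In the initial position \<open>w\<close> nothing
  special happens there. The flow stays holomorphic in \<open>w\<close> across \<open>tc\<close>
  with bounds independent of \<open>t\<close>, so both signs are one computation in \<delta> = t -
  tc and share the two constants. A late start \<open>a\<close> is forced because the comparison of
  moduli on a circle only survives a short time. It costs analyticity of the data at
  \<open>a\<close> beyond the unit disc, that is an exponential moment; a supersolution of the
  characteristic system supplies it as long as \<open>s\<close> is finite. In the coordinate w = exp
  u, with z = exp (u + G), circles become vertical segments and z^(-i) = exp (- i (u + G)), with i
  as the large parameter. To leading order the phase near the saddle is - \<alpha> \<delta> u -
  \<lambda> u^2 / 2, with critical value \<alpha>^2 \<delta>^2 / (2 \<lambda>). This gives d, while
  c is the amplitude at \<open>tc\<close> divided by the square root of 2 \<pi> \<lambda>.\<close>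

lemma has_integral_gaussian:
  fixes c :: real assumes "c > 0"
  shows "((\<lambda>x. exp (- c * x\<^sup>2)) has_integral sqrt (pi / c)) UNIV"
proof -
  define s where "s = sqrt (1 / (2 * c))"
  have s: "s > 0" "s\<^sup>2 = 1 / (2 * c)" using assms by (simp_all add: s_def)
  have "(normal_density 0 s has_integral 1) UNIV"
    using has_integral_integral_lborel[OF integrable_normal_density[OF s(1), of 0]] s by simp
  from has_integral_mult_right[OF this, of "sqrt (pi / c)"]
  show ?thesis
    unfolding normal_density_def using assms by (simp add: s mult.commute)
qed

text \<open>Half of the exponent absorbs the power, by y^k / k! \<le> exp y with y = c x^2 / 2. What
  remains is a Gaussian with known integral, so each moment has the right order in c.\<close>

lemma power_mult_gaussian_le:
  fixes c x :: real assumes "c > 0"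
  shows "x ^ (2 * k) * exp (- c * x\<^sup>2) \<le> (2 / c) ^ k * fact k * exp (- (c / 2) * x\<^sup>2)"
proof -
  define y where "y = c / 2 * x\<^sup>2"
  have y: "y \<ge> 0" using assms by (simp add: y_def)
  have "y ^ k / fact k \<le> exp y"
  proof -
    have "(\<lambda>n. y ^ n /\<^sub>R fact n) sums exp y" by (rule exp_converges)
    then have "(\<Sum>n\<in>{k}. y ^ n /\<^sub>R fact n) \<le> exp y"
      using sum_le_suminf[of "\<lambda>n. y ^ n /\<^sub>R fact n" "{k}"] y by (auto simp: sums_iff)
    then show ?thesis by (simp add: field_simps)
  qed
  then have le: "y ^ k \<le> fact k * exp y" by (simp add: field_simps)
  have "x ^ (2 * k) = (2 / c) ^ k * y ^ k"
    using assms by (simp add: y_def power_mult power_mult_distrib[symmetric])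
  moreover have "exp (- c * x\<^sup>2) = exp (- y) * exp (- y)"
    unfolding y_def exp_add[symmetric] by (simp add: field_simps)
  ultimately have "x ^ (2 * k) * exp (- c * x\<^sup>2) = (2 / c) ^ k * (y ^ k * (exp (- y) * exp (- y)))" by simp
  also have "\<dots> \<le> (2 / c) ^ k * (fact k * exp y * (exp (- y) * exp (- y)))"
    using le assms by (intro mult_left_mono mult_right_mono) auto
  also have "\<dots> = (2 / c) ^ k * fact k * exp (- y)" by (simp add: exp_minus)
  finally show ?thesis by (simp add: y_def)
qed

lemma gaussian_moment_le:
  fixes c :: real assumes "c > 0"
  shows "integral {-pi..pi} (\<lambda>x. x ^ (2 * k) * exp (- c * x\<^sup>2)) \<le> (2 / c) ^ k * fact k * sqrt (2 * pi / c)"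
proof -
  have hi: "((\<lambda>x. (2 / c) ^ k * fact k * exp (- (c / 2) * x\<^sup>2)) has_integral (2 / c) ^ k * fact k * sqrt (pi / (c / 2))) UNIV"
    by (intro has_integral_mult_right has_integral_gaussian) (use assms in auto)
  have int: "(\<lambda>x. (2 / c) ^ k * fact k * exp (- (c / 2) * x\<^sup>2)) integrable_on {-pi..pi}"
    by (intro integrable_continuous_interval continuous_intros)
  have "integral {-pi..pi} (\<lambda>x. x ^ (2 * k) * exp (- c * x\<^sup>2))
      \<le> integral {-pi..pi} (\<lambda>x. (2 / c) ^ k * fact k * exp (- (c / 2) * x\<^sup>2))"
    by (rule integral_le) (intro integrable_continuous_interval continuous_intros int power_mult_gaussian_le assms)+
  also have "\<dots> \<le> integral UNIV (\<lambda>x. (2 / c) ^ k * fact k * exp (- (c / 2) * x\<^sup>2))"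
    using hi int assms by (intro integral_subset_le) auto
  also have "\<dots> = (2 / c) ^ k * fact k * sqrt (2 * pi / c)"
    unfolding integral_unique[OF hi] by (simp add: mult.commute)
  finally show ?thesis .
qed

text \<open>Outside the interval |x| \<ge> 1, so the tail is dominated by x^2 times the Gaussian. It
  is therefore smaller than the full integral by a factor of order 1/c, which is all that a relative
  error O(1/n) requires.\<close>

lemma gaussian_truncate:
  fixes c :: real assumes "c > 0"
  shows "\<bar>integral {-pi..pi} (\<lambda>x. exp (- c * x\<^sup>2)) - sqrt (pi / c)\<bar> \<le> (2 / c) * sqrt (2 * pi / c)"
proof -
  let ?f = "\<lambda>x::real. exp (- c * x\<^sup>2)"
  let ?g = "\<lambda>x::real. (2 / c) * exp (- (c / 2) * x\<^sup>2)"
  have F: "(?f has_integral sqrt (pi / c)) UNIV" by (rule has_integral_gaussian[OF assms])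
  have G: "(?g has_integral (2 / c) * sqrt (pi / (c / 2))) UNIV"
    by (intro has_integral_mult_right has_integral_gaussian) (use assms in auto)
  have R: "(?f has_integral integral {-pi..pi} ?f) {-pi..pi}"
    by (intro integrable_integral integrable_continuous_interval continuous_intros)
  then have R': "((\<lambda>x. if x \<in> {-pi..pi} then ?f x else 0) has_integral integral {-pi..pi} ?f) UNIV"
    by (simp only: has_integral_restrict_UNIV)
  have D: "((\<lambda>x. ?f x - (if x \<in> {-pi..pi} then ?f x else 0)) has_integral (sqrt (pi / c) - integral {-pi..pi} ?f)) UNIV"
    by (rule has_integral_diff[OF F R'])
  have "sqrt (pi / c) - integral {-pi..pi} ?f \<le> (2 / c) * sqrt (pi / (c / 2))"
  proof (rule has_integral_le[OF D G])
    fix x :: real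
    show "?f x - (if x \<in> {-pi..pi} then ?f x else 0) \<le> ?g x"
    proof (cases "x \<in> {-pi..pi}")
      case True then show ?thesis using assms by simp
    next
      case False
      then have "\<bar>x\<bar> \<ge> 1" using pi_gt3 by auto
      then have "1 \<le> x\<^sup>2" by (metis one_power2 abs_one abs_le_square_iff)
      then have "1 * ?f x \<le> x\<^sup>2 * ?f x" by (intro mult_right_mono) auto
      also have "\<dots> \<le> ?g x" using power_mult_gaussian_le[OF assms, of x 1] by simp
      finally show ?thesis using False assms by simp
    qed
  qed
  moreover have "0 \<le> sqrt (pi / c) - integral {-pi..pi} ?f"
    by (rule has_integral_nonneg[OF D]) auto
  ultimately show ?thesis by (simp add: mult.commute)
qed

lemma integral_odd_zero:
  fixes f :: "real \<Rightarrow> complex"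
  assumes "\<And>x. f (- x) = - f x"
  shows "integral {-a..a} f = 0"
proof -
  have "integral {-a..a} f = integral {-a..a} (\<lambda>x. f (- x))"
    using Henstock_Kurzweil_Integration.integral_reflect_real[of a "-a" f] by simp
  also have "\<dots> = - integral {-a..a} f" by (simp add: assms)
  finally show ?thesis by simp
qed

text \<open>Taylor's formula on the segment from 0 to a. The factor involves only the real part of a
  because it gets multiplied by a Gaussian, and only the product with exp (Re a) is known to stay
  Gaussian.\<close>

lemma exp_minus_one_minus_id_le:
  fixes a :: complex
  shows "norm (exp a - 1 - a) \<le> max 1 (exp (Re a)) * (norm a)\<^sup>2"
proof -
  have "cmod (exp a - (\<Sum>i\<le>1. exp 0 * (a - 0) ^ i / fact i)) \<le> max 1 (exp (Re a)) * cmod (a - 0) ^ Suc 1 / fact 1"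
  proof (rule complex_Taylor[where S = "closed_segment 0 a" and f = "\<lambda>_. exp"])
    fix x assume "x \<in> closed_segment 0 a"
    then obtain u where u: "0 \<le> u" "u \<le> 1" "x = u *\<^sub>R a" by (auto simp: in_segment)
    have "u * Re a \<le> max 0 (Re a)"
      using u by (cases "Re a \<ge> 0") (auto simp: mult_left_le_one_le mult_nonneg_nonpos max_def)
    then have "exp (Re x) \<le> exp (max 0 (Re a))" using u by simp
    also have "\<dots> = max 1 (exp (Re a))" by (simp add: max_def)
    finally show "cmod (exp x) \<le> max 1 (exp (Re a))" by simp
  qed (auto intro: DERIV_exp DERIV_subset)
  then show ?thesis by (simp add: algebra_simps power2_eq_square)
qed

text \<open>The terms linear and cubic in \<theta> are kept on the left because they are odd and
  will integrate to zero. Estimated in norm they would cost a relative error n^(-1/2) instead of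
  1/n. Each of the three terms on the right integrates to order n^(-3/2).\<close>

lemma laplace_pointwise:
  fixes \<phi> W c3 W0 W1 :: complex and B \<kappa> lam \<theta> :: real and n :: real
  assumes B: "B \<ge> 1" and n: "n > 0" and th: "\<bar>\<theta>\<bar> \<le> pi"
    and \<phi>: "norm (\<phi> - lam * \<theta>\<^sup>2 / 2 - c3 * complex_of_real \<theta> ^ 3) \<le> B * \<theta> ^ 4"
    and W: "norm (W - W0 - W1 * \<theta>) \<le> B * \<theta>\<^sup>2"
    and re: "Re \<phi> \<ge> \<kappa> * \<theta>\<^sup>2" and lam: "\<kappa> \<le> lam / 2"
    and c3: "norm c3 \<le> B" and W0: "norm W0 \<le> B" and W1: "norm W1 \<le> B"
  shows "norm (W * exp (- n * \<phi>) - (W0 * exp (- (n * lam / 2) * \<theta>\<^sup>2)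
       + (W1 * \<theta> - n * c3 * complex_of_real \<theta> ^ 3 * W0) * exp (- (n * lam / 2) * \<theta>\<^sup>2)))
     \<le> 600 * B ^ 3 * (\<theta>\<^sup>2 + n * \<theta> ^ 4 + n\<^sup>2 * \<theta> ^ 6) * exp (- (n * \<kappa>) * \<theta>\<^sup>2)"
proof -
  define E where "E = exp (- (n * lam / 2) * \<theta>\<^sup>2)"
  define a where "a = - n * (\<phi> - lam * \<theta>\<^sup>2 / 2)"
  define G where "G = exp (- (n * \<kappa>) * \<theta>\<^sup>2)"
  have th4: "\<bar>\<theta>\<bar> \<le> 4" using th pi_less_4 by simp
  have E0: "E > 0" and G0: "G > 0" by (simp_all add: E_def G_def)
  have EG: "E \<le> G"
  proof -
    have "n * \<kappa> \<le> n * lam / 2" using lam n by (simp add: mult_left_mono)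
    then have "(n * \<kappa>) * \<theta>\<^sup>2 \<le> (n * lam / 2) * \<theta>\<^sup>2" by (intro mult_right_mono) auto
    then show ?thesis by (simp add: E_def G_def)
  qed
  have expE: "exp (- n * \<phi>) = complex_of_real E * exp a"
    by (simp add: E_def a_def exp_of_real[symmetric] exp_add[symmetric] algebra_simps)
  have Ga: "E * exp (Re a) \<le> G"
  proof -
    have "E * exp (Re a) = norm (exp (- n * \<phi>))" unfolding expE using E0 by (simp add: norm_mult)
    also have "\<dots> = exp (- n * Re \<phi>)" by simp
    also have "\<dots> \<le> G" unfolding G_def using re n by (simp add: mult_left_mono)
    finally show ?thesis .
  qed
  have t4: "\<theta> ^ 4 = \<bar>\<theta>\<bar> ^ 4" "\<theta>\<^sup>2 = \<bar>\<theta>\<bar> ^ 2" "\<theta> ^ 6 = \<bar>\<theta>\<bar> ^ 6" by (simp_all add: power_even_abs)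
  have l43: "\<bar>\<theta>\<bar> ^ 4 \<le> 4 * \<bar>\<theta>\<bar> ^ 3"
    using mult_right_mono[OF th4, of "\<bar>\<theta>\<bar>^3"] by (simp add: power_eq_if)
  have l21: "\<bar>\<theta>\<bar> ^ 2 \<le> 4 * \<bar>\<theta>\<bar>"
    using mult_right_mono[OF th4, of "\<bar>\<theta>\<bar>"] by (simp add: power_eq_if)
  have na: "norm a \<le> n * (5 * B * \<bar>\<theta>\<bar> ^ 3)"
  proof -
    have "norm (\<phi> - lam * \<theta>\<^sup>2 / 2) \<le> norm (\<phi> - lam * \<theta>\<^sup>2 / 2 - c3 * complex_of_real \<theta> ^ 3) + norm (c3 * complex_of_real \<theta> ^ 3)"
      by (metis diff_add_cancel norm_triangle_ineq)
    also have "\<dots> \<le> B * \<theta> ^ 4 + B * \<bar>\<theta>\<bar> ^ 3"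
      using \<phi> c3 by (intro add_mono) (auto simp: norm_mult norm_power intro!: mult_right_mono)
    also have "\<dots> \<le> B * (4 * \<bar>\<theta>\<bar> ^ 3) + B * \<bar>\<theta>\<bar> ^ 3"
      unfolding t4(1) using l43 B by (intro add_mono mult_left_mono) auto
    finally show ?thesis using n by (simp add: a_def norm_mult)
  qed
  have nW: "norm (W - W0) \<le> 5 * B * \<bar>\<theta>\<bar>"
  proof -
    have "norm (W - W0) \<le> norm (W - W0 - W1 * \<theta>) + norm (W1 * \<theta>)"
      by (metis diff_add_cancel norm_triangle_ineq)
    also have "\<dots> \<le> B * \<theta>\<^sup>2 + B * \<bar>\<theta>\<bar>"
      using W W1 by (intro add_mono) (auto simp: norm_mult intro!: mult_right_mono)
    also have "\<dots> \<le> B * (4 * \<bar>\<theta>\<bar>) + B * \<bar>\<theta>\<bar>"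
      unfolding t4(2) using l21 B by (intro add_mono mult_left_mono) auto
    finally show ?thesis by simp
  qed
  have nWW: "norm W \<le> 21 * B"
  proof -
    have "norm W \<le> norm (W - W0) + norm W0" by (metis diff_add_cancel norm_triangle_ineq)
    also have "\<dots> \<le> 5 * B * 4 + B" using nW W0 th4 B by (intro add_mono order_trans[OF nW] mult_left_mono) auto
    finally show ?thesis by simp
  qed
  have na2: "(norm a)\<^sup>2 \<le> n\<^sup>2 * (25 * B\<^sup>2 * \<theta> ^ 6)"
  proof -
    have "(norm a)\<^sup>2 \<le> (n * (5 * B * \<bar>\<theta>\<bar> ^ 3))\<^sup>2" using na by (intro power_mono) auto
    also have "\<dots> = n\<^sup>2 * (25 * B\<^sup>2 * \<bar>\<theta>\<bar> ^ 6)" by (simp add: power_mult_distrib power_mult[symmetric])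
    finally show ?thesis unfolding t4(3) .
  qed
  have T1: "norm (E * (W * (exp a - 1 - a))) \<le> 21 * B * (n\<^sup>2 * (25 * B\<^sup>2 * \<theta> ^ 6)) * G"
  proof -
    have "E * max 1 (exp (Re a)) \<le> G" using EG Ga by (simp add: max_def)
    have "norm (E * (W * (exp a - 1 - a))) = E * (norm W * norm (exp a - 1 - a))"
      using E0 by (simp add: norm_mult)
    also have "\<dots> \<le> E * (21 * B * (max 1 (exp (Re a)) * (norm a)\<^sup>2))"
      using E0 nWW B by (intro mult_left_mono mult_mono exp_minus_one_minus_id_le) auto
    also have "\<dots> = 21 * B * ((E * max 1 (exp (Re a))) * (norm a)\<^sup>2)" by simp
    also have "\<dots> \<le> 21 * B * (G * (n\<^sup>2 * (25 * B\<^sup>2 * \<theta> ^ 6)))"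
      using \<open>E * max 1 (exp (Re a)) \<le> G\<close> na2 B G0 by (intro mult_left_mono mult_mono) auto
    finally show ?thesis by (simp add: mult_ac)
  qed
  have T2: "norm (E * (W - W0 - W1 * \<theta>)) \<le> G * (B * \<theta>\<^sup>2)"
    unfolding norm_mult using EG E0 W by (intro mult_mono) auto
  have T3: "norm (E * (a * (W - W0))) \<le> G * (n * (25 * B\<^sup>2 * \<theta> ^ 4))"
  proof -
    have "norm (E * (a * (W - W0))) \<le> G * ((n * (5 * B * \<bar>\<theta>\<bar> ^ 3)) * (5 * B * \<bar>\<theta>\<bar>))"
      unfolding norm_mult using EG E0 na nW n B by (intro mult_mono) auto
    also have "\<dots> = G * (n * (25 * B\<^sup>2 * \<bar>\<theta>\<bar> ^ 4))" by (simp add: power2_eq_square power_eq_if)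
    finally show ?thesis unfolding t4(1) .
  qed
  have T4: "norm (E * (W0 * (a + n * c3 * complex_of_real \<theta> ^ 3))) \<le> G * (B * (n * (B * \<theta> ^ 4)))"
  proof -
    have "a + n * c3 * complex_of_real \<theta> ^ 3 = - n * (\<phi> - lam * \<theta>\<^sup>2 / 2 - c3 * complex_of_real \<theta> ^ 3)" by (simp add: a_def algebra_simps)
    then have "norm (a + n * c3 * complex_of_real \<theta> ^ 3) = n * norm (\<phi> - lam * \<theta>\<^sup>2 / 2 - c3 * complex_of_real \<theta> ^ 3)"
      using n by (simp only: norm_mult) simp
    also have "\<dots> \<le> n * (B * \<theta> ^ 4)" using n \<phi> by (intro mult_left_mono) auto
    finally have "norm (a + n * c3 * complex_of_real \<theta> ^ 3) \<le> n * (B * \<theta> ^ 4)" .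
    then show ?thesis
      unfolding norm_mult[of "complex_of_real E"] norm_mult[of W0] using EG E0 G0 n W0 B by (intro mult_mono) auto
  qed
  \<comment> \<open>The error splits into the second-order remainder of exp a, the remainder of the
    amplitude, the product of the two first-order errors, and the quartic remainder of the
    phase.\<close>
  have "W * exp (- n * \<phi>) - (W0 * E + (W1 * \<theta> - n * c3 * complex_of_real \<theta> ^ 3 * W0) * E)
     = E * (W * (exp a - 1 - a)) + E * (W - W0 - W1 * \<theta>) + E * (a * (W - W0)) + E * (W0 * (a + n * c3 * complex_of_real \<theta> ^ 3))"
    unfolding expE by (simp add: algebra_simps)
  also have "norm \<dots> \<le> 21 * B * (n\<^sup>2 * (25 * B\<^sup>2 * \<theta> ^ 6)) * G + G * (B * \<theta>\<^sup>2) + G * (n * (25 * B\<^sup>2 * \<theta> ^ 4)) + G * (B * (n * (B * \<theta> ^ 4)))"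
    by (intro norm_triangle_le add_mono T1 T2 T3 T4)
  also have "\<dots> = (525 * B^3 * (n\<^sup>2 * \<theta>^6) + B * \<theta>\<^sup>2 + 26 * B\<^sup>2 * (n * \<theta>^4)) * G"
    by (simp add: algebra_simps power_eq_if)
  \<comment> \<open>The largest coefficient is 525 = 21 * 25, rounded up to 600; B \<ge> 1 lifts the
    lower powers of B to the third.\<close>
  also have "\<dots> \<le> (600 * B^3 * (n\<^sup>2 * \<theta>^6) + 600 * B^3 * \<theta>\<^sup>2 + 600 * B^3 * (n * \<theta>^4)) * G"
  proof -
    have "B \<le> B^3" "B\<^sup>2 \<le> B^3" "0 \<le> B^3" using B by (simp_all add: self_le_power power_increasing)
    then show ?thesis using n G0 by (intro mult_right_mono add_mono) auto
  qed
  finally show ?thesis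
    by (simp add: E_def G_def algebra_simps)
qed

text \<open>The constant depends on B and \<kappa> only and not on the phase or the amplitude. This
  is the source of the uniformity in \<epsilon>.\<close>

lemma laplace_uniform:
  fixes \<phi> W :: "real \<Rightarrow> complex" and c3 W0 W1 :: complex and B \<kappa> lam :: real and n :: real
  assumes B: "B \<ge> 1" and n: "n > 0" and \<kappa>: "\<kappa> > 0"
    and cont: "continuous_on {-pi..pi} \<phi>" "continuous_on {-pi..pi} W"
    and \<phi>: "\<And>\<theta>. \<bar>\<theta>\<bar> \<le> pi \<Longrightarrow> norm (\<phi> \<theta> - lam * \<theta>\<^sup>2 / 2 - c3 * \<theta> ^ 3) \<le> B * \<theta> ^ 4"
    and W: "\<And>\<theta>. \<bar>\<theta>\<bar> \<le> pi \<Longrightarrow> norm (W \<theta> - W0 - W1 * \<theta>) \<le> B * \<theta>\<^sup>2"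
    and re: "\<And>\<theta>. \<bar>\<theta>\<bar> \<le> pi \<Longrightarrow> Re (\<phi> \<theta>) \<ge> \<kappa> * \<theta>\<^sup>2" and lam: "\<kappa> \<le> lam / 2"
    and c3: "norm c3 \<le> B" and W0: "norm W0 \<le> B" and W1: "norm W1 \<le> B"
  shows "norm (integral {-pi..pi} (\<lambda>\<theta>. W \<theta> * exp (- n * \<phi> \<theta>)) - W0 * sqrt (2 * pi / (n * lam)))
     \<le> (600 * B ^ 3 * (2 / \<kappa> + 8 / \<kappa>\<^sup>2 + 48 / \<kappa> ^ 3) + B * (2 / \<kappa>)) * sqrt (2 * pi / \<kappa>) / (n * sqrt n)"
proof -
  define c where "c = n * lam / 2"
  define k where "k = n * \<kappa>"
  have k0: "k > 0" using n \<kappa> by (simp add: k_def)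
  have kc: "k \<le> c" using lam n by (simp add: k_def c_def mult_left_mono)
  then have c0: "c > 0" using k0 by simp
  let ?f = "\<lambda>\<theta>. W \<theta> * exp (- n * \<phi> \<theta>)"
  let ?m = "\<lambda>\<theta>::real. W0 * complex_of_real (exp (- c * \<theta>\<^sup>2))"
  let ?o = "\<lambda>\<theta>::real. (W1 * \<theta> - n * c3 * \<theta> ^ 3 * W0) * complex_of_real (exp (- c * \<theta>\<^sup>2))"
  let ?g = "\<lambda>j \<theta>::real. \<theta> ^ (2 * j) * exp (- k * \<theta>\<^sup>2)"
  let ?G = "\<lambda>\<theta>::real. 600 * B ^ 3 * (?g 1 \<theta> + n * ?g 2 \<theta> + n\<^sup>2 * ?g 3 \<theta>)"
  have intf: "?f integrable_on {-pi..pi}"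
    by (intro integrable_continuous_interval continuous_intros cont)
  have intm: "?m integrable_on {-pi..pi}"
    by (intro integrable_continuous_interval continuous_intros)
  have into: "?o integrable_on {-pi..pi}"
    by (intro integrable_continuous_interval continuous_intros)
  have intg: "(?g j) integrable_on {-pi..pi}" for j
    by (intro integrable_continuous_interval continuous_intros)
  have intG: "?G integrable_on {-pi..pi}"
    by (intro integrable_continuous_interval continuous_intros)
  \<comment> \<open>The symmetric interval is what makes the terms of order 1/n disappear.\<close>
  have o0: "integral {-pi..pi} ?o = 0"
    by (rule integral_odd_zero) (simp add: algebra_simps)
  have pw: "norm (?f \<theta> - (?m \<theta> + ?o \<theta>)) \<le> ?G \<theta>" if "\<theta> \<in> {-pi..pi}" for \<theta>
  proof -
    have "\<bar>\<theta>\<bar> \<le> pi" using that by auto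
    from laplace_pointwise[OF B n this \<phi>[OF this] W[OF this] re[OF this] lam c3 W0 W1]
    show ?thesis unfolding c_def k_def by (simp add: algebra_simps power2_eq_square)
  qed
  have "norm (integral {-pi..pi} (\<lambda>\<theta>. ?f \<theta> - (?m \<theta> + ?o \<theta>))) \<le> integral {-pi..pi} ?G"
    by (rule integral_norm_bound_integral) (intro integrable_diff integrable_add intf intm into intG pw)+
  also have "integral {-pi..pi} ?G = 600 * B ^ 3 * (integral {-pi..pi} (?g 1) + n * integral {-pi..pi} (?g 2) + n\<^sup>2 * integral {-pi..pi} (?g 3))"
    by (intro integral_unique has_integral_mult_right has_integral_add integrable_integral intg)
  also have "\<dots> \<le> 600 * B ^ 3 * ((2 / k) ^ 1 * fact 1 * sqrt (2 * pi / k) + n * ((2 / k) ^ 2 * fact 2 * sqrt (2 * pi / k)) + n\<^sup>2 * ((2 / k) ^ 3 * fact 3 * sqrt (2 * pi / k)))"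
    using B n by (intro mult_left_mono add_mono gaussian_moment_le k0) auto
  also have "\<dots> = 600 * B ^ 3 * (2 / \<kappa> + 8 / \<kappa>\<^sup>2 + 48 / \<kappa> ^ 3) * sqrt (2 * pi / \<kappa>) / (n * sqrt n)"
  proof -
    have "sqrt (2 * pi / k) = sqrt (2 * pi / \<kappa>) / sqrt n"
      unfolding real_sqrt_divide[symmetric] k_def by (simp add: mult.commute)
    show ?thesis unfolding \<open>sqrt (2 * pi / k) = _\<close> using n \<kappa> by (simp add: k_def field_simps power2_eq_square power3_eq_cube fact_numeral)
  qed
  finally have 1: "norm (integral {-pi..pi} (\<lambda>\<theta>. ?f \<theta> - (?m \<theta> + ?o \<theta>))) \<le> 600 * B ^ 3 * (2 / \<kappa> + 8 / \<kappa>\<^sup>2 + 48 / \<kappa> ^ 3) * sqrt (2 * pi / \<kappa>) / (n * sqrt n)" .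
  have "integral {-pi..pi} (\<lambda>\<theta>. ?f \<theta> - (?m \<theta> + ?o \<theta>)) = integral {-pi..pi} ?f - integral {-pi..pi} ?m"
    using intf intm into o0
    by (simp add: Henstock_Kurzweil_Integration.integral_diff Henstock_Kurzweil_Integration.integral_add integrable_add)
  moreover have "integral {-pi..pi} ?m = W0 * complex_of_real (integral {-pi..pi} (\<lambda>\<theta>. exp (- c * \<theta>\<^sup>2)))"
  proof -
    have "((\<lambda>\<theta>. exp (- c * \<theta>\<^sup>2)) has_integral integral {-pi..pi} (\<lambda>\<theta>. exp (- c * \<theta>\<^sup>2))) {-pi..pi}"
      by (intro integrable_integral integrable_continuous_interval continuous_intros)
    from has_integral_mult_right[OF has_integral_linear[OF this bounded_linear_of_real], of W0]
    show ?thesis unfolding o_def by (rule integral_unique)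
  qed
  ultimately have 2: "integral {-pi..pi} (\<lambda>\<theta>. ?f \<theta> - (?m \<theta> + ?o \<theta>)) = integral {-pi..pi} ?f - W0 * complex_of_real (integral {-pi..pi} (\<lambda>\<theta>. exp (- c * \<theta>\<^sup>2)))" by simp
  have 3: "norm (W0 * complex_of_real (integral {-pi..pi} (\<lambda>\<theta>. exp (- c * \<theta>\<^sup>2))) - W0 * complex_of_real (sqrt (2 * pi / (n * lam)))) \<le> B * (2 / \<kappa>) * sqrt (2 * pi / \<kappa>) / (n * sqrt n)"
  proof -
    have e: "sqrt (2 * pi / (n * lam)) = sqrt (pi / c)" by (simp add: c_def mult.commute)
    have "norm (W0 * complex_of_real (integral {-pi..pi} (\<lambda>\<theta>. exp (- c * \<theta>\<^sup>2))) - W0 * complex_of_real (sqrt (2 * pi / (n * lam))))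
      = norm W0 * \<bar>integral {-pi..pi} (\<lambda>\<theta>. exp (- c * \<theta>\<^sup>2)) - sqrt (pi / c)\<bar>"
      unfolding e right_diff_distrib[symmetric] norm_mult of_real_diff[symmetric] norm_of_real ..
    also have "\<dots> \<le> B * ((2 / c) * sqrt (2 * pi / c))"
      by (intro mult_mono gaussian_truncate c0 W0) (use B in auto)
    also have "\<dots> \<le> B * ((2 / k) * sqrt (2 * pi / k))"
      using kc k0 c0 B by (intro mult_left_mono mult_mono real_sqrt_le_mono divide_left_mono) auto
    also have "\<dots> = B * (2 / \<kappa>) * sqrt (2 * pi / \<kappa>) / (n * sqrt n)"
    proof -
      have "sqrt (2 * pi / k) = sqrt (2 * pi / \<kappa>) / sqrt n"
        unfolding real_sqrt_divide[symmetric] k_def by (simp add: mult.commute)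
      show ?thesis unfolding \<open>sqrt (2 * pi / k) = _\<close> using n \<kappa> by (simp add: k_def field_simps)
    qed
    finally show ?thesis .
  qed
  have "norm (integral {-pi..pi} ?f - W0 * complex_of_real (sqrt (2 * pi / (n * lam))))
     \<le> 600 * B ^ 3 * (2 / \<kappa> + 8 / \<kappa>\<^sup>2 + 48 / \<kappa> ^ 3) * sqrt (2 * pi / \<kappa>) / (n * sqrt n) + B * (2 / \<kappa>) * sqrt (2 * pi / \<kappa>) / (n * sqrt n)"
    by (rule norm_diff_triangle_le[OF _ 3]) (use 1 2 in simp)
  also have "\<dots> = (600 * B ^ 3 * (2 / \<kappa> + 8 / \<kappa>\<^sup>2 + 48 / \<kappa> ^ 3) + B * (2 / \<kappa>)) * sqrt (2 * pi / \<kappa>) / (n * sqrt n)"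
    by (simp add: add_divide_distrib distrib_right)
  finally show ?thesis .
qed

section \<open>Holomorphic dependence on a parameter\<close>

lemma norm_higher_deriv_le:
  assumes "f holomorphic_on S" "cball w r \<subseteq> S" "0 < r" "\<And>v. v \<in> cball w r \<Longrightarrow> norm (f v) \<le> B"
  shows "norm ((deriv ^^ n) f w) \<le> fact n * B / r ^ n"
proof (rule Cauchy_inequality)
  show "f holomorphic_on ball w r" by (rule holomorphic_on_subset[OF assms(1)]) (use assms in auto)
  show "continuous_on (cball w r) f"
    by (rule holomorphic_on_imp_continuous_on, rule holomorphic_on_subset[OF assms(1)]) (use assms in auto)
  show "norm (f x) \<le> B" if "norm (w - x) = r" for x using that by (intro assms) (auto simp: dist_norm)
qed (use assms in auto)

text \<open>Joint continuity is uniform on a compact product, so g t - g t0 is small on a whole disc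
  of radius r. Cauchy's estimate transfers this to the derivative at the price of the factor 1/r,
  which the choice e * r / 4 anticipates.\<close>

lemma continuous_on_Times_deriv:
  fixes g :: "real \<Rightarrow> complex \<Rightarrow> complex"
  assumes S: "open S" and hol: "\<And>t. t \<in> {a..b} \<Longrightarrow> g t holomorphic_on S"
    and cont: "continuous_on ({a..b} \<times> S) (\<lambda>(t, w). g t w)"
  shows "continuous_on ({a..b} \<times> S) (\<lambda>(t, w). deriv (g t) w)"
  unfolding continuous_on_iff
proof (intro ballI allI impI)
  fix x0 and e :: real
  assume x0: "x0 \<in> {a..b} \<times> S" and e: "e > 0"
  obtain t0 w0 where x0_eq: "x0 = (t0, w0)" by (cases x0)
  then have t0: "t0 \<in> {a..b}" and w0: "w0 \<in> S" using x0 by auto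
  obtain r0 where r0: "r0 > 0" "cball w0 r0 \<subseteq> S" using S w0 open_contains_cball by blast
  define r where "r = r0 / 2"
  have r: "r > 0" using r0 by (simp add: r_def)
  have er: "0 < e * r / 4" using e r by simp
  have uc: "uniformly_continuous_on ({a..b} \<times> cball w0 r0) (\<lambda>(t, w). g t w)"
    by (intro compact_uniformly_continuous compact_Times continuous_on_subset[OF cont]) (use r0 in auto)
  obtain d1 where d1: "d1 > 0" "\<And>x y. x \<in> {a..b} \<times> cball w0 r0 \<Longrightarrow> y \<in> {a..b} \<times> cball w0 r0 \<Longrightarrow> dist y x < d1 \<Longrightarrow>
      dist (case y of (t, w) \<Rightarrow> g t w) (case x of (t, w) \<Rightarrow> g t w) < e * r / 4"
    by (rule uniformly_continuous_onE[OF uc er]) (rule that)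
  have dh: "deriv (g t0) holomorphic_on S" using hol[OF t0] S by (intro holomorphic_deriv) auto
  have "continuous_on S (deriv (g t0))" by (rule holomorphic_on_imp_continuous_on[OF dh])
  then obtain d2 where d2: "d2 > 0" "\<And>w. w \<in> S \<Longrightarrow> dist w w0 < d2 \<Longrightarrow> dist (deriv (g t0) w) (deriv (g t0) w0) < e / 2"
    using w0 half_gt_zero[OF e] unfolding continuous_on_iff by blast
  show "\<exists>d>0. \<forall>x'\<in>{a..b} \<times> S. dist x' x0 < d \<longrightarrow> dist (case x' of (t, w) \<Rightarrow> deriv (g t) w) (case x0 of (t, w) \<Rightarrow> deriv (g t) w) < e"
    unfolding x0_eq prod.case
  proof (intro exI[of _ "min (min d1 d2) r"] conjI ballI impI)
    show "min (min d1 d2) r > 0" using d1 d2 r by simp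
    fix x' assume x': "x' \<in> {a..b} \<times> S" "dist x' (t0, w0) < min (min d1 d2) r"
    obtain t w where tw: "x' = (t, w)" by (cases x')
    have t: "t \<in> {a..b}" and w: "w \<in> S" using x' tw by auto
    have dw: "dist w w0 < min (min d1 d2) r" using x' tw dist_snd_le[of x' "(t0,w0)"] by simp
    have dt: "dist t t0 < min (min d1 d2) r" using x' tw dist_fst_le[of x' "(t0,w0)"] by simp
    have sub: "cball w r \<subseteq> cball w0 r0"
    proof
      fix v assume "v \<in> cball w r"
      then show "v \<in> cball w0 r0" using dw dist_triangle[of w0 v w] by (auto simp: r_def dist_commute)
    qed
    have wS: "(\<lambda>v. g t v - g t0 v) holomorphic_on S" using hol t t0 by (intro holomorphic_intros) auto
    have "norm ((deriv ^^ 1) (\<lambda>v. g t v - g t0 v) w) \<le> fact 1 * (e * r / 4) / r ^ 1"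
    proof (rule norm_higher_deriv_le[OF wS _ r])
      show "cball w r \<subseteq> S" using sub r0 by auto
      fix v assume "v \<in> cball w r"
      then have v: "v \<in> cball w0 r0" using sub by auto
      have "dist (t, v) (t0, v) < d1" using dt by (simp add: dist_Pair_Pair)
      from d1(2)[OF _ _ this] show "norm (g t v - g t0 v) \<le> e * r / 4" using v t t0 by (simp add: dist_norm)
    qed
    then have "norm (deriv (\<lambda>v. g t v - g t0 v) w) \<le> e / 4" using r by simp
    moreover have "deriv (\<lambda>v. g t v - g t0 v) w = deriv (g t) w - deriv (g t0) w"
      using hol t t0 w S by (intro deriv_diff holomorphic_on_imp_differentiable_at) auto
    ultimately have "dist (deriv (g t) w) (deriv (g t0) w) \<le> e / 4" by (simp add: dist_norm)
    moreover have "dist (deriv (g t0) w) (deriv (g t0) w0) < e / 2" using d2(2)[OF w] dw by simp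
    ultimately have "dist (deriv (g t) w) (deriv (g t0) w0) < e"
      using dist_triangle[of "deriv (g t) w" "deriv (g t0) w0" "deriv (g t0) w"] e by linarith
    then show "dist (case x' of (t, w) \<Rightarrow> deriv (g t) w) (deriv (g t0) w0) < e" by (simp add: tw)
  qed
qed

lemma integral_has_field_derivative_holomorphic:
  fixes g :: "real \<Rightarrow> complex \<Rightarrow> complex"
  assumes S: "open S" "convex S" and hol: "\<And>t. t \<in> {a..b} \<Longrightarrow> g t holomorphic_on S"
    and cont: "continuous_on ({a..b} \<times> S) (\<lambda>(t, w). g t w)" and w: "w \<in> S"
  shows "((\<lambda>w. integral {a..b} (\<lambda>t. g t w)) has_field_derivative integral {a..b} (\<lambda>t. deriv (g t) w)) (at w)"
proof -
  have "continuous_on (S \<times> cbox a b) (\<lambda>x. case (snd x, fst x) of (t, w) \<Rightarrow> deriv (g t) w)"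
    by (rule continuous_on_compose2[OF continuous_on_Times_deriv[OF S(1) hol cont]])
      (auto intro!: continuous_intros)
  then have c1: "continuous_on (S \<times> cbox a b) (\<lambda>(w, t). deriv (g t) w)"
    by (simp add: case_prod_unfold)
  have d: "((\<lambda>w. g t w) has_field_derivative deriv (g t) x) (at x within S)" if "x \<in> S" "t \<in> cbox a b" for x t
    by (rule holomorphic_derivI[OF hol S(1)]) (use that in auto)
  have i: "(\<lambda>t. g t x) integrable_on cbox a b" if x: "x \<in> S" for x
  proof -
    have "continuous_on {a..b} (\<lambda>t. case (t, x) of (t, w) \<Rightarrow> g t w)"
      by (rule continuous_on_compose2[OF cont]) (use x in \<open>auto intro!: continuous_intros\<close>)
    then show ?thesis by (simp add: integrable_continuous_interval)
  qed
  have "((\<lambda>w. integral (cbox a b) (\<lambda>t. g t w)) has_field_derivative integral (cbox a b) (\<lambda>t. deriv (g t) w)) (at w within S)"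
    using leibniz_rule_field_derivative[of S a b "\<lambda>w t. g t w" "\<lambda>w t. deriv (g t) w", OF d i c1 w S(2)] by blast
  then show ?thesis using at_within_open[OF w S(1)] by simp
qed

lemma integral_holomorphic:
  fixes g :: "real \<Rightarrow> complex \<Rightarrow> complex"
  assumes S: "open S" "convex S" and hol: "\<And>t. t \<in> {a..b} \<Longrightarrow> g t holomorphic_on S"
    and cont: "continuous_on ({a..b} \<times> S) (\<lambda>(t, w). g t w)"
  shows "(\<lambda>w. integral {a..b} (\<lambda>t. g t w)) holomorphic_on S"
  unfolding holomorphic_on_open[OF S(1)]
  using integral_has_field_derivative_holomorphic[OF assms] by blast

lemma continuous_on_Times_Lipschitz:
  fixes F :: "real \<Rightarrow> 'a::metric_space \<Rightarrow> 'b::real_normed_vector"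
  assumes lip: "\<And>t t' w. t \<in> T \<Longrightarrow> t' \<in> T \<Longrightarrow> w \<in> S \<Longrightarrow> norm (F t w - F t' w) \<le> L * \<bar>t - t'\<bar>"
    and cont: "\<And>t. t \<in> T \<Longrightarrow> continuous_on S (F t)"
  shows "continuous_on (T \<times> S) (\<lambda>(t, w). F t w)"
  unfolding continuous_on_iff
proof (intro ballI allI impI)
  fix x0 and e :: real
  assume x0: "x0 \<in> T \<times> S" and e: "e > 0"
  obtain t0 w0 where x0_eq: "x0 = (t0, w0)" by (cases x0)
  then have t0: "t0 \<in> T" and w0: "w0 \<in> S" using x0 by auto
  obtain d where d: "d > 0" "\<And>w. w \<in> S \<Longrightarrow> dist w w0 < d \<Longrightarrow> dist (F t0 w) (F t0 w0) < e / 2"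
    using cont[OF t0] w0 half_gt_zero[OF e] unfolding continuous_on_iff by blast
  define d' where "d' = e / (2 * (\<bar>L\<bar> + 1))"
  have d': "d' > 0" using e by (simp add: d'_def)
  show "\<exists>d>0. \<forall>x'\<in>T \<times> S. dist x' x0 < d \<longrightarrow> dist (case x' of (t, w) \<Rightarrow> F t w) (case x0 of (t, w) \<Rightarrow> F t w) < e"
    unfolding x0_eq prod.case
  proof (intro exI[of _ "min d d'"] conjI ballI impI)
    show "min d d' > 0" using d d' by simp
    fix x' assume x': "x' \<in> T \<times> S" "dist x' (t0, w0) < min d d'"
    obtain t w where tw: "x' = (t, w)" by (cases x')
    have t: "t \<in> T" and w: "w \<in> S" using x' tw by auto
    have dw: "dist w w0 < d" using x' tw dist_snd_le[of x' "(t0,w0)"] by simp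
    have dt: "\<bar>t - t0\<bar> < d'" using x' tw dist_fst_le[of x' "(t0,w0)"] by (simp add: dist_real_def)
    have "norm (F t w - F t0 w) \<le> L * \<bar>t - t0\<bar>" by (rule lip[OF t t0 w])
    also have "\<dots> \<le> (\<bar>L\<bar> + 1) * d'" using dt by (intro mult_mono) auto
    also have "\<dots> = e / 2" by (simp add: d'_def field_simps)
    finally have "dist (F t w) (F t0 w) \<le> e / 2" by (simp add: dist_norm)
    then show "dist (case x' of (t, w) \<Rightarrow> F t w) (F t0 w0) < e"
      using d(2)[OF w dw] dist_triangle[of "F t w" "F t0 w0" "F t0 w"] by (simp add: tw)
  qed
qed

section \<open>Numerical bounds for the force along a characteristic\<close>

lemma norm_exp_le_3: "norm (z::complex) \<le> 1 \<Longrightarrow> norm (exp z) \<le> 3"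
  using norm_exp[of z] exp_le exp_le_cancel_iff[of "norm z" 1] by linarith

lemma norm_exp_diff_le:
  fixes x y :: complex
  assumes "norm x \<le> 1" "norm y \<le> 1"
  shows "norm (exp x - exp y) \<le> 3 * norm (x - y)"
proof (rule field_differentiable_bound[of "cball 0 1" exp exp])
  show "\<And>z. z \<in> cball 0 1 \<Longrightarrow> (exp has_field_derivative exp z) (at z within cball 0 1)"
    by (rule DERIV_subset[OF DERIV_exp]) simp
qed (use assms norm_exp_le_3 in auto)

text \<open>The position w exp h has norm at most 2 * 3 = 6, and 6 + 36 = 42.\<close>

lemma char_force_bound:
  assumes "norm (w::complex) \<le> 2" "norm h \<le> 1"
  shows "norm (w * exp h - (w * exp h)\<^sup>2) \<le> 42"
proof -
  have z: "norm (w * exp h) \<le> 6" using assms norm_exp_le_3[of h] mult_mono[of "norm w" 2 "norm (exp h)" 3] by (simp add: norm_mult)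
  have "norm (w * exp h - (w * exp h)\<^sup>2) \<le> norm (w * exp h) + norm (w * exp h) ^ 2"
    by (metis norm_power norm_triangle_ineq4)
  also have "\<dots> \<le> 6 + 6 ^ 2" by (intro add_mono power_mono z) auto
  finally show ?thesis by simp
qed

text \<open>The difference factors as (z - z') (1 - z - z'), and the second factor is at most 1 + 6
  + 6 = 13. The distance of positions is at most 3 times that of the starting points plus 6 times
  that of the displacements.\<close>

lemma char_force_Lipschitz:
  assumes "norm (w::complex) \<le> 2" "norm h \<le> 1" "norm (w'::complex) \<le> 2" "norm h' \<le> 1"
  shows "norm ((w * exp h - (w * exp h)\<^sup>2) - (w' * exp h' - (w' * exp h')\<^sup>2)) \<le> 39 * norm (w - w') + 78 * norm (h - h')"
proof -
  define z z' where "z = w * exp h" and "z' = w' * exp h'"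
  have z: "norm z \<le> 6" "norm z' \<le> 6"
    using assms norm_exp_le_3[of h] norm_exp_le_3[of h'] mult_mono[of "norm w" 2 "norm (exp h)" 3] mult_mono[of "norm w'" 2 "norm (exp h')" 3]
    by (simp_all add: norm_mult z_def z'_def)
  have "z - z' = (w - w') * exp h + w' * (exp h - exp h')" by (simp add: z_def z'_def algebra_simps)
  also have "norm \<dots> \<le> norm (w - w') * 3 + 2 * (3 * norm (h - h'))"
  proof (intro norm_triangle_le add_mono)
    show "norm ((w - w') * exp h) \<le> norm (w - w') * 3"
      unfolding norm_mult by (intro mult_left_mono norm_exp_le_3 assms) auto
    show "norm (w' * (exp h - exp h')) \<le> 2 * (3 * norm (h - h'))"
      unfolding norm_mult by (intro mult_mono norm_exp_diff_le assms) auto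
  qed
  finally have d: "norm (z - z') \<le> 3 * norm (w - w') + 6 * norm (h - h')" by simp
  have "norm ((z - z\<^sup>2) - (z' - z'\<^sup>2)) = norm (z - z') * norm (1 - z - z')"
    unfolding norm_mult[symmetric] by (simp add: algebra_simps power2_eq_square)
  also have "norm (1 - z - z') \<le> 13"
    using norm_triangle_ineq4[of "1 - z" z'] norm_triangle_ineq4[of 1 z] z by simp
  finally have "norm ((z - z\<^sup>2) - (z' - z'\<^sup>2)) \<le> norm (z - z') * 13" by (simp add: mult_left_mono)
  also have "\<dots> \<le> (3 * norm (w - w') + 6 * norm (h - h')) * 13" using d by simp
  finally show ?thesis by (simp add: z_def z'_def)
qed

section \<open>Characteristic curves\<close>

lemma vector_mvt_bound:
  fixes f :: "real \<Rightarrow> 'a::banach"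
  assumes "\<And>s. s \<in> {a..b} \<Longrightarrow> (f has_vector_derivative f' s) (at s within {a..b})"
    and "\<And>s. s \<in> {a..b} \<Longrightarrow> norm (f' s) \<le> B" and "t \<in> {a..b}" "s \<in> {a..b}"
  shows "norm (f t - f s) \<le> B * \<bar>t - s\<bar>"
proof -
  have "norm (f t - f s) \<le> B * norm (t - s)"
  proof (rule differentiable_bound[of "{a..b}" f "\<lambda>s x. x *\<^sub>R f' s"])
    show "\<And>x. x \<in> {a..b} \<Longrightarrow> (f has_derivative (\<lambda>y. y *\<^sub>R f' x)) (at x within {a..b})"
      using assms(1) by (simp add: has_vector_derivative_def)
    fix x assume "x \<in> {a..b}"
    then show "onorm (\<lambda>y. y *\<^sub>R f' x) \<le> B"
      using assms(2)[of x] by (intro onorm_le) (simp add: mult.commute[of B] mult_left_mono)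
  qed (use assms in auto)
  then show ?thesis by simp
qed

lemma nonneg_derivative_imp_le:
  fixes f :: "real \<Rightarrow> real"
  assumes d: "\<And>s. s \<in> {a..b} \<Longrightarrow> (f has_real_derivative f' s) (at s within {a..b})"
    and nn: "\<And>s. s \<in> {a..b} \<Longrightarrow> 0 \<le> f' s" and t: "t \<in> {a..b}"
  shows "f a \<le> f t"
proof (rule DERIV_nonneg_imp_increasing_open[of a t f])
  show "a \<le> t" using t by simp
  show "\<exists>y. DERIV f x :> y \<and> y \<ge> 0" if "a < x" "x < t" for x
    using d[of x] nn[of x] that t by (auto simp: at_within_Icc_at)
  show "continuous_on {a..t} f"
    by (rule continuous_on_subset[OF DERIV_continuous_on[OF d]]) (use t in auto)
qed

text \<open>A characteristic curve \<open>(h, U)\<close> of the forced Burgers equation issued from the point \<open>w\<close>;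
  the position is \<open>w exp (h t)\<close>.\<close>

definition char_curve :: "(real \<Rightarrow> real) \<Rightarrow> (real \<Rightarrow> real) \<Rightarrow> real \<Rightarrow> real \<Rightarrow> complex \<Rightarrow> (real \<Rightarrow> complex) \<Rightarrow> (real \<Rightarrow> complex) \<Rightarrow> bool" where
  "char_curve p q a b w h U \<longleftrightarrow> h a = 0 \<and>
     (\<forall>t\<in>{a..b}. norm (h t) \<le> 1 \<and>
        (h has_vector_derivative p t * U t) (at t within {a..b}) \<and>
        (U has_vector_derivative q t * (w * exp (h t) - (w * exp (h t))\<^sup>2)) (at t within {a..b}))"

lemma char_curve_continuous:
  assumes "char_curve p q a b w h U"
  shows "continuous_on {a..b} h" "continuous_on {a..b} U"
  using assms by (auto simp: char_curve_def intro!: continuous_on_vector_derivative)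

context
  fixes p q :: "real \<Rightarrow> real" and a b :: real
  assumes ab: "a \<le> b" "b - a \<le> 1 / 1000"
    and p01: "\<And>t. t \<in> {a..b} \<Longrightarrow> 0 \<le> p t \<and> p t \<le> 1"
    and q01: "\<And>t. t \<in> {a..b} \<Longrightarrow> 0 \<le> q t \<and> q t \<le> 1"
begin

text \<open>The largest deviation A of the velocities controls the displacements, and these control
  the force. A then reappears on the right with the factor 78 (b - a)^2, negligible for b - a \<le>
  1/1000, and is absorbed on the left. Equal data give uniqueness.\<close>

lemma char_curve_stable:
  assumes c1: "char_curve p q a b w h U" and c2: "char_curve p q a b w' h' U'"
    and w: "norm w \<le> 2" "norm w' \<le> 2" and t: "t \<in> {a..b}"
  shows "norm (U t - U' t) \<le> 2 * norm (U a - U' a) + norm (w - w')"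
    and "norm (h t - h' t) \<le> (b - a) * (2 * norm (U a - U' a) + norm (w - w'))"
proof -
  have "continuous_on {a..b} (\<lambda>t. norm (U t - U' t))"
    by (intro continuous_intros char_curve_continuous[OF c1] char_curve_continuous[OF c2])
  then obtain m where m: "m \<in> {a..b}" "\<And>t. t \<in> {a..b} \<Longrightarrow> norm (U t - U' t) \<le> norm (U m - U' m)"
    using continuous_attains_sup[of "{a..b}" "\<lambda>t. norm (U t - U' t)"] ab by auto
  define A where "A = norm (U m - U' m)"
  have A: "norm (U t - U' t) \<le> A" if "t \<in> {a..b}" for t using m that by (simp add: A_def)
  have A0: "A \<ge> 0" by (simp add: A_def)
  have hA: "norm (h t - h' t) \<le> (b - a) * A" if t: "t \<in> {a..b}" for t
  proof -
    have "norm ((h t - h' t) - (h a - h' a)) \<le> A * \<bar>t - a\<bar>"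
    proof (rule vector_mvt_bound[of a b "\<lambda>t. h t - h' t" "\<lambda>t. p t * U t - p t * U' t"])
      fix s assume s: "s \<in> {a..b}"
      then show "((\<lambda>t. h t - h' t) has_vector_derivative p s * U s - p s * U' s) (at s within {a..b})"
        using c1 c2 by (intro derivative_intros) (auto simp: char_curve_def)
      have "norm (p s * U s - p s * U' s) = p s * norm (U s - U' s)"
        using p01[OF s] unfolding right_diff_distrib[symmetric] norm_mult by simp
      also have "\<dots> \<le> 1 * A" using p01[OF s] A[OF s] by (intro mult_mono) auto
      finally show "norm (p s * U s - p s * U' s) \<le> A" by simp
    qed (use t ab in auto)
    also have "\<dots> \<le> A * (b - a)" using t A0 by (intro mult_left_mono) auto
    finally show ?thesis using c1 c2 by (simp add: char_curve_def mult.commute)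
  qed
  define L where "L = 39 * norm (w - w') + 78 * ((b - a) * A)"
  have L0: "L \<ge> 0" using A0 ab by (simp add: L_def)
  have "norm ((U m - U' m) - (U a - U' a)) \<le> L * \<bar>m - a\<bar>"
  proof (rule vector_mvt_bound[of a b "\<lambda>t. U t - U' t" "\<lambda>t. q t * (w * exp (h t) - (w * exp (h t))\<^sup>2) - q t * (w' * exp (h' t) - (w' * exp (h' t))\<^sup>2)"])
    fix s assume s: "s \<in> {a..b}"
    then show "((\<lambda>t. U t - U' t) has_vector_derivative q s * (w * exp (h s) - (w * exp (h s))\<^sup>2) - q s * (w' * exp (h' s) - (w' * exp (h' s))\<^sup>2)) (at s within {a..b})"
      using c1 c2 by (intro derivative_intros) (auto simp: char_curve_def)
    have "norm (q s * (w * exp (h s) - (w * exp (h s))\<^sup>2) - q s * (w' * exp (h' s) - (w' * exp (h' s))\<^sup>2))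
        = q s * norm ((w * exp (h s) - (w * exp (h s))\<^sup>2) - (w' * exp (h' s) - (w' * exp (h' s))\<^sup>2))"
      using q01[OF s] unfolding right_diff_distrib[symmetric] norm_mult by simp
    also have "\<dots> \<le> 1 * (39 * norm (w - w') + 78 * norm (h s - h' s))"
      using q01[OF s] c1 c2 s w by (intro mult_mono char_force_Lipschitz) (auto simp: char_curve_def)
    also have "\<dots> \<le> L" using hA[OF s] by (simp add: L_def)
    finally show "norm (q s * (w * exp (h s) - (w * exp (h s))\<^sup>2) - q s * (w' * exp (h' s) - (w' * exp (h' s))\<^sup>2)) \<le> L" .
  qed (use m ab in auto)
  also have "\<dots> \<le> L * (1 / 1000)" using m ab L0 by (intro mult_left_mono) auto
  finally have "A \<le> norm (U a - U' a) + L / 1000"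
    using norm_triangle_ineq2[of "U m - U' m" "U a - U' a"] by (simp add: A_def)
  moreover define P where "P = (b - a) * A"
  moreover have "P \<le> (1 / 1000) * A" unfolding P_def using ab A0 by (intro mult_right_mono) auto
  ultimately have "A \<le> 2 * norm (U a - U' a) + norm (w - w')"
    using norm_ge_zero[of "w - w'"] norm_ge_zero[of "U a - U' a"] A0 unfolding L_def
    by argo
  then show "norm (U t - U' t) \<le> 2 * norm (U a - U' a) + norm (w - w')"
    and "norm (h t - h' t) \<le> (b - a) * (2 * norm (U a - U' a) + norm (w - w'))"
    using A[OF t] hA[OF t] mult_left_mono[of A "2 * norm (U a - U' a) + norm (w - w')" "b - a"] ab by auto
qed

text \<open>For real data the complex conjugate is a characteristic with the same data, so
  uniqueness makes the curve real.\<close>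

lemma char_curve_real:
  assumes c: "char_curve p q a b w h U" and w: "norm w \<le> 2" "w \<in> \<real>" "U a \<in> \<real>" and t: "t \<in> {a..b}"
  shows "U t \<in> \<real>" "h t \<in> \<real>"
proof -
  have cw: "cnj w = w" "cnj (U a) = U a" using w by (auto simp: Reals_cnj_iff)
  have "char_curve p q a b w (\<lambda>t. cnj (h t)) (\<lambda>t. cnj (U t))"
    unfolding char_curve_def
  proof (intro conjI ballI)
    fix t assume t: "t \<in> {a..b}"
    have "(h has_vector_derivative p t * U t) (at t within {a..b})" using c t by (auto simp: char_curve_def)
    from has_vector_derivative_cnj[OF this]
    show "((\<lambda>t. cnj (h t)) has_vector_derivative p t * cnj (U t)) (at t within {a..b})" by simp
    have "(U has_vector_derivative q t * (w * exp (h t) - (w * exp (h t))\<^sup>2)) (at t within {a..b})" using c t by (auto simp: char_curve_def)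
    from has_vector_derivative_cnj[OF this]
    show "((\<lambda>t. cnj (U t)) has_vector_derivative q t * (w * exp (cnj (h t)) - (w * exp (cnj (h t)))\<^sup>2)) (at t within {a..b})"
      by (simp add: cw exp_cnj)
  qed (use c in \<open>auto simp: char_curve_def\<close>)
  from char_curve_stable[OF c this w(1) w(1) t]
  have "U t = cnj (U t)" "h t = cnj (h t)" by (auto simp: cw)
  then show "U t \<in> \<real>" "h t \<in> \<real>" by (auto simp: Reals_cnj_iff)
qed

text \<open>The point z = 1, U = 0 is an equilibrium of the characteristic system, because z - z^2
  vanishes there.\<close>

lemma char_curve_at_1:
  assumes c: "char_curve p q a b 1 h U" and "U a = 0" and t: "t \<in> {a..b}"
  shows "U t = 0" "h t = 0"
proof -
  have "char_curve p q a b 1 (\<lambda>_. 0) (\<lambda>_. 0)" by (auto simp: char_curve_def)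
  from char_curve_stable[OF c this _ _ t] show "U t = 0" "h t = 0" using assms by auto
qed

end

text \<open>The imaginary part of e enters the real part of exp e - 1 only quadratically. On a
  circle that imaginary part has size \<theta>, whereas the available gap has size \<theta>^2; a
  bound by the norm of e would be useless.\<close>

lemma Re_exp_minus_one_le:
  fixes e :: complex and x B :: real
  assumes "Re e \<le> x" "0 \<le> x" "exp x \<le> B"
  shows "\<bar>Re (exp e - 1)\<bar> \<le> B * (\<bar>Re e\<bar> + (norm e)\<^sup>2)"
proof -
  have B0: "B > 0" using assms(3) exp_gt_zero[of x] by linarith
  have eB: "exp (Re e) \<le> B" using assms by (meson exp_le_cancel_iff order_trans)
  have "\<bar>exp (Re e) - 1\<bar> \<le> B * \<bar>Re e\<bar>"
  proof (cases "Re e \<ge> 0")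
    case True
    have "1 - Re e \<le> exp (- Re e)" using exp_ge_add_one_self[of "- Re e"] by simp
    then have "exp (Re e) * (1 - Re e) \<le> 1" using mult_left_mono[of "1 - Re e" "exp (- Re e)" "exp (Re e)"] by (simp add: exp_minus)
    then have "exp (Re e) - 1 \<le> exp (Re e) * Re e" by (simp add: algebra_simps)
    also have "\<dots> \<le> B * Re e" using eB True by (intro mult_right_mono) auto
    finally show ?thesis using True by simp
  next
    case False
    have B1: "1 \<le> B" using assms one_le_exp_iff[of x] by linarith
    have "1 - exp (Re e) \<le> - Re e" using exp_ge_add_one_self[of "Re e"] by linarith
    also have "\<dots> \<le> B * (- Re e)" using B1 False mult_right_mono[of 1 B "- Re e"] by simp
    finally show ?thesis using False by simp
  qed
  moreover have "exp (Re e) * (1 - cos (Im e)) \<le> B * (norm e)\<^sup>2"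
  proof -
    have "1 - cos (Im e) = 2 * (sin (Im e / 2))\<^sup>2" using cos_double_sin[of "Im e / 2"] by simp
    also have "\<dots> \<le> 2 * (Im e / 2)\<^sup>2" using power_mono[OF abs_sin_x_le_abs_x[of "Im e / 2"], of 2] by (simp add: power_divide)
    also have "\<dots> \<le> (norm e)\<^sup>2" by (simp add: cmod_power2 power_divide)
    finally show ?thesis using eB B0 by (intro mult_mono) auto
  qed
  moreover have "Re (exp e - 1) = (exp (Re e) - 1) - exp (Re e) * (1 - cos (Im e))"
    by (simp add: Re_exp algebra_simps)
  moreover have "0 \<le> exp (Re e) * (1 - cos (Im e))" by simp
  ultimately show ?thesis unfolding distrib_left by linarith
qed

text \<open>With y = |x| / 2 \<le> 2 one has sin y \<ge> y - y^3 / 6 \<ge> y / 3, and 1 - cos x is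
  twice the square of sin y.\<close>

lemma one_minus_cos_ge:
  fixes x :: real assumes "\<bar>x\<bar> \<le> pi"
  shows "1 - cos x \<ge> x\<^sup>2 / 18"
proof -
  define y where "y = \<bar>x\<bar> / 2"
  have y: "0 \<le> y" "y \<le> 2" using assms pi_less_4 by (auto simp: y_def)
  have "\<bar>sin y - y\<bar> \<le> \<bar>y\<bar> ^ 3 / 6"
    using Maclaurin_sin_bound[of y 3] by (simp add: eval_nat_numeral sin_coeff_def)
  moreover have "y ^ 3 \<le> 4 * y"
  proof -
    have "y * y\<^sup>2 \<le> y * 2\<^sup>2" using y by (intro mult_left_mono power_mono) auto
    then show ?thesis by (simp add: power2_eq_square power3_eq_cube)
  qed
  ultimately have "y / 3 \<le> sin y" using y unfolding abs_le_iff by (simp add: abs_of_nonneg)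
  then have "(y / 3)\<^sup>2 \<le> (sin y)\<^sup>2" using y by (intro power_mono) auto
  moreover have "cos x = 1 - 2 * (sin y)\<^sup>2"
    using cos_double_sin[of y] by (simp add: y_def)
  ultimately show ?thesis by (simp add: y_def power_divide)
qed

text \<open>The second-order term \<open>(norm e)\<^sup>2\<close> is dominated by \<open>Re (U a - U' a)\<close> itself: this is what makes the
  modulus of the characteristic map minimal at the positive real point of a circle.\<close>

lemma char_curve_circle_gap:
  fixes p q :: "real \<Rightarrow> real" and a b M r \<theta> p0 :: real
  assumes ab: "a \<le> b" "(b - a) * (400000 * (M + 1)) \<le> 1" and M: "M \<ge> 0"
    and p01: "\<And>t. t \<in> {a..b} \<Longrightarrow> p0 \<le> p t \<and> p t \<le> 1" and p0: "0 \<le> p0"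
    and q01: "\<And>t. t \<in> {a..b} \<Longrightarrow> 0 \<le> q t \<and> q t \<le> 1"
    and c1: "char_curve p q a b (r * cis \<theta>) h U" and c2: "char_curve p q a b r h' U'"
    and r: "0 < r" "r \<le> 2" and U': "U' a \<in> \<real>"
    and gap: "(norm (U a - U' a))\<^sup>2 \<le> 4 * Re (U a - U' a)" "\<theta>\<^sup>2 \<le> M * Re (U a - U' a)"
    and \<theta>: "\<bar>\<theta>\<bar> \<le> pi" and t: "t \<in> {a..b}"
  shows "Re (h t) - Re (h' t) \<ge> p0 / 2 * Re (U a - U' a) * (t - a)"
proof -
  define G where "G = Re (U a - U' a)"
  have G0: "G \<ge> 0" using gap(1) zero_le_power2[of "norm (U a - U' a)"] unfolding G_def by linarith
  have d1: "b - a \<le> 1 / 1000"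
  proof -
    have "(b - a) * 1000 \<le> (b - a) * (400000 * (M + 1))" using ab M by (intro mult_left_mono) auto
    then show ?thesis using ab by simp
  qed
  have pp: "0 \<le> p t \<and> p t \<le> 1" if "t \<in> {a..b}" for t using p01[OF that] p0 by auto
  define A where "A = 2 * norm (U a - U' a) + norm (r * cis \<theta> - complex_of_real r)"
  have nw: "norm (r * cis \<theta>) \<le> 2" "norm (complex_of_real r) \<le> 2" using r by (simp_all add: norm_mult)
  have st: "norm (h t - h' t) \<le> (b - a) * A" if "t \<in> {a..b}" for t
    using char_curve_stable(2)[OF ab(1) d1 pp q01 c1 c2 nw that] by (simp add: A_def)
  have hreal: "h' s \<in> \<real>" "U' s \<in> \<real>" if "s \<in> {a..b}" for s
    using char_curve_real[OF ab(1) d1 pp q01 c2 nw(2) _ U' that] by auto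
  have cis1: "norm (r * cis \<theta> - complex_of_real r) \<le> 2 * \<bar>\<theta>\<bar>"
  proof -
    have "r * cis \<theta> - complex_of_real r = r * (cis \<theta> - 1)" by (simp add: algebra_simps)
    moreover have "norm (cis \<theta> - 1) \<le> \<bar>\<theta>\<bar>"
    proof -
      have "(norm (cis \<theta> - 1))\<^sup>2 = (cos \<theta> - 1)\<^sup>2 + (sin \<theta>)\<^sup>2" by (simp add: cmod_power2)
      also have "\<dots> = 2 - 2 * cos \<theta>" using sin_cos_squared_add[of \<theta>] by (simp add: power2_eq_square algebra_simps)
      also have "\<dots> = 4 * (sin (\<theta> / 2))\<^sup>2" using cos_double_sin[of "\<theta> / 2"] by simp
      also have "\<dots> \<le> 4 * (\<theta> / 2)\<^sup>2" using power_mono[OF abs_sin_x_le_abs_x[of "\<theta> / 2"], of 2] by (simp add: power_divide)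
      also have "\<dots> = \<bar>\<theta>\<bar>\<^sup>2" by (simp add: power_divide)
      finally have "(norm (cis \<theta> - 1))\<^sup>2 \<le> \<bar>\<theta>\<bar>\<^sup>2" .
      then show ?thesis by (rule power2_le_imp_le) simp
    qed
    ultimately show ?thesis using r by (simp add: norm_mult mult_mono)
  qed
  have A0: "A \<ge> 0" by (simp add: A_def)
  \<comment> \<open>\<open>e s\<close> is the logarithm of the ratio between the positions of the
    complex and of the real characteristic.\<close>
  define e where "e = (\<lambda>s. \<i> * \<theta> + h s - h' s)"
  have ne2: "(norm (e s))\<^sup>2 \<le> 8 * (M + 1) * G" if s: "s \<in> {a..b}" for s
  proof -
    have "norm (e s) \<le> \<bar>\<theta>\<bar> + norm (h s - h' s)"
      using norm_triangle_ineq[of "\<i> * \<theta>" "h s - h' s"] by (simp add: e_def norm_mult add_diff_eq)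
    also have "norm (h s - h' s) \<le> (b - a) * A" by (rule st[OF s])
    also have "\<dots> \<le> (1 / 2) * A" using d1 A0 by (intro mult_right_mono) auto
    also have "\<dots> \<le> norm (U a - U' a) + \<bar>\<theta>\<bar>" using cis1 by (simp add: A_def)
    finally have "norm (e s) \<le> norm (U a - U' a) + 2 * \<bar>\<theta>\<bar>" by simp
    then have "(norm (e s))\<^sup>2 \<le> (norm (U a - U' a) + 2 * \<bar>\<theta>\<bar>)\<^sup>2" by (intro power_mono) auto
    also have "\<dots> \<le> 2 * (norm (U a - U' a))\<^sup>2 + 8 * \<theta>\<^sup>2"
      using sum_squares_bound[of "norm (U a - U' a)" "2 * \<bar>\<theta>\<bar>"] by (simp add: power2_sum power_mult_distrib)
    also have "\<dots> \<le> 2 * (4 * G) + 8 * (M * G)" using gap by (intro add_mono mult_left_mono) (auto simp: G_def)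
    finally show ?thesis by (simp add: algebra_simps)
  qed
  \<comment> \<open>The absorption argument is run for the real parts alone. The full difference of
    the velocities is only of the order of the square root of \<open>G\<close>.\<close>
  have "continuous_on {a..b} (\<lambda>t. \<bar>Re (U t) - Re (U' t)\<bar>)"
    by (intro continuous_intros char_curve_continuous[OF c1] char_curve_continuous[OF c2])
  then obtain m where m: "m \<in> {a..b}" "\<And>t. t \<in> {a..b} \<Longrightarrow> \<bar>Re (U t) - Re (U' t)\<bar> \<le> \<bar>Re (U m) - Re (U' m)\<bar>"
    using continuous_attains_sup[of "{a..b}" "\<lambda>t. \<bar>Re (U t) - Re (U' t)\<bar>"] ab by auto
  define B where "B = \<bar>Re (U m) - Re (U' m)\<bar>"
  have B0: "B \<ge> 0" by (simp add: B_def)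
  have Ree: "\<bar>Re (e s)\<bar> \<le> (b - a) * B" if s: "s \<in> {a..b}" for s
  proof -
    have "norm ((Re (h s) - Re (h' s)) - (Re (h a) - Re (h' a))) \<le> B * \<bar>s - a\<bar>"
    proof (rule vector_mvt_bound[of a b "\<lambda>t. Re (h t) - Re (h' t)" "\<lambda>t. p t * Re (U t) - p t * Re (U' t)"])
      fix s assume s: "s \<in> {a..b}"
      have "(h has_vector_derivative p s * U s) (at s within {a..b})" "(h' has_vector_derivative p s * U' s) (at s within {a..b})"
        using c1 c2 s by (auto simp: char_curve_def)
      from DERIV_diff[OF this[THEN has_field_derivative_Re]]
      show "((\<lambda>t. Re (h t) - Re (h' t)) has_vector_derivative p s * Re (U s) - p s * Re (U' s)) (at s within {a..b})"
        by (simp add: has_real_derivative_iff_has_vector_derivative)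
      have "norm (p s * Re (U s) - p s * Re (U' s)) = p s * \<bar>Re (U s) - Re (U' s)\<bar>"
        using pp[OF s] unfolding right_diff_distrib[symmetric] by (simp add: abs_mult)
      also have "\<dots> \<le> 1 * B" using pp[OF s] m(2)[OF s] unfolding B_def by (intro mult_mono) auto
      finally show "norm (p s * Re (U s) - p s * Re (U' s)) \<le> B" by simp
    qed (use s ab in auto)
    also have "\<dots> \<le> B * (b - a)" using s B0 by (intro mult_left_mono) auto
    finally show ?thesis using c1 c2 by (simp add: char_curve_def e_def mult.commute)
  qed
  \<comment> \<open>With |z| \<le> 6, exp 2 \<le> 9 and exp 4 \<le> 81 the coefficient is 6 * 9 + 36
    * 324 = 11718.\<close>
  define K where "K = 12000 * ((b - a) * B + 8 * (M + 1) * G)"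
  have K0: "K \<ge> 0" unfolding K_def using ab B0 M G0 by (intro mult_nonneg_nonneg add_nonneg_nonneg) auto
  have force: "\<bar>Re (r * cis \<theta> * exp (h s) - (r * cis \<theta> * exp (h s))\<^sup>2) - Re (r * exp (h' s) - (r * exp (h' s))\<^sup>2)\<bar> \<le> K"
    if s: "s \<in> {a..b}" for s
  proof -
    obtain k where k: "h' s = complex_of_real k" using hreal(1)[OF s] by (auto elim: Reals_cases)
    define z where "z = r * exp k"
    have "norm (h' s) \<le> 1" using c2 s by (simp add: char_curve_def)
    then have nk: "\<bar>k\<bar> \<le> 1" by (simp add: k)
    have "exp k \<le> 3" using nk exp_le exp_le_cancel_iff[of k 1] by linarith
    then have z: "0 < z" "z \<le> 6" unfolding z_def using r mult_mono[of r 2 "exp k" 3] by auto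
    have rz: "r * exp (h' s) = complex_of_real z" by (simp add: z_def k exp_of_real)
    have "cis \<theta> = exp (\<i> * \<theta>)" by (simp add: cis_conv_exp)
    then have rw: "r * cis \<theta> * exp (h s) = complex_of_real z * exp (e s)"
      unfolding rz[symmetric] by (simp add: e_def exp_add[symmetric] exp_diff field_simps)
    have Re2: "Re (e s) \<le> 2"
    proof -
      have "norm (h s) \<le> 1" "norm (h' s) \<le> 1" using c1 c2 s by (simp_all add: char_curve_def)
      then have "\<bar>Re (h s)\<bar> \<le> 1" "\<bar>Re (h' s)\<bar> \<le> 1" using abs_Re_le_cmod[of "h s"] abs_Re_le_cmod[of "h' s"] by linarith+
      then show ?thesis by (simp add: e_def)
    qed
    have e2: "exp (2::real) \<le> 9" "exp (4::real) \<le> 81"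
    proof -
      have "exp (1::real) ^ 2 \<le> 3 ^ 2" "exp (1::real) ^ 4 \<le> 3 ^ 4" using exp_le by (intro power_mono; simp)+
      then show "exp (2::real) \<le> 9" "exp (4::real) \<le> 81" by (simp_all add: exp_of_nat_mult[symmetric] flip: exp_of_nat_mult)
    qed
    define N where "N = \<bar>Re (e s)\<bar> + (norm (e s))\<^sup>2"
    have 1: "\<bar>Re (exp (e s) - 1)\<bar> \<le> 9 * N" unfolding N_def
      by (rule Re_exp_minus_one_le[OF Re2 _ e2(1)]) simp
    have "\<bar>Re (exp (2 * e s) - 1)\<bar> \<le> 81 * (\<bar>Re (2 * e s)\<bar> + (norm (2 * e s))\<^sup>2)"
      by (rule Re_exp_minus_one_le[OF _ _ e2(2)]) (use Re2 in auto)
    also have "\<dots> \<le> 324 * N" by (simp add: N_def norm_mult power_mult_distrib)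
    finally have 2: "\<bar>Re (exp (2 * e s) - 1)\<bar> \<le> 324 * N" .
    have "Re (r * cis \<theta> * exp (h s) - (r * cis \<theta> * exp (h s))\<^sup>2) - Re (r * exp (h' s) - (r * exp (h' s))\<^sup>2)
        = z * Re (exp (e s) - 1) - z\<^sup>2 * Re (exp (2 * e s) - 1)"
      unfolding rw rz power_mult_distrib exp_double by (simp add: algebra_simps flip: of_real_power)
    also have "\<bar>\<dots>\<bar> \<le> z * \<bar>Re (exp (e s) - 1)\<bar> + z\<^sup>2 * \<bar>Re (exp (2 * e s) - 1)\<bar>"
      using z abs_triangle_ineq4[of "z * Re (exp (e s) - 1)" "z\<^sup>2 * Re (exp (2 * e s) - 1)"] by (simp add: abs_mult)
    also have "\<dots> \<le> 6 * (9 * N) + 6\<^sup>2 * (324 * N)"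
      using z 1 2 by (intro add_mono mult_mono power_mono) auto
    also have "\<dots> = 11718 * N" by simp
    also have "\<dots> \<le> 12000 * ((b - a) * B + 8 * (M + 1) * G)"
      using Ree[OF s] ne2[OF s] by (intro mult_mono) (auto simp: N_def)
    also have "\<dots> = K" by (simp add: K_def)
    finally show ?thesis .
  qed
  have dU: "\<bar>(Re (U s) - Re (U' s)) - G\<bar> \<le> K * (b - a)" if s: "s \<in> {a..b}" for s
  proof -
    have "norm ((Re (U s) - Re (U' s)) - (Re (U a) - Re (U' a))) \<le> K * \<bar>s - a\<bar>"
    proof (rule vector_mvt_bound[of a b "\<lambda>t. Re (U t) - Re (U' t)" "\<lambda>s. q s * Re (r * cis \<theta> * exp (h s) - (r * cis \<theta> * exp (h s))\<^sup>2) - q s * Re (r * exp (h' s) - (r * exp (h' s))\<^sup>2)"])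
      fix s assume s: "s \<in> {a..b}"
      have "(U has_vector_derivative q s * (r * cis \<theta> * exp (h s) - (r * cis \<theta> * exp (h s))\<^sup>2)) (at s within {a..b})"
        "(U' has_vector_derivative q s * (r * exp (h' s) - (r * exp (h' s))\<^sup>2)) (at s within {a..b})"
        using c1 c2 s by (auto simp: char_curve_def)
      from DERIV_diff[OF this[THEN has_field_derivative_Re]]
      show "((\<lambda>t. Re (U t) - Re (U' t)) has_vector_derivative q s * Re (r * cis \<theta> * exp (h s) - (r * cis \<theta> * exp (h s))\<^sup>2) - q s * Re (r * exp (h' s) - (r * exp (h' s))\<^sup>2)) (at s within {a..b})"
        by (simp add: has_real_derivative_iff_has_vector_derivative del: minus_complex.sel)
      have "norm (q s * Re (r * cis \<theta> * exp (h s) - (r * cis \<theta> * exp (h s))\<^sup>2) - q s * Re (r * exp (h' s) - (r * exp (h' s))\<^sup>2))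
         = q s * \<bar>Re (r * cis \<theta> * exp (h s) - (r * cis \<theta> * exp (h s))\<^sup>2) - Re (r * exp (h' s) - (r * exp (h' s))\<^sup>2)\<bar>"
        using q01[OF s] unfolding right_diff_distrib[symmetric] by (simp only: real_norm_def abs_mult) simp
      also have "\<dots> \<le> 1 * K" using q01[OF s] force[OF s] by (intro mult_mono) auto
      finally show "norm (q s * Re (r * cis \<theta> * exp (h s) - (r * cis \<theta> * exp (h s))\<^sup>2) - q s * Re (r * exp (h' s) - (r * exp (h' s))\<^sup>2)) \<le> K" by simp
    qed (use s ab in auto)
    also have "\<dots> \<le> K * (b - a)" using s K0 by (intro mult_left_mono) auto
    finally show ?thesis by (simp add: G_def)
  qed
  \<comment> \<open>This is where 400000 (M + 1) comes from: 12000 * 8 / 400000 = 0.24. The part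
    with \<open>B\<close> has the factor 0.012 and is absorbed through B \<le> G + K (b - a), so the
    initial gap \<open>G\<close> loses less than half.\<close>
  have Kd: "K * (b - a) \<le> G / 2"
  proof -
    have "(b - a) * (b - a) * B \<le> (1 / 1000) * (1 / 1000) * B"
      using d1 ab(1) B0 by (intro mult_right_mono mult_mono) auto
    moreover have "(b - a) * (400000 * (M + 1)) * G \<le> 1 * G" using ab(2) G0 by (rule mult_right_mono)
    moreover have "K * (b - a) = 12000 * ((b - a) * (b - a) * B) + (96 / 400) * ((b - a) * (400000 * (M + 1)) * G)"
      by (simp add: K_def algebra_simps)
    ultimately have *: "K * (b - a) \<le> 12 / 1000 * B + 96 / 400 * G" by simp
    moreover have "B \<le> G + K * (b - a)" using dU[OF m(1)] G0 unfolding B_def by linarith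
    ultimately show ?thesis using B0 G0 by linarith
  qed
  have lower: "Re (U s) - Re (U' s) \<ge> G / 2" if "s \<in> {a..b}" for s
    using dU[OF that] Kd by linarith
  \<comment> \<open>The velocity gap persists at \<open>G / 2\<close>, so the displacement gap grows
    at least linearly with slope \<open>p0 / 2 * G\<close>.\<close>
  define F where "F = (\<lambda>s. (Re (h s) - Re (h' s)) - p0 / 2 * G * (s - a))"
  have "F a \<le> F t"
  proof (rule nonneg_derivative_imp_le[OF _ _ t])
    fix s assume s: "s \<in> {a..b}"
    have "(h has_vector_derivative p s * U s) (at s within {a..b})" "(h' has_vector_derivative p s * U' s) (at s within {a..b})"
      using c1 c2 s by (auto simp: char_curve_def)
    from DERIV_diff[OF this[THEN has_field_derivative_Re]]
    have d: "((\<lambda>t. Re (h t) - Re (h' t)) has_real_derivative p s * Re (U s) - p s * Re (U' s)) (at s within {a..b})"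
      by (simp add: has_real_derivative_iff_has_vector_derivative)
    show "(F has_real_derivative (p s * Re (U s) - p s * Re (U' s)) - p0 / 2 * G) (at s within {a..b})"
      unfolding F_def by (rule DERIV_diff[OF d]) (auto intro!: derivative_eq_intros)
    have "p0 * (G / 2) \<le> p s * (Re (U s) - Re (U' s))"
      using p01[OF s] p0 G0 lower[OF s] by (intro mult_mono) auto
    then show "0 \<le> (p s * Re (U s) - p s * Re (U' s)) - p0 / 2 * G" by (simp add: algebra_simps)
  qed
  then show ?thesis using c1 c2 by (simp add: F_def char_curve_def G_def)
qed

section \<open>Existence of a holomorphic characteristic flow by Picard iteration\<close>

lemma integral_Times_holomorphic:
  fixes g :: "real \<Rightarrow> complex \<Rightarrow> complex"
  assumes S: "open S" "convex S" and hol: "\<forall>t\<in>{a..b}. g t holomorphic_on S"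
    and cont: "continuous_on ({a..b} \<times> S) (\<lambda>(t, w). g t w)"
    and bd: "\<forall>t\<in>{a..b}. \<forall>w\<in>S. norm (g t w) \<le> B"
  shows "\<And>t w. t \<in> {a..b} \<Longrightarrow> w \<in> S \<Longrightarrow> ((\<lambda>t. integral {a..t} (\<lambda>s. g s w)) has_vector_derivative g t w) (at t within {a..b})"
    and "\<And>t. t \<in> {a..b} \<Longrightarrow> (\<lambda>w. integral {a..t} (\<lambda>s. g s w)) holomorphic_on S"
    and "continuous_on ({a..b} \<times> S) (\<lambda>(t, w). integral {a..t} (\<lambda>s. g s w))"
    and "\<And>t w. t \<in> {a..b} \<Longrightarrow> w \<in> S \<Longrightarrow> norm (integral {a..t} (\<lambda>s. g s w)) \<le> B * (b - a)"
proof -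
  show d: "((\<lambda>t. integral {a..t} (\<lambda>s. g s w)) has_vector_derivative g t w) (at t within {a..b})"
    if t: "t \<in> {a..b}" and w: "w \<in> S" for t w
  proof (rule integral_has_vector_derivative[OF _ t])
    have "continuous_on {a..b} (\<lambda>t. case (t, w) of (t, w) \<Rightarrow> g t w)"
      by (rule continuous_on_compose2[OF cont]) (use w in \<open>auto intro!: continuous_intros\<close>)
    then show "continuous_on {a..b} (\<lambda>s. g s w)" by simp
  qed
  show h: "(\<lambda>w. integral {a..t} (\<lambda>s. g s w)) holomorphic_on S" if t: "t \<in> {a..b}" for t
  proof (rule integral_holomorphic[OF S])
    show "continuous_on ({a..t} \<times> S) (\<lambda>(t, w). g t w)"
      by (rule continuous_on_subset[OF cont]) (use t in auto)
  qed (use t hol in auto)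
  have lip: "norm (integral {a..t} (\<lambda>s. g s w) - integral {a..t'} (\<lambda>s. g s w)) \<le> B * \<bar>t - t'\<bar>"
    if "t \<in> {a..b}" "t' \<in> {a..b}" "w \<in> S" for t t' w
    by (rule vector_mvt_bound[OF d[OF _ that(3)]]) (use that bd in auto)
  show "continuous_on ({a..b} \<times> S) (\<lambda>(t, w). integral {a..t} (\<lambda>s. g s w))"
    by (rule continuous_on_Times_Lipschitz[OF lip]) (use h holomorphic_on_imp_continuous_on in auto)
  show "norm (integral {a..t} (\<lambda>s. g s w)) \<le> B * (b - a)" if t: "t \<in> {a..b}" and w: "w \<in> S" for t w
  proof -
    have B: "0 \<le> B" using bd t w norm_ge_zero order_trans by blast
    have "norm (integral {a..t} (\<lambda>s. g s w)) \<le> B * \<bar>t - a\<bar>" using lip[OF t _ w, of a] t by simp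
    also have "\<dots> \<le> B * (b - a)" using t B by (intro mult_left_mono) auto
    finally show ?thesis .
  qed
qed

definition char_U :: "(real \<Rightarrow> real) \<Rightarrow> (complex \<Rightarrow> complex) \<Rightarrow> real \<Rightarrow> (real \<Rightarrow> complex \<Rightarrow> complex) \<Rightarrow> real \<Rightarrow> complex \<Rightarrow> complex" where
  "char_U q U0 a H t w = U0 w + integral {a..t} (\<lambda>s. q s * (w * exp (H s w) - (w * exp (H s w))\<^sup>2))"

text \<open>The Picard operator for the displacement alone: the velocity is eliminated through
  \<open>char_U\<close>, so the iteration has a single unknown.\<close>

definition char_h :: "(real \<Rightarrow> real) \<Rightarrow> (real \<Rightarrow> real) \<Rightarrow> (complex \<Rightarrow> complex) \<Rightarrow> real \<Rightarrow> (real \<Rightarrow> complex \<Rightarrow> complex) \<Rightarrow> real \<Rightarrow> complex \<Rightarrow> complex" where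
  "char_h p q U0 a H t w = integral {a..t} (\<lambda>s. p s * char_U q U0 a H s w)"

text \<open>The class in which the iteration runs. The bound 1 is the one under which the estimates
  of the force hold.\<close>

definition char_admissible :: "real \<Rightarrow> real \<Rightarrow> real \<Rightarrow> (real \<Rightarrow> complex \<Rightarrow> complex) \<Rightarrow> bool" where
  "char_admissible a b R H \<longleftrightarrow> continuous_on ({a..b} \<times> ball 0 R) (\<lambda>(t, w). H t w) \<and>
     (\<forall>t\<in>{a..b}. H t holomorphic_on ball 0 R \<and> (\<forall>w\<in>ball 0 R. norm (H t w) \<le> 1))"

context
  fixes p q :: "real \<Rightarrow> real" and U0 :: "complex \<Rightarrow> complex" and a b R :: real
  assumes ab: "a \<le> b" "b - a \<le> 1 / 1000"
    and p01: "\<And>t. t \<in> {a..b} \<Longrightarrow> 0 \<le> p t \<and> p t \<le> 1"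
    and q01: "\<And>t. t \<in> {a..b} \<Longrightarrow> 0 \<le> q t \<and> q t \<le> 1"
    and pq: "continuous_on {a..b} p" "continuous_on {a..b} q"
    and R: "0 < R" "R \<le> 2"
    and U0: "U0 holomorphic_on ball 0 R" "\<And>w. w \<in> ball 0 R \<Longrightarrow> norm (U0 w) \<le> 3"
begin

text \<open>The velocity moves by at most 42 (b - a) \<le> 1 from its initial bound 3, hence the
  bound 4. In turn 4 (b - a) \<le> 1 returns the displacement to the admissible class.\<close>

lemma char_U_props:
  fixes H :: "real \<Rightarrow> complex \<Rightarrow> complex"
  assumes H: "char_admissible a b R H"
  shows "\<And>t w. t \<in> {a..b} \<Longrightarrow> w \<in> ball 0 R \<Longrightarrow>
      ((\<lambda>t. char_U q U0 a H t w) has_vector_derivative q t * (w * exp (H t w) - (w * exp (H t w))\<^sup>2)) (at t within {a..b})"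
    and "\<And>t. t \<in> {a..b} \<Longrightarrow> char_U q U0 a H t holomorphic_on ball 0 R"
    and "continuous_on ({a..b} \<times> ball 0 R) (\<lambda>(t, w). char_U q U0 a H t w)"
    and "\<And>t w. t \<in> {a..b} \<Longrightarrow> w \<in> ball 0 R \<Longrightarrow> norm (char_U q U0 a H t w) \<le> 4"
proof -
  let ?g = "\<lambda>s (w::complex). complex_of_real (q s) * (w * exp (H s w) - (w * exp (H s w))\<^sup>2)"
  have hol: "\<forall>t\<in>{a..b}. ?g t holomorphic_on ball 0 R"
    using H by (auto simp: char_admissible_def intro!: holomorphic_intros)
  have qq: "continuous_on ({a..b} \<times> ball (0::complex) R) (\<lambda>x. q (fst x))"
    by (rule continuous_on_compose2[OF pq(2)]) (auto intro!: continuous_intros)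
  have cont: "continuous_on ({a..b} \<times> ball 0 R) (\<lambda>(t, w). ?g t w)"
    using H qq unfolding char_admissible_def case_prod_unfold by (intro continuous_intros) auto
  have bd': "norm (?g t w) \<le> 42" if "t \<in> {a..b}" "w \<in> ball 0 R" for t w
  proof -
    have "norm (?g t w) = q t * norm (w * exp (H t w) - (w * exp (H t w))\<^sup>2)"
      using q01[OF that(1)] by (simp add: norm_mult)
    also have "\<dots> \<le> 1 * 42"
      using q01[OF that(1)] that R H by (intro mult_mono char_force_bound) (auto simp: char_admissible_def)
    finally show ?thesis by simp
  qed
  then have bd: "\<forall>t\<in>{a..b}. \<forall>w\<in>ball 0 R. norm (?g t w) \<le> 42" by blast
  note I = integral_Times_holomorphic[OF open_ball convex_ball hol cont bd]
  show "((\<lambda>t. char_U q U0 a H t w) has_vector_derivative ?g t w) (at t within {a..b})" if "t \<in> {a..b}" "w \<in> ball 0 R" for t w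
    unfolding char_U_def using has_vector_derivative_add[OF has_vector_derivative_const I(1)[OF that], of "U0 w"] by simp
  show "char_U q U0 a H t holomorphic_on ball 0 R" if "t \<in> {a..b}" for t
    unfolding char_U_def[abs_def] by (intro holomorphic_on_add U0 I(2) that)
  show "continuous_on ({a..b} \<times> ball 0 R) (\<lambda>(t, w). char_U q U0 a H t w)"
  proof -
    have "continuous_on ({a..b} \<times> ball 0 R) (\<lambda>x. U0 (snd x))"
      by (rule continuous_on_compose2[OF holomorphic_on_imp_continuous_on[OF U0(1)]]) (auto intro!: continuous_intros)
    then show ?thesis using I(3) unfolding char_U_def case_prod_unfold by (intro continuous_on_add)
  qed
  show "norm (char_U q U0 a H t w) \<le> 4" if "t \<in> {a..b}" "w \<in> ball 0 R" for t w
  proof -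
    have "42 * (b - a) \<le> 1" using ab by simp
    with I(4)[OF that] have "norm (integral {a..t} (\<lambda>s. ?g s w)) \<le> 1" by (rule order_trans)
    then have "norm (U0 w) + norm (integral {a..t} (\<lambda>s. ?g s w)) \<le> 3 + 1"
      by (intro add_mono U0(2)[OF that(2)])
    then show ?thesis unfolding char_U_def by (intro order_trans[OF norm_triangle_ineq]) simp
  qed
qed

lemma char_h_props:
  fixes H :: "real \<Rightarrow> complex \<Rightarrow> complex"
  assumes H: "char_admissible a b R H"
  shows "\<And>t w. t \<in> {a..b} \<Longrightarrow> w \<in> ball 0 R \<Longrightarrow>
      ((\<lambda>t. char_h p q U0 a H t w) has_vector_derivative p t * char_U q U0 a H t w) (at t within {a..b})"
    and "char_admissible a b R (char_h p q U0 a H)"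
proof -
  let ?g = "\<lambda>s w. complex_of_real (p s) * char_U q U0 a H s w"
  have hol: "\<forall>t\<in>{a..b}. ?g t holomorphic_on ball 0 R"
    using char_U_props(2)[OF H] by (auto intro!: holomorphic_intros)
  have pp: "continuous_on ({a..b} \<times> ball (0::complex) R) (\<lambda>x. p (fst x))"
    by (rule continuous_on_compose2[OF pq(1)]) (auto intro!: continuous_intros)
  have cont: "continuous_on ({a..b} \<times> ball 0 R) (\<lambda>(t, w). ?g t w)"
    using char_U_props(3)[OF H] pp unfolding case_prod_unfold by (intro continuous_intros) auto
  have bd': "norm (?g t w) \<le> 4" if "t \<in> {a..b}" "w \<in> ball 0 R" for t w
  proof -
    have "norm (?g t w) = p t * norm (char_U q U0 a H t w)"
      using p01[OF that(1)] by (simp add: norm_mult)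
    also have "\<dots> \<le> 1 * 4"
      using p01[OF that(1)] that by (intro mult_mono char_U_props(4) H) auto
    finally show ?thesis by simp
  qed
  then have bd: "\<forall>t\<in>{a..b}. \<forall>w\<in>ball 0 R. norm (?g t w) \<le> 4" by blast
  note I = integral_Times_holomorphic[OF open_ball convex_ball hol cont bd]
  show "((\<lambda>t. char_h p q U0 a H t w) has_vector_derivative ?g t w) (at t within {a..b})" if "t \<in> {a..b}" "w \<in> ball 0 R" for t w
    unfolding char_h_def by (rule I(1)[OF that])
  show "char_admissible a b R (char_h p q U0 a H)"
    unfolding char_admissible_def char_h_def[abs_def]
  proof (intro conjI ballI)
    fix t :: real and w :: complex assume "t \<in> {a..b}" "w \<in> ball 0 R"
    from I(4)[OF this] have "norm (integral {a..t} (\<lambda>s. ?g s w)) \<le> 4 * (b - a)" .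
    also have "\<dots> \<le> 1" using ab by simp
    finally show "norm (integral {a..t} (\<lambda>s. ?g s w)) \<le> 1" .
  qed (use I(2,3) in auto)
qed

text \<open>The force is 78-Lipschitz in the displacement and the interval is shorter than 1/78, so
  velocities differ by at most e; integrating once more gives e / 2. The estimate holds for each w
  separately.\<close>

lemma char_h_contraction:
  fixes H K :: "real \<Rightarrow> complex \<Rightarrow> complex"
  assumes H: "char_admissible a b R H" and K: "char_admissible a b R K"
    and w: "w \<in> ball 0 R"
    and e: "\<And>t. t \<in> {a..b} \<Longrightarrow> norm (H t w - K t w) \<le> e" and t: "t \<in> {a..b}"
  shows "norm (char_h p q U0 a H t w - char_h p q U0 a K t w) \<le> e / 2"
proof -
  have e0: "e \<ge> 0" using e[OF t] norm_ge_zero order_trans by blast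
  have U: "norm (char_U q U0 a H t w - char_U q U0 a K t w) \<le> e" if t: "t \<in> {a..b}" for t
  proof -
    have "norm ((char_U q U0 a H t w - char_U q U0 a K t w) - (char_U q U0 a H a w - char_U q U0 a K a w)) \<le> 78 * e * \<bar>t - a\<bar>"
    proof (rule vector_mvt_bound[OF has_vector_derivative_diff[OF char_U_props(1)[OF H _ w] char_U_props(1)[OF K _ w]]])
      fix s assume s: "s \<in> {a..b}"
      have "norm (q s * (w * exp (H s w) - (w * exp (H s w))\<^sup>2) - q s * (w * exp (K s w) - (w * exp (K s w))\<^sup>2))
        = q s * norm ((w * exp (H s w) - (w * exp (H s w))\<^sup>2) - (w * exp (K s w) - (w * exp (K s w))\<^sup>2))"
        using q01[OF s] unfolding right_diff_distrib[symmetric] norm_mult by simp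
      also have "\<dots> \<le> 1 * (39 * norm (w - w) + 78 * norm (H s w - K s w))"
        using q01[OF s] H K s w R by (intro mult_mono char_force_Lipschitz) (auto simp: char_admissible_def)
      also have "\<dots> \<le> 78 * e" using e[OF s] by simp
      finally show "norm (q s * (w * exp (H s w) - (w * exp (H s w))\<^sup>2) - q s * (w * exp (K s w) - (w * exp (K s w))\<^sup>2)) \<le> 78 * e" .
    qed (use t ab in auto)
    also have "\<dots> \<le> 78 * e * (1 / 78)" using t ab e0 by (intro mult_left_mono) auto
    finally show ?thesis by (simp add: char_U_def)
  qed
  have "norm ((char_h p q U0 a H t w - char_h p q U0 a K t w) - (char_h p q U0 a H a w - char_h p q U0 a K a w)) \<le> e * \<bar>t - a\<bar>"
  proof (rule vector_mvt_bound[OF has_vector_derivative_diff[OF char_h_props(1)[OF H _ w] char_h_props(1)[OF K _ w]]])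
    fix s assume s: "s \<in> {a..b}"
    have "norm (p s * char_U q U0 a H s w - p s * char_U q U0 a K s w) = p s * norm (char_U q U0 a H s w - char_U q U0 a K s w)"
      using p01[OF s] unfolding right_diff_distrib[symmetric] norm_mult by simp
    also have "\<dots> \<le> 1 * e" using p01[OF s] U[OF s] by (intro mult_mono) auto
    finally show "norm (p s * char_U q U0 a H s w - p s * char_U q U0 a K s w) \<le> e" by simp
  qed (use t ab in auto)
  also have "\<dots> \<le> e * (1 / 2)" using t ab e0 by (intro mult_left_mono) auto
  finally show ?thesis by (simp add: char_h_def)
qed

text \<open>The iterates are partial sums of a telescoping series dominated by powers of 1/2. The
  limit is uniform in time and starting point together, which preserves joint continuity as well as
  holomorphy in w.\<close>

lemma char_flow_exists:
  obtains h U :: "real \<Rightarrow> complex \<Rightarrow> complex" where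
    "\<And>w. w \<in> ball 0 R \<Longrightarrow> char_curve p q a b w (\<lambda>t. h t w) (\<lambda>t. U t w)"
    "\<And>w. w \<in> ball 0 R \<Longrightarrow> U a w = U0 w"
    "\<And>t. t \<in> {a..b} \<Longrightarrow> h t holomorphic_on ball 0 R"
    "\<And>t. t \<in> {a..b} \<Longrightarrow> U t holomorphic_on ball 0 R"
    "\<And>t w. t \<in> {a..b} \<Longrightarrow> w \<in> ball 0 R \<Longrightarrow> norm (U t w) \<le> 4"
    "continuous_on ({a..b} \<times> ball 0 R) (\<lambda>(t, w). h t w)"
    "continuous_on ({a..b} \<times> ball 0 R) (\<lambda>(t, w). U t w)"
proof -
  define Hn where "Hn n = (char_h p q U0 a ^^ n) (\<lambda>_ _. 0)" for n
  have HSuc: "Hn (Suc n) = char_h p q U0 a (Hn n)" for n by (simp add: Hn_def)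
  have adm: "char_admissible a b R (Hn n)" for n
  proof (induction n)
    case 0 then show ?case by (simp add: Hn_def char_admissible_def case_prod_unfold)
  next
    case (Suc n) then show ?case unfolding HSuc by (rule char_h_props(2))
  qed
  let ?A = "{a..b} \<times> ball (0::complex) R"
  have diff: "norm (Hn (Suc n) t w - Hn n t w) \<le> (1 / 2) ^ n" if "w \<in> ball 0 R" "t \<in> {a..b}" for n t w
    using that(2)
  proof (induction n arbitrary: t)
    case 0
    then show ?case using adm[of 1] that unfolding char_admissible_def by (auto simp: Hn_def)
  next
    case (Suc n)
    have "norm (char_h p q U0 a (Hn (Suc n)) t w - char_h p q U0 a (Hn n) t w) \<le> (1 / 2) ^ n / 2"
      by (rule char_h_contraction[OF adm adm that(1) Suc.IH Suc.prems])
    then show ?case by (simp add: HSuc[symmetric])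
  qed
  define D where "D n x = Hn (Suc n) (fst x) (snd x) - Hn n (fst x) (snd x)" for n x
  define H where "H t w = (\<Sum>n. D n (t, w))" for t w
  have ps: "(\<Sum>i<n. D i x) = Hn n (fst x) (snd x)" for n x
    by (induction n) (simp_all add: D_def Hn_def)
  have "uniform_limit ?A (\<lambda>n x. \<Sum>i<n. D i x) (\<lambda>x. suminf (\<lambda>i. D i x)) sequentially"
  proof (rule Weierstrass_m_test)
    show "summable (\<lambda>n. (1 / 2 :: real) ^ n)" by (rule summable_geometric) simp
    show "norm (D n x) \<le> (1 / 2) ^ n" if "x \<in> ?A" for n x using diff[of "snd x" "fst x" n] that by (auto simp: D_def)
  qed
  then have ul: "uniform_limit ?A (\<lambda>n (t, w). Hn n t w) (\<lambda>(t, w). H t w) sequentially"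
    by (simp add: ps H_def case_prod_unfold)
  have admH: "char_admissible a b R H"
    unfolding char_admissible_def
  proof (intro conjI ballI)
    show "continuous_on ?A (\<lambda>(t, w). H t w)"
      by (rule uniform_limit_theorem[OF _ ul]) (use adm in \<open>auto simp: char_admissible_def\<close>)
    fix t assume t: "t \<in> {a..b}"
    have ult: "uniform_limit (ball 0 R) (\<lambda>n w. Hn n t w) (\<lambda>w. H t w) sequentially"
      unfolding uniform_limit_iff
    proof (intro allI impI)
      fix e :: real assume "e > 0"
      with ul have "\<forall>\<^sub>F n in sequentially. \<forall>x\<in>?A. dist (case x of (t, w) \<Rightarrow> Hn n t w) (case x of (t, w) \<Rightarrow> H t w) < e"
        by (simp add: uniform_limit_iff)
      then show "\<forall>\<^sub>F n in sequentially. \<forall>w\<in>ball 0 R. dist (Hn n t w) (H t w) < e"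
        by (rule eventually_mono) (use t in fastforce)
    qed
    show "H t holomorphic_on ball 0 R"
    proof (rule holomorphic_uniform_sequence[OF open_ball, of "\<lambda>n. Hn n t"])
      show "Hn n t holomorphic_on ball 0 R" for n using adm t by (auto simp: char_admissible_def)
      fix x :: complex assume x: "x \<in> ball 0 R"
      obtain d where "d > 0" "cball x d \<subseteq> ball 0 R" using x open_contains_cball[of "ball (0::complex) R"] by (metis open_ball)
      then show "\<exists>d>0. cball x d \<subseteq> ball 0 R \<and> uniform_limit (cball x d) (\<lambda>n. Hn n t) (H t) sequentially"
        using uniform_limit_on_subset[OF ult] by blast
    qed
    fix w :: complex assume w: "w \<in> ball 0 R"
    have "(\<lambda>n. Hn n t w) \<longlonglongrightarrow> H t w" using tendsto_uniform_limitI[OF ult w] .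
    then show "norm (H t w) \<le> 1"
      by (rule Lim_norm_ubound[rotated]) (use adm t w in \<open>auto simp: char_admissible_def\<close>)
  qed
  have fixp: "char_h p q U0 a H t w = H t w" if t: "t \<in> {a..b}" and w: "w \<in> ball 0 R" for t w
  proof -
    have "norm (char_h p q U0 a H t w - H t w) \<le> e" if e: "e > 0" for e
    proof -
      have "\<forall>\<^sub>F n in sequentially. \<forall>x\<in>?A. dist (case x of (t, w) \<Rightarrow> Hn n t w) (case x of (t, w) \<Rightarrow> H t w) < e / 2"
        by (rule uniform_limitD[OF ul]) (use e in simp)
      then obtain N where N: "\<forall>n\<ge>N. \<forall>x\<in>?A. dist (case x of (t, w) \<Rightarrow> Hn n t w) (case x of (t, w) \<Rightarrow> H t w) < e / 2"
        unfolding eventually_sequentially by blast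
      have N: "norm (Hn n t w - H t w) < e / 2" if "n \<ge> N" "t \<in> {a..b}" "w \<in> ball 0 R" for n t w
        using N that by (fastforce simp: dist_norm)
      have "norm (char_h p q U0 a H t w - char_h p q U0 a (Hn N) t w) \<le> (e / 2) / 2"
        
      proof (rule char_h_contraction[OF admH adm w _ t])
        show "norm (H t w - Hn N t w) \<le> e / 2" if "t \<in> {a..b}" for t
          using N[OF order_refl that w] by (simp add: norm_minus_commute)
      qed
      moreover have "norm (char_h p q U0 a (Hn N) t w - H t w) < e / 2"
        using N[of "Suc N" t w] t w by (simp add: HSuc)
      ultimately show ?thesis
        using norm_diff_triangle_ineq[of "char_h p q U0 a H t w" "char_h p q U0 a (Hn N) t w" "char_h p q U0 a (Hn N) t w" "H t w"] e by simp
    qed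
    then have "norm (char_h p q U0 a H t w - H t w) \<le> 0" by (rule field_le_epsilon[of _ 0, simplified])
    then show ?thesis by simp
  qed
  show thesis
  \<comment> \<open>The image of the limit under the operator serves as the flow, since its
    derivatives are already known; the fixed point equation only rewrites the force at a given
    time.\<close>
  proof (rule that[of "char_h p q U0 a H" "char_U q U0 a H"])
    fix w assume w: "w \<in> ball (0::complex) R"
    show "char_curve p q a b w (\<lambda>t. char_h p q U0 a H t w) (\<lambda>t. char_U q U0 a H t w)"
      unfolding char_curve_def
    proof (intro conjI ballI)
      show "char_h p q U0 a H a w = 0" by (simp add: char_h_def)
      fix t assume t: "t \<in> {a..b}"
      show "norm (char_h p q U0 a H t w) \<le> 1" using char_h_props(2)[OF admH] t w by (auto simp: char_admissible_def)
      show "((\<lambda>t. char_h p q U0 a H t w) has_vector_derivative p t * char_U q U0 a H t w) (at t within {a..b})"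
        by (rule char_h_props(1)[OF admH t w])
      show "((\<lambda>t. char_U q U0 a H t w) has_vector_derivative q t * (w * exp (char_h p q U0 a H t w) - (w * exp (char_h p q U0 a H t w))\<^sup>2)) (at t within {a..b})"
        unfolding fixp[OF t w] by (rule char_U_props(1)[OF admH t w])
    qed
    show "char_U q U0 a H a w = U0 w" by (simp add: char_U_def)
  qed (use char_h_props(2)[OF admH] char_U_props(2-4)[OF admH] in \<open>auto simp: char_admissible_def\<close>)
qed

end

section \<open>Lagrange inversion\<close>

lemma lagrange_inversion_contour:
  fixes h G :: "complex \<Rightarrow> complex" and \<xi> :: "nat \<Rightarrow> complex"
  assumes hol: "h holomorphic_on ball 0 R" "G holomorphic_on ball 0 R"
    and summ: "\<And>v. norm v < 1 \<Longrightarrow> summable (\<lambda>k. \<xi> k * v ^ k)"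
    and r1: "0 < r1" "r1 \<le> R"
    and lt1: "\<And>w. norm w < r1 \<Longrightarrow> norm (w * exp (h w)) < 1"
    and G: "\<And>w. norm w < r1 \<Longrightarrow> G w = (\<Sum>k. \<xi> k * (w * exp (h w)) ^ k)"
    and i: "i \<ge> 1" and r: "0 < r" "r < R"
  shows "contour_integral (circlepath 0 r) (\<lambda>w. deriv G w * exp (- of_nat i * h w) / w ^ i)
     = 2 * pi * \<i> * (of_nat i * \<xi> i)"
proof -
  define f where "f = (\<lambda>w. deriv G w * exp (- of_nat i * h w))"
  have holf: "f holomorphic_on ball 0 R"
    unfolding f_def by (intro holomorphic_intros holomorphic_deriv hol) auto
  \<comment> \<open>By Cauchy's formula the integral is a derivative at 0, so the circle of radius r
    may be replaced by a small one.\<close>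
  have indep: "contour_integral (circlepath 0 s) (\<lambda>w. f w / w ^ i) = (2 * pi * \<i>) * (deriv ^^ (i - 1)) f 0 / fact (i - 1)"
    if "0 < s" "s < R" for s
    using Cauchy_contour_integral_circlepath[of 0 s f 0 "i - 1"] that i
      holomorphic_on_subset[OF holf] holomorphic_on_imp_continuous_on[OF holomorphic_on_subset[OF holf]]
    by (auto simp: subset_iff)
  define s where "s = r1 / 2"
  have s: "0 < s" "s < r1" "s < R" using r1 by (auto simp: s_def)
  define Z where "Z = (\<lambda>w. w * exp (h w))"
  define Z' where "Z' = (\<lambda>w. exp (h w) * (1 + w * deriv h w))"
  have hd: "(h has_field_derivative deriv h w) (at w)" if "norm w < r1" for w
    using hol(1) that r1 by (auto intro!: holomorphic_derivI[of _ "ball 0 R"])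
  have Zd: "(Z has_field_derivative Z' w) (at w)" if "norm w < r1" for w
    unfolding Z_def Z'_def using hd[OF that] by (auto intro!: derivative_eq_intros simp: algebra_simps)
  have Z0: "Z w \<noteq> 0" if "w \<noteq> 0" for w using that by (simp add: Z_def)
  \<comment> \<open>The tail starts at index i + 1: after differentiation it still contains Z^i, so
    division by Z^i leaves the holomorphic function \<open>A\<close>.\<close>
  define Q where "Q = (\<lambda>v. \<Sum>k. \<xi> (k + Suc i) * v ^ k)"
  have Qhol: "Q holomorphic_on ball 0 1"
  proof (rule power_series_holomorphic)
    fix v :: complex assume "v \<in> ball 0 1"
    then have "summable (\<lambda>k. \<xi> k * v ^ k)" by (intro summ) auto
    then have "summable (\<lambda>k. \<xi> (k + Suc i) * v ^ k)"
      by (simp only: summable_powser_ignore_initial_segment)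
    then show "(\<lambda>k. \<xi> (k + Suc i) * (v - 0) ^ k) sums Q v"
      unfolding Q_def by (simp add: summable_sums)
  qed
  have Qd: "(Q has_field_derivative deriv Q (Z w)) (at (Z w))" if "norm w < r1" for w
    using Qhol lt1[OF that] by (auto intro!: holomorphic_derivI[of _ "ball 0 1"] simp: Z_def)
  have Gsplit: "G w = (\<Sum>k\<le>i. \<xi> k * Z w ^ k) + Z w ^ Suc i * Q (Z w)" if w: "norm w < r1" for w
  proof -
    have sm: "summable (\<lambda>k. \<xi> k * Z w ^ k)" using summ lt1[OF w] by (simp add: Z_def)
    then have sm': "summable (\<lambda>k. \<xi> (k + Suc i) * Z w ^ k)"
      by (simp only: summable_powser_ignore_initial_segment)
    have "G w = (\<Sum>k. \<xi> k * Z w ^ k)" using G[OF w] by (simp add: Z_def)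
    also have "\<dots> = (\<Sum>k. \<xi> (k + Suc i) * Z w ^ (k + Suc i)) + (\<Sum>k<Suc i. \<xi> k * Z w ^ k)"
      by (rule suminf_split_initial_segment[OF sm])
    also have "(\<Sum>k. \<xi> (k + Suc i) * Z w ^ (k + Suc i)) = (\<Sum>k. Z w ^ Suc i * (\<xi> (k + Suc i) * Z w ^ k))"
      by (simp add: power_add mult_ac)
    also have "\<dots> = Z w ^ Suc i * Q (Z w)"
      unfolding Q_def by (rule suminf_mult[OF sm'])
    finally show ?thesis by (simp add: lessThan_Suc_atMost add.commute)
  qed
  define A where "A = (\<lambda>w. (of_nat (Suc i) * Q (Z w) + Z w * deriv Q (Z w)) * Z' w)"
  have Gd: "deriv G w = (\<Sum>k\<le>i. \<xi> k * (of_nat k * Z w ^ (k - 1) * Z' w)) + Z w ^ i * A w"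
    if w: "norm w < r1" for w
  proof -
    have QZ: "((\<lambda>w. Q (Z w)) has_field_derivative deriv Q (Z w) * Z' w) (at w)"
      using DERIV_chain2[OF Qd[OF w] Zd[OF w]] .
    have "((\<lambda>w. (\<Sum>k\<le>i. \<xi> k * Z w ^ k) + Z w ^ Suc i * Q (Z w)) has_field_derivative
       (\<Sum>k\<le>i. \<xi> k * (of_nat k * Z w ^ (k - 1) * Z' w)) + Z w ^ i * A w) (at w)"
      using QZ Zd[OF w] i power_minus_mult[of i "Z w"] unfolding A_def
      by (auto intro!: derivative_eq_intros sum.cong simp: algebra_simps)
    then have "(G has_field_derivative (\<Sum>k\<le>i. \<xi> k * (of_nat k * Z w ^ (k - 1) * Z' w)) + Z w ^ i * A w) (at w)"
      by (rule has_field_derivative_transform_within_open[of _ _ _ "ball 0 r1"]) (use w Gsplit in auto)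
    then show ?thesis by (rule DERIV_imp_deriv)
  qed
  have fexp: "f w / w ^ i = (\<Sum>k<i. \<xi> k * of_nat k * (Z' w / Z w ^ Suc (i - k))) + of_nat i * \<xi> i * (1 / w + deriv h w) + A w"
    if w: "norm w < r1" "w \<noteq> 0" for w
  proof -
    have "exp (- of_nat i * h w) / w ^ i = inverse (Z w ^ i)"
      by (simp add: Z_def power_mult_distrib exp_minus exp_of_nat_mult field_simps)
    moreover have "f w / w ^ i = deriv G w * (exp (- of_nat i * h w) / w ^ i)" by (simp add: f_def)
    ultimately have "f w / w ^ i = deriv G w / Z w ^ i" by (simp add: divide_inverse)
    also have "\<dots> = (\<Sum>k\<le>i. \<xi> k * (of_nat k * Z w ^ (k - 1) * Z' w) / Z w ^ i) + A w"
      unfolding Gd[OF w(1)] using Z0[OF w(2)] by (simp add: add_divide_distrib sum_divide_distrib)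
    also have "(\<Sum>k\<le>i. \<xi> k * (of_nat k * Z w ^ (k - 1) * Z' w) / Z w ^ i)
        = (\<Sum>k<i. \<xi> k * (of_nat k * Z w ^ (k - 1) * Z' w) / Z w ^ i) + \<xi> i * (of_nat i * Z w ^ (i - 1) * Z' w) / Z w ^ i"
      by (simp add: lessThan_Suc_atMost[symmetric])
    also have "(\<Sum>k<i. \<xi> k * (of_nat k * Z w ^ (k - 1) * Z' w) / Z w ^ i) = (\<Sum>k<i. \<xi> k * of_nat k * (Z' w / Z w ^ Suc (i - k)))"
    proof (rule sum.cong[OF refl])
      fix k assume k: "k \<in> {..<i}"
      show "\<xi> k * (of_nat k * Z w ^ (k - 1) * Z' w) / Z w ^ i = \<xi> k * of_nat k * (Z' w / Z w ^ Suc (i - k))"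
      proof (cases k)
        case (Suc j)
        have "Z w ^ i = Z w ^ (k - 1) * Z w ^ Suc (i - k)"
          unfolding power_add[symmetric] using k Suc by simp
        then show ?thesis using Z0[OF w(2)] by simp
      qed simp
    qed
    also have "\<xi> i * (of_nat i * Z w ^ (i - 1) * Z' w) / Z w ^ i = of_nat i * \<xi> i * (Z' w / Z w)"
      using Z0[OF w(2)] i by (cases i) auto
    also have "Z' w / Z w = 1 / w + deriv h w" using w by (simp add: Z_def Z'_def field_simps)
    finally show ?thesis .
  qed
  have pimg: "path_image (circlepath 0 s) \<subseteq> ball 0 r1 - {0}" using s by auto
  have 1: "((\<lambda>w. Z' w / Z w ^ Suc (i - k)) has_contour_integral 0) (circlepath 0 s)" if "k < i" for k
  proof -
    define m where "m = i - k"
    have m: "m \<ge> 1" using that by (simp add: m_def)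
    have "((\<lambda>w. Z' w / Z w ^ Suc m) has_contour_integral
        ((\<lambda>w. - (1 / of_nat m) * inverse (Z w ^ m)) (pathfinish (circlepath 0 s)) - (\<lambda>w. - (1 / of_nat m) * inverse (Z w ^ m)) (pathstart (circlepath 0 s)))) (circlepath 0 s)"
    proof (rule contour_integral_primitive[where S = "ball 0 r1 - {0}"])
      fix w :: complex assume "w \<in> ball 0 r1 - {0}"
      then have w: "norm w < r1" "w \<noteq> 0" by auto
      have "((\<lambda>w. - (1 / of_nat m) * inverse (Z w ^ m)) has_field_derivative Z' w / Z w ^ Suc m) (at w)"
        using Zd[OF w(1)] Z0[OF w(2)] m
        by (auto intro!: derivative_eq_intros simp: field_simps power_Suc[symmetric] power_add[symmetric] simp del: power_Suc)
      then show "((\<lambda>w. - (1 / of_nat m) * inverse (Z w ^ m)) has_field_derivative Z' w / Z w ^ Suc m) (at w within ball 0 r1 - {0})"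
        by (rule DERIV_subset) auto
    qed (use pimg in auto)
    then show ?thesis by (simp add: m_def)
  qed
  have 2: "((\<lambda>w. 1 / w) has_contour_integral 2 * pi * \<i>) (circlepath 0 s)"
    using Cauchy_integral_circlepath_simple[of "\<lambda>_. 1" 0 s 0] s by simp
  have Zhol: "Z holomorphic_on ball 0 r1" 
    unfolding holomorphic_on_open[OF open_ball] using Zd by (metis mem_ball_0)
  have hhol: "deriv h holomorphic_on ball 0 r1"
    using hol(1) r1 by (intro holomorphic_deriv holomorphic_on_subset[OF hol(1)]) auto
  have QZhol: "(\<lambda>w. q (Z w)) holomorphic_on ball 0 r1" if "q holomorphic_on ball 0 1" for q
  proof -
    have "Z ` ball 0 r1 \<subseteq> ball 0 1" using lt1 by (auto simp: Z_def)
    from holomorphic_on_compose_gen[OF Zhol that this] show ?thesis by (simp add: o_def)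
  qed
  have Ahol: "A holomorphic_on ball 0 r1"
    unfolding A_def Z'_def
    by (intro holomorphic_intros QZhol Qhol holomorphic_deriv Zhol hhol holomorphic_on_subset[OF hol(1)]) (use r1 in auto)
  have 3: "(deriv h has_contour_integral 0) (circlepath 0 s)" "(A has_contour_integral 0) (circlepath 0 s)"
    using pimg by (auto intro!: Cauchy_theorem_disc_simple[OF hhol] Cauchy_theorem_disc_simple[OF Ahol])
  have "((\<lambda>w. (\<Sum>k<i. \<xi> k * of_nat k * (Z' w / Z w ^ Suc (i - k))) + of_nat i * \<xi> i * (1 / w + deriv h w) + A w) has_contour_integral
     (\<Sum>k<i. \<xi> k * of_nat k * 0) + of_nat i * \<xi> i * (2 * pi * \<i> + 0) + 0) (circlepath 0 s)"
    by (intro has_contour_integral_add has_contour_integral_sum has_contour_integral_lmul 1 2 3) auto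
  then have "((\<lambda>w. f w / w ^ i) has_contour_integral (\<Sum>k<i. \<xi> k * of_nat k * 0) + of_nat i * \<xi> i * (2 * pi * \<i> + 0) + 0) (circlepath 0 s)"
  proof (rule has_contour_integral_eq)
    fix x assume "x \<in> path_image (circlepath 0 s)"
    then have "norm x < r1" "x \<noteq> 0" using pimg by auto
    from fexp[OF this] show "(\<Sum>k<i. \<xi> k * of_nat k * (Z' x / Z x ^ Suc (i - k))) + of_nat i * \<xi> i * (1 / x + deriv h x) + A x = f x / x ^ i"
      by (rule sym)
  qed
  then have "contour_integral (circlepath 0 s) (\<lambda>w. f w / w ^ i) = 2 * pi * \<i> * (of_nat i * \<xi> i)"
    by (simp add: contour_integral_unique)
  then show ?thesis using indep[OF s(1,3)] indep[OF r] by (simp add: f_def)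
qed

section \<open>The system of differential equations\<close>

text \<open>The integrating factor makes f exp (- integral of g) monotone. Neither f nor g has a
  prescribed sign, so the same form serves for positivity and for uniqueness.\<close>

lemma gronwall_lower:
  fixes f g :: "real \<Rightarrow> real"
  assumes d: "\<And>s. s \<in> {a..b} \<Longrightarrow> (f has_real_derivative f' s) (at s within {a..b})"
    and g: "continuous_on {a..b} g" and le: "\<And>s. s \<in> {a..b} \<Longrightarrow> g s * f s \<le> f' s" and t: "t \<in> {a..b}"
  shows "f a * exp (integral {a..t} g) \<le> f t"
proof -
  define G where "G s = integral {a..s} g" for s
  have G: "(G has_real_derivative g s) (at s within {a..b})" if "s \<in> {a..b}" for s
    unfolding G_def using integral_has_real_derivative[OF g that] .
  have "f a * exp (- G a) \<le> f t * exp (- G t)"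
  proof (rule nonneg_derivative_imp_le[OF _ _ t])
    fix s assume s: "s \<in> {a..b}"
    show "((\<lambda>s. f s * exp (- G s)) has_real_derivative (f' s - g s * f s) * exp (- G s)) (at s within {a..b})"
      by (auto intro!: derivative_eq_intros d[OF s] G[OF s] simp: algebra_simps)
    show "0 \<le> (f' s - g s * f s) * exp (- G s)" using le[OF s] by simp
  qed
  then have "f a \<le> f t * exp (- G t)" by (simp add: G_def)
  then have "f a * exp (G t) \<le> f t * exp (- G t) * exp (G t)" by (rule mult_right_mono) simp
  also have "\<dots> = f t" by (simp add: mult.assoc flip: exp_add)
  finally show ?thesis by (simp add: G_def)
qed

text \<open>The lower bound is applied to minus the squared norm, which starts at 0 and is never
  positive.\<close>

lemma gronwall_zero:
  fixes E :: "real \<Rightarrow> complex"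
  assumes d: "\<And>s. s \<in> {a..b} \<Longrightarrow> (E has_vector_derivative E' s) (at s within {a..b})"
    and le: "\<And>s. s \<in> {a..b} \<Longrightarrow> norm (E' s) \<le> K * norm (E s)" and E0: "E a = 0" and t: "t \<in> {a..b}"
  shows "E t = 0"
proof -
  let ?f = "\<lambda>s. - ((Re (E s))\<^sup>2 + (Im (E s))\<^sup>2)"
  have "?f a * exp (integral {a..t} (\<lambda>_. 2 * K)) \<le> ?f t"
  proof (rule gronwall_lower[OF _ _ _ t])
    fix s assume s: "s \<in> {a..b}"
    show "(?f has_real_derivative - (2 * Re (E s) * Re (E' s) + 2 * Im (E s) * Im (E' s))) (at s within {a..b})"
      by (auto intro!: derivative_eq_intros d[OF s])
    have "Re (E s) * Re (E' s) + Im (E s) * Im (E' s) = Re (E s * cnj (E' s))" by simp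
    also have "\<dots> \<le> norm (E s * cnj (E' s))" by (rule complex_Re_le_cmod)
    also have "\<dots> \<le> norm (E s) * (K * norm (E s))" unfolding norm_mult using le[OF s] by (intro mult_left_mono) auto
    also have "\<dots> = K * ((Re (E s))\<^sup>2 + (Im (E s))\<^sup>2)" using cmod_power2[of "E s"] by (simp add: power2_eq_square mult_ac)
    finally have "2 * (Re (E s) * Re (E' s) + Im (E s) * Im (E' s)) \<le> 2 * (K * ((Re (E s))\<^sup>2 + (Im (E s))\<^sup>2))" by simp
    then show "2 * K * ?f s \<le> - (2 * Re (E s) * Re (E' s) + 2 * Im (E s) * Im (E' s))" by (simp add: algebra_simps)
  qed (auto intro: continuous_intros)
  then have "(Re (E t))\<^sup>2 + (Im (E t))\<^sup>2 \<le> 0" using E0 by simp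
  then show ?thesis by (simp add: complex_eq_iff sum_power2_le_zero_iff)
qed

lemma series_has_vector_derivative:
  fixes f f' :: "nat \<Rightarrow> real \<Rightarrow> complex"
  assumes d: "\<And>n t. t \<in> {a..b} \<Longrightarrow> (f n has_vector_derivative f' n t) (at t within {a..b})"
    and M: "\<And>n t. t \<in> {a..b} \<Longrightarrow> norm (f' n t) \<le> M n" "summable M"
    and t0: "t0 \<in> {a..b}" "summable (\<lambda>n. f n t0)" and t: "t \<in> {a..b}"
  shows "((\<lambda>t. \<Sum>n. f n t) has_vector_derivative (\<Sum>n. f' n t)) (at t within {a..b})"
proof -
  have ul: "uniform_limit {a..b} (\<lambda>n x. \<Sum>i<n. f' i x) (\<lambda>x. suminf (\<lambda>i. f' i x)) sequentially"
    by (rule Weierstrass_m_test[OF M])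
  have "\<exists>g. \<forall>t\<in>{a..b}. (\<lambda>n. f n t) sums g t \<and> (g has_derivative (\<lambda>y. y *\<^sub>R (\<Sum>n. f' n t))) (at t within {a..b})"
  proof (rule has_derivative_series[where f' = "\<lambda>n t y. y *\<^sub>R f' n t"])
    show "\<And>n x. x \<in> {a..b} \<Longrightarrow> (f n has_derivative (\<lambda>y. y *\<^sub>R f' n x)) (at x within {a..b})"
      using d by (simp add: has_vector_derivative_def)
    show "\<forall>\<^sub>F n in sequentially. \<forall>x\<in>{a..b}. \<forall>h. norm ((\<Sum>i<n. h *\<^sub>R f' i x) - h *\<^sub>R (\<Sum>n. f' n x)) \<le> e * norm h" if "0 < e" for e
      using uniform_limitD[OF ul that]
    proof (rule eventually_mono, intro ballI allI)
      fix n x and h :: real assume "\<forall>x\<in>{a..b}. dist (\<Sum>i<n. f' i x) (\<Sum>i. f' i x) < e" "x \<in> {a..b}"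
      then have "norm ((\<Sum>i<n. f' i x) - (\<Sum>n. f' n x)) \<le> e" by (auto simp: dist_norm intro: less_imp_le)
      then have "\<bar>h\<bar> * norm ((\<Sum>i<n. f' i x) - (\<Sum>n. f' n x)) \<le> \<bar>h\<bar> * e" by (rule mult_left_mono) simp
      then show "norm ((\<Sum>i<n. h *\<^sub>R f' i x) - h *\<^sub>R (\<Sum>n. f' n x)) \<le> e * norm h"
        unfolding scaleR_right.sum[symmetric] scaleR_right_diff_distrib[symmetric] norm_scaleR by (simp add: mult.commute)
    qed
    show "(\<lambda>n. f n t0) sums (\<Sum>n. f n t0)" using t0(2) by (rule summable_sums)
  qed (use t0 in auto)
  then obtain g where g: "\<And>t. t \<in> {a..b} \<Longrightarrow> (\<lambda>n. f n t) sums g t"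
    "\<And>t. t \<in> {a..b} \<Longrightarrow> (g has_vector_derivative (\<Sum>n. f' n t)) (at t within {a..b})"
    unfolding has_vector_derivative_def by blast
  show ?thesis
    by (rule has_vector_derivative_transform[OF t _ g(2)[OF t]]) (use g(1) in \<open>simp add: sums_iff\<close>)
qed

lemma summable_cubic_geometric:
  fixes c :: real assumes "0 \<le> c" "c < 1"
  shows "summable (\<lambda>i. real (Suc i) ^ 3 * c ^ i)"
proof (cases "c = 0")
  case True
  then show ?thesis by (intro summable_finite[of "{0}"]) auto
next
  case False
  then have c: "0 < c" using assms by simp
  have "(\<lambda>i. real (Suc i) ^ 3 * c ^ i) \<in> O(\<lambda>i. ((1 + c) / 2) ^ i)"
    using c assms by real_asymp
  moreover have "summable (\<lambda>i. norm (((1 + c) / 2) ^ i))" using assms c by (simp add: norm_power)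
  ultimately show ?thesis by (rule summable_comparison_test_bigo[rotated])
qed


section \<open>The system in convolution form, and elementary bounds on its solution\<close>

locale bf_process =
  fixes x :: "nat \<Rightarrow> real \<Rightarrow> real"
  assumes sol: "bf_solution x"
begin

definition p :: "real \<Rightarrow> real" where "p t = 1 - (x 1 t)\<^sup>2"
definition q :: "real \<Rightarrow> real" where "q t = (x 1 t)\<^sup>2"

text \<open>The index 0 is reset to 0, so that sums over component sizes become Cauchy products.\<close>

definition X :: "nat \<Rightarrow> real \<Rightarrow> real" where "X i t = (if i = 0 then 0 else x i t)"

text \<open>One formula for the three kinds of equation. The weight k replaces i / 2 by the symmetry
  between k and i - k, so the convolution is the coefficient of z^i in X (z d/dz X). The last term
  is the coefficient of z^2 - z.\<close>

definition rhs :: "nat \<Rightarrow> real \<Rightarrow> real" where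
  "rhs i t = p t * ((\<Sum>k\<le>i. k * X k t * X (i - k) t) - i * X i t) + q t * ((if i = 2 then 1 else 0) - (if i = 1 then 1 else 0))"

lemma bf_rhs_eq:
  assumes i: "i \<ge> 1"
  shows "bf_rhs (\<lambda>j. x j t) i = rhs i t"
proof -
  have sum1: "(\<Sum>k\<le>i. k * X k t * X (i - k) t) = (\<Sum>k = 1..<i. k * (x k t * x (i - k) t))"
    by (rule sum.mono_neutral_cong_right) (auto simp: X_def)
  \<comment> \<open>Reflecting k to i - k and averaging turns the weight k into i / 2.\<close>
  have "(\<Sum>k = 1..<i. real k * (x k t * x (i - k) t)) = (\<Sum>k = 1..<i. real (i - k) * (x (i - k) t * x (i - (i - k)) t))"
    by (rule sum.reindex_bij_witness[of _ "\<lambda>k. i - k" "\<lambda>k. i - k"]) auto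
  also have "\<dots> = (\<Sum>k = 1..<i. real i * (x k t * x (i - k) t) - real k * (x k t * x (i - k) t))"
    by (rule sum.cong) (auto simp: of_nat_diff algebra_simps)
  also have "\<dots> = real i * (\<Sum>k = 1..<i. x k t * x (i - k) t) - (\<Sum>k = 1..<i. real k * (x k t * x (i - k) t))"
    by (simp only: sum_subtractf sum_distrib_left)
  finally have sum2: "(\<Sum>k = 1..<i. real k * (x k t * x (i - k) t)) = real i / 2 * (\<Sum>k = 1..<i. x k t * x (i - k) t)"
    by linarith
  consider "i = 1" | "i = 2" | "i \<ge> 3" using i by linarith
  then show ?thesis
  proof cases
    case 1 then show ?thesis unfolding rhs_def sum1 by (simp add: bf_rhs_def p_def q_def X_def power2_eq_square power3_eq_cube algebra_simps)
  next
    case 2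
    have "{1..<2::nat} = {1}" by auto
    with 2 show ?thesis unfolding rhs_def sum1
      by (simp add: bf_rhs_def p_def q_def X_def power2_eq_square power4_eq_xxxx algebra_simps)
  next
    case 3 then show ?thesis unfolding rhs_def sum1 sum2 by (simp add: bf_rhs_def p_def q_def X_def field_simps)
  qed
qed

lemma X_deriv:
  assumes t: "t \<in> {a..b}" "0 \<le> a"
  shows "(X i has_real_derivative rhs i t) (at t within {a..b})"
proof (cases "i = 0")
  case True
  then show ?thesis by (simp add: X_def[abs_def] rhs_def)
next
  case False
  then have "(x i has_real_derivative bf_rhs (\<lambda>j. x j t) i) (at t within {0..})"
    using sol t by (auto simp: bf_solution_def)
  then have "(x i has_real_derivative rhs i t) (at t within {a..b})"
    using bf_rhs_eq[of i t] False t by (auto intro: DERIV_subset)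
  then show ?thesis using False by (simp add: X_def[abs_def])
qed

lemma X_cont: "0 \<le> a \<Longrightarrow> continuous_on {a..b} (X i)"
  by (rule DERIV_continuous_on[OF X_deriv])

lemma X_0: "X i 0 = (if i = 1 then 1 else 0)"
  using sol by (auto simp: bf_solution_def X_def)

lemma p_eq: "p t = 1 - (X 1 t)\<^sup>2" and q_eq: "q t = (X 1 t)\<^sup>2"
  by (simp_all add: p_def q_def X_def)

lemma pq_cont: "0 \<le> a \<Longrightarrow> continuous_on {a..b} p" "0 \<le> a \<Longrightarrow> continuous_on {a..b} q"
  unfolding p_eq[abs_def] q_eq[abs_def] by (intro continuous_intros X_cont; assumption)+

lemma rhs_1: "rhs 1 t = - X 1 t - (X 1 t)\<^sup>2 + (X 1 t) ^ 3"
  by (simp add: rhs_def X_def p_def q_def power2_eq_square power3_eq_cube algebra_simps)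

lemma X1_pos: "0 \<le> t \<Longrightarrow> 0 < X 1 t"
proof -
  assume t: "0 \<le> t"
  have "X 1 0 * exp (integral {0..t} (\<lambda>s. - 1 - X 1 s + (X 1 s)\<^sup>2)) \<le> X 1 t"
    by (rule gronwall_lower[OF X_deriv]) (use t in \<open>auto intro!: continuous_intros X_cont simp: rhs_1 power2_eq_square power3_eq_cube algebra_simps simp del: One_nat_def\<close>)
  then show ?thesis using exp_gt_zero[of "integral {0..t} (\<lambda>s. - 1 - X 1 s + (X 1 s)\<^sup>2)"] by (simp add: X_0 del: exp_gt_zero)
qed

lemma X1_le: "0 \<le> t \<Longrightarrow> X 1 t \<le> 1"
proof -
  assume t: "0 \<le> t"
  have "(1 - X 1 0) * exp (integral {0..t} (\<lambda>s. (X 1 s)\<^sup>2)) \<le> 1 - X 1 t"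
  proof (rule gronwall_lower[where f = "\<lambda>s. 1 - X 1 s" and b = t and f' = "\<lambda>s. - rhs 1 s"])
    fix s assume s: "s \<in> {0..t}"
    show "((\<lambda>s. 1 - X 1 s) has_real_derivative - rhs 1 s) (at s within {0..t})"
      by (auto intro!: derivative_eq_intros X_deriv s)
    show "(X 1 s)\<^sup>2 * (1 - X 1 s) \<le> - rhs 1 s"
      unfolding rhs_1 using X1_pos[of s] s by (simp add: power2_eq_square power3_eq_cube algebra_simps)
  qed (use t in \<open>auto intro!: continuous_intros X_cont\<close>)
  then show ?thesis by (simp add: X_0)
qed

text \<open>1 - X 1 grows at a rate at least the positive minimum of X 1. Strictness is what makes
  \<open>p\<close> positive for t > 0; where \<open>p\<close> vanishes the characteristics do not
  move.\<close>

lemma X1_lt: "0 < t \<Longrightarrow> X 1 t < 1"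
proof -
  assume t: "0 < t"
  have c: "continuous_on {0..t} (X 1)" by (intro X_cont) simp
  obtain m where m: "m \<in> {0..t}" "\<And>s. s \<in> {0..t} \<Longrightarrow> X 1 m \<le> X 1 s"
    using continuous_attains_inf[OF compact_Icc _ c] t by auto
  have "1 - X 1 0 - X 1 m * 0 \<le> 1 - X 1 t - X 1 m * t"
  proof (rule nonneg_derivative_imp_le[where f = "\<lambda>s. 1 - X 1 s - X 1 m * s" and a = 0 and b = t])
    fix s assume s: "s \<in> {0..t}"
    show "((\<lambda>s. 1 - X 1 s - X 1 m * s) has_real_derivative - rhs 1 s - X 1 m) (at s within {0..t})"
      by (auto intro!: derivative_eq_intros X_deriv s)
    have "(X 1 s)\<^sup>2 * X 1 s \<le> (X 1 s)\<^sup>2 * 1" using X1_le[of s] s by (intro mult_left_mono) auto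
    then show "0 \<le> - rhs 1 s - X 1 m" unfolding rhs_1 using m(2)[OF s] by (simp add: power2_eq_square power3_eq_cube)
  qed (use t in auto)
  then have "X 1 m * t \<le> 1 - X 1 t" by (simp add: X_0)
  moreover have "0 < X 1 m * t" using X1_pos[of m] m t by simp
  ultimately show ?thesis by linarith
qed

lemma pq_bounds: "0 \<le> t \<Longrightarrow> 0 \<le> p t \<and> p t \<le> 1" "0 \<le> t \<Longrightarrow> 0 \<le> q t \<and> q t \<le> 1" "0 < t \<Longrightarrow> 0 < p t"
  using X1_pos[of t] X1_le[of t] X1_lt[of t] unfolding p_eq q_eq by (auto simp: power_le_one power2_less_1_iff abs_square_less_1)

text \<open>The extreme terms of the convolution contain X 0 = 0, so only smaller indices occur. By
  induction the gain is nonnegative and the loss is linear in X i.\<close>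

lemma X_nonneg: "0 \<le> t \<Longrightarrow> 0 \<le> X i t"
proof (induction i arbitrary: t rule: less_induct)
  case (less i)
  show ?case
  proof (cases "i \<le> 1")
    case True
    then show ?thesis using X1_pos[OF less.prems] by (cases i) (auto simp: X_def)
  next
    case False
    have "X i 0 * exp (integral {0..t} (\<lambda>s. - p s * i)) \<le> X i t"
    proof (rule gronwall_lower[OF X_deriv])
      fix s assume s: "s \<in> {0..t}"
      have "(\<Sum>k\<le>i. k * X k s * X (i - k) s) \<ge> 0"
      proof (rule sum_nonneg)
        fix k assume k: "k \<in> {..i}"
        show "0 \<le> k * X k s * X (i - k) s"
        proof (cases "k = 0 \<or> k = i")
          case True then show ?thesis by (auto simp: X_def)
        next
          case False
          then show ?thesis using k s by (intro mult_nonneg_nonneg less.IH) auto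
        qed
      qed
      then have "0 \<le> p s * (\<Sum>k\<le>i. k * X k s * X (i - k) s)" using pq_bounds(1)[of s] s by simp
      then show "- p s * i * X i s \<le> rhs i s"
        using False pq_bounds(2)[of s] s unfolding rhs_def by (auto simp: algebra_simps)
    qed (use less.prems in \<open>auto intro!: continuous_intros pq_cont\<close>)
    then show ?thesis using False by (simp add: X_0)
  qed
qed

end

section \<open>Exponential moments\<close>

text \<open>This is z^2 - z at z = exp y. For y \<le> 0 it is not positive; otherwise exp u \<le> 1
  + u + u^2 gives the second-order coefficient 2 + 2 + 1 = 5.\<close>

lemma exp_two_minus_exp_le:
  fixes y u :: real assumes "y \<le> u" "0 \<le> u" "u \<le> 1"
  shows "exp (2 * y) - exp y \<le> u + 5 * u\<^sup>2"
proof -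
  have e: "exp (2 * y) - exp y = exp y * (exp y - 1)" for y :: real
    by (simp add: algebra_simps flip: exp_add)
  show ?thesis
  proof (cases "y \<le> 0")
    case True
    then have "exp y * (exp y - 1) \<le> 0" by (intro mult_nonneg_nonpos) auto
    also have "0 \<le> u + 5 * u\<^sup>2" using assms by simp
    finally show ?thesis unfolding e .
  next
    case False
    have b: "exp u \<le> 1 + u + u\<^sup>2" using exp_bound[of u] assms by simp
    have "exp y * (exp y - 1) \<le> exp u * (exp u - 1)" using False assms by (intro mult_mono) auto
    also have "\<dots> \<le> (1 + u + u\<^sup>2) * (u + u\<^sup>2)" using b assms by (intro mult_mono) auto
    also have "\<dots> = u + 2 * u\<^sup>2 + 2 * (u * u\<^sup>2) + u\<^sup>2 * u\<^sup>2" by (simp add: power2_eq_square algebra_simps)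
    also have "\<dots> \<le> u + 2 * u\<^sup>2 + 2 * (1 * u\<^sup>2) + 1 * u\<^sup>2"
      using assms by (intro add_mono mult_left_mono mult_right_mono) (auto simp: power_le_one)
    finally show ?thesis unfolding e by simp
  qed
qed

context bf_process
begin

text \<open>The product on the right contains further pairs, all with nonnegative coefficients.
  Thanks to this sign the comparison can run on finite sums, before any convergence is
  known.\<close>

lemma truncated_convolution_le:
  assumes t: "0 \<le> t" and z: "0 \<le> z"
  shows "(\<Sum>i\<le>N. (\<Sum>k\<le>i. k * X k t * X (i - k) t) * z ^ i)
     \<le> (\<Sum>k\<le>N. k * X k t * z ^ k) * (\<Sum>l\<le>N. X l t * z ^ l)"
proof -
  let ?f = "\<lambda>(k, l). (k * X k t * z ^ k) * (X l t * z ^ l)"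
  have "(\<Sum>i\<le>N. (\<Sum>k\<le>i. k * X k t * X (i - k) t) * z ^ i) = (\<Sum>i\<le>N. \<Sum>k\<le>i. ?f (k, i - k))"
  proof (intro sum.cong refl, unfold sum_distrib_right, intro sum.cong refl)
    fix i k :: nat assume "k \<in> {..i}"
    then have "z ^ i = z ^ k * z ^ (i - k)" by (simp flip: power_add)
    then show "k * X k t * X (i - k) t * z ^ i = ?f (k, i - k)" by simp
  qed
  also have "\<dots> = sum ?f {(i, j). i + j \<le> N}"
    by (subst sum.triangle_reindex_eq) simp
  also have "\<dots> \<le> sum ?f ({..N} \<times> {..N})"
    by (rule sum_mono2) (use X_nonneg[OF t] z in auto)
  also have "\<dots> = (\<Sum>k\<le>N. k * X k t * z ^ k) * (\<Sum>l\<le>N. X l t * z ^ l)"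
    by (simp add: sum_product sum.cartesian_product)
  finally show ?thesis .
qed

text \<open>With U = 1 - V, the hypotheses are the characteristic equations with inequalities: the
  curve exp y moves no faster than \<open>p U\<close>, and V grows no slower than the force demands.
  Then V minus the truncated sum has derivative at least p S times itself, where S is the truncated
  sum weighted by i, and so keeps its sign. N \<ge> 2 ensures that the gain z^2 is counted in
  full.\<close>

lemma supersolution:
  assumes T: "0 \<le> T" and N: "N \<ge> 2"
    and y: "\<And>t. t \<in> {0..T} \<Longrightarrow> (y has_real_derivative y' t) (at t within {0..T})"
    and V: "\<And>t. t \<in> {0..T} \<Longrightarrow> (V has_real_derivative V' t) (at t within {0..T})"
    and y': "\<And>t. t \<in> {0..T} \<Longrightarrow> y' t \<le> p t * (1 - V t)"
    and V': "\<And>t. t \<in> {0..T} \<Longrightarrow> q t * (exp (2 * y t) - exp (y t)) \<le> V' t"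
    and init: "exp (y 0) \<le> V 0" and t: "t \<in> {0..T}"
  shows "(\<Sum>i\<le>N. X i t * exp (y t) ^ i) \<le> V t"
proof -
  define z where "z t = exp (y t)" for t
  define Y where "Y t = (\<Sum>i\<le>N. X i t * z t ^ i)" for t
  define S where "S t = (\<Sum>i\<le>N. i * X i t * z t ^ i)" for t
  have zd: "(z has_real_derivative z t * y' t) (at t within {0..T})" if "t \<in> {0..T}" for t
    unfolding z_def by (auto intro!: derivative_eq_intros y[OF that])
  have Yd: "(Y has_real_derivative (\<Sum>i\<le>N. rhs i t * z t ^ i + i * X i t * z t ^ i * y' t)) (at t within {0..T})"
    if t: "t \<in> {0..T}" for t
    unfolding Y_def
  proof (rule DERIV_sum)
    fix i
    have "((\<lambda>t. X i t * z t ^ i) has_real_derivative rhs i t * z t ^ i + X i t * (i * z t ^ (i - 1) * (z t * y' t))) (at t within {0..T})"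
      by (auto intro!: derivative_eq_intros X_deriv t zd[OF t])
    also have "X i t * (i * z t ^ (i - 1) * (z t * y' t)) = i * X i t * z t ^ i * y' t"
      by (cases i) auto
    finally show "((\<lambda>t. X i t * z t ^ i) has_real_derivative rhs i t * z t ^ i + i * X i t * z t ^ i * y' t) (at t within {0..T})" .
  qed
  have Scont: "continuous_on {0..T} S"
    unfolding S_def by (intro continuous_intros X_cont DERIV_continuous_on[OF zd]) auto
  have zsum: "(\<Sum>i\<le>N. ((if i = 2 then 1 else 0) - (if i = 1 then 1 else 0)) * w ^ i) = w\<^sup>2 - w" for w :: real
    using N by (simp add: left_diff_distrib sum_subtractf if_distrib[of "\<lambda>c. c * _"] cong: if_cong)
  have "(V 0 - Y 0) * exp (integral {0..t} (\<lambda>t. p t * S t)) \<le> V t - Y t"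
  proof (rule gronwall_lower[OF _ _ _ t, where f = "\<lambda>t. V t - Y t"])
    fix s assume s: "s \<in> {0..T}"
    then have s0: "0 \<le> s" by simp
    show "((\<lambda>t. V t - Y t) has_real_derivative V' s - (\<Sum>i\<le>N. rhs i s * z s ^ i + i * X i s * z s ^ i * y' s)) (at s within {0..T})"
      by (intro DERIV_diff V Yd s)
    have S0: "S s \<ge> 0" unfolding S_def using X_nonneg[OF s0] by (intro sum_nonneg) (auto simp: z_def)
    have "(\<Sum>i\<le>N. rhs i s * z s ^ i) = p s * ((\<Sum>i\<le>N. (\<Sum>k\<le>i. k * X k s * X (i - k) s) * z s ^ i) - S s)
        + q s * (\<Sum>i\<le>N. ((if i = 2 then 1 else 0) - (if i = 1 then 1 else 0)) * z s ^ i)"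
      unfolding rhs_def S_def by (simp add: sum.distrib sum_subtractf sum_distrib_left algebra_simps)
    also have "\<dots> \<le> p s * (S s * Y s - S s) + q s * ((z s)\<^sup>2 - z s)"
      unfolding zsum S_def Y_def using pq_bounds(1,2)[OF s0]
      by (intro add_mono mult_left_mono diff_mono truncated_convolution_le s0) (auto simp: z_def)
    also have "(z s)\<^sup>2 - z s = exp (2 * y s) - exp (y s)" by (simp add: z_def power2_eq_square flip: exp_add)
    finally have 1: "(\<Sum>i\<le>N. rhs i s * z s ^ i) \<le> p s * (S s * Y s - S s) + V' s" using V'[OF s] by linarith
    have "(\<Sum>i\<le>N. i * X i s * z s ^ i * y' s) = S s * y' s" by (simp add: S_def sum_distrib_right)
    also have "\<dots> \<le> S s * (p s * (1 - V s))" by (intro mult_left_mono y' s S0)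
    finally show "p s * S s * (V s - Y s) \<le> V' s - (\<Sum>i\<le>N. rhs i s * z s ^ i + i * X i s * z s ^ i * y' s)"
      using 1 by (simp add: sum.distrib algebra_simps)
  qed (auto intro!: continuous_intros pq_cont Scont)
  moreover have "Y 0 = exp (y 0)"
    using N by (simp add: Y_def X_0 z_def if_distrib[of "\<lambda>c. c * _"] cong: if_cong)
  ultimately have "0 \<le> V t - Y t"
    using init by (smt (verit) exp_ge_zero mult_nonneg_nonneg)
  then show ?thesis by (simp add: Y_def z_def)
qed

lemma X_sum_le_1: "0 \<le> t \<Longrightarrow> (\<Sum>i\<le>N. X i t) \<le> 1"
proof -
  assume t: "0 \<le> t"
  \<comment> \<open>Two extra terms meet the requirement N \<ge> 2; the constant pair y = 0, V = 1
    is itself a solution.\<close>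
  have "(\<Sum>i\<le>N. X i t) \<le> (\<Sum>i\<le>N + 2. X i t)"
    by (rule sum_mono2) (use X_nonneg[OF t] in auto)
  also have "\<dots> = (\<Sum>i\<le>N + 2. X i t * exp 0 ^ i)" by simp
  also have "\<dots> \<le> 1"
    by (rule supersolution[where y = "\<lambda>_. 0" and V = "\<lambda>_. 1" and y' = "\<lambda>_. 0" and V' = "\<lambda>_. 0" and T = t]) (use t in auto)
  finally show ?thesis .
qed

lemma X_le_1: "0 \<le> t \<Longrightarrow> X i t \<le> 1"
  using X_sum_le_1[of t i] member_le_sum[of i "{..i}" "\<lambda>i. X i t"] X_nonneg[of t] by fastforce

text \<open>Shifting the linearised characteristic through \<open>(1, 0)\<close> by a second-order amount gives a
  supersolution, hence an exponential moment up to any time before the blow-up of \<open>s\<close>.\<close>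

lemma exponential_moment:
  assumes t0: "0 \<le> t0"
    and s: "\<And>t. t \<in> {0..t0} \<Longrightarrow> (s has_real_derivative q t + p t * (s t)\<^sup>2) (at t within {0..t0})"
    and s0: "s 0 = 1"
  obtains \<rho> V where "\<rho> > 1" "\<And>t i. t \<in> {0..t0} \<Longrightarrow> X i t * \<rho> ^ i \<le> V"
proof -
  have sc: "continuous_on {0..t0} s" by (rule DERIV_continuous_on[OF s])
  define A where "A t = integral {0..t} (\<lambda>t. p t * s t)" for t
  have psc: "continuous_on {0..t0} (\<lambda>t. p t * s t)" by (intro continuous_intros pq_cont sc) simp
  have Ad: "(A has_real_derivative p t * s t) (at t within {0..t0})" if "t \<in> {0..t0}" for t
    unfolding A_def by (rule integral_has_real_derivative[OF psc that])
  \<comment> \<open>The substitution that linearises the Riccati equation of \<open>s\<close>: the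
    derivative of \<alpha> is - p s \<alpha> and that of s \<alpha> is q \<alpha>, so (\<alpha>, - s
    \<alpha>) is the linearised characteristic through (1, 0).\<close>
  define \<alpha> where "\<alpha> t = exp (- A t)" for t
  have \<alpha>d: "(\<alpha> has_real_derivative - p t * s t * \<alpha> t) (at t within {0..t0})" if "t \<in> {0..t0}" for t
    unfolding \<alpha>_def by (auto intro!: derivative_eq_intros Ad[OF that])
  have \<alpha>c: "continuous_on {0..t0} \<alpha>" by (rule DERIV_continuous_on[OF \<alpha>d])
  obtain m1 where m1: "m1 \<in> {0..t0}" "\<And>t. t \<in> {0..t0} \<Longrightarrow> \<alpha> m1 \<le> \<alpha> t"
    using continuous_attains_inf[OF compact_Icc _ \<alpha>c] t0 by auto
  obtain m2 where m2: "m2 \<in> {0..t0}" "\<And>t. t \<in> {0..t0} \<Longrightarrow> \<alpha> t \<le> \<alpha> m2"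
    using continuous_attains_sup[OF compact_Icc _ \<alpha>c] t0 by auto
  have \<alpha>0: "\<alpha> 0 = 1" by (simp add: \<alpha>_def A_def)
  define B where "B = \<alpha> m2"
  have B1: "B \<ge> 1" using m2(2)[of 0] t0 \<alpha>0 by (simp add: B_def)
  have \<alpha>pos: "0 < \<alpha> t" for t by (simp add: \<alpha>_def)
  \<comment> \<open>Absorbs the quadratic term 5 u^2 of the force at u = \<eta> \<alpha>, since
    \<alpha> \<le> B.\<close>
  define M where "M = 5 * B\<^sup>2"
  have M: "M \<ge> 5" using B1 by (simp add: M_def)
  \<comment> \<open>The first bound keeps \<eta> \<alpha> \<le> 1; the second lets the correction in
    \<open>y\<close> consume at most half of the linear term.\<close>
  define \<eta> where "\<eta> = min (1 / B) (\<alpha> m1 / (2 * M * exp t0))"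
  have \<eta>: "\<eta> > 0" "\<eta> \<le> 1 / B" "\<eta> * M * exp t0 \<le> \<alpha> m1 / 2"
  proof -
    show "\<eta> > 0" "\<eta> \<le> 1 / B" using B1 M \<alpha>pos by (auto simp: \<eta>_def)
    have "\<eta> \<le> \<alpha> m1 / (2 * M * exp t0)" by (simp add: \<eta>_def)
    then show "\<eta> * M * exp t0 \<le> \<alpha> m1 / 2" using M by (simp add: field_simps)
  qed
  have \<eta>1: "\<eta> \<le> 1" using \<eta>(2) B1 by (smt (verit) divide_le_eq_1)
  \<comment> \<open>The factor exp t makes the derivative of the correction equal to the correction
    itself, which dominates it after multiplication by p \<le> 1.\<close>
  define y where "y t = \<eta> * \<alpha> t - \<eta>\<^sup>2 * M * exp t" for t
  define V where "V t = 1 + \<eta> * (s t * \<alpha> t) + \<eta>\<^sup>2 * M * exp t" for t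
  have yd: "(y has_real_derivative \<eta> * (- p t * s t * \<alpha> t) - \<eta>\<^sup>2 * M * exp t) (at t within {0..t0})" if "t \<in> {0..t0}" for t
    unfolding y_def by (auto intro!: derivative_eq_intros \<alpha>d[OF that])
  have Vd: "(V has_real_derivative \<eta> * (q t * \<alpha> t) + \<eta>\<^sup>2 * M * exp t) (at t within {0..t0})" if "t \<in> {0..t0}" for t
    unfolding V_def by (auto intro!: derivative_eq_intros \<alpha>d[OF that] s[OF that] simp: algebra_simps power2_eq_square)
  have bound: "(\<Sum>i\<le>N. X i t * exp (y t) ^ i) \<le> V t" if t: "t \<in> {0..t0}" and N: "N \<ge> 2" for t N
  proof (rule supersolution[OF t0 N yd Vd _ _ _ t])
    fix t assume t: "t \<in> {0..t0}"
    have "p t * (\<eta>\<^sup>2 * M * exp t) \<le> 1 * (\<eta>\<^sup>2 * M * exp t)"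
      using pq_bounds(1)[of t] t M by (intro mult_right_mono) auto
    then show "\<eta> * (- p t * s t * \<alpha> t) - \<eta>\<^sup>2 * M * exp t \<le> p t * (1 - V t)"
      by (simp add: V_def algebra_simps)
    have u: "0 \<le> \<eta> * \<alpha> t" "\<eta> * \<alpha> t \<le> 1"
    proof -
      show "0 \<le> \<eta> * \<alpha> t" using \<eta> \<alpha>pos[of t] by simp
      have "\<eta> * \<alpha> t \<le> 1 / B * B" using \<eta> m2(2)[OF t] \<alpha>pos[of t] B1 unfolding B_def by (intro mult_mono) auto
      then show "\<eta> * \<alpha> t \<le> 1" using B1 by simp
    qed
    have "y t \<le> \<eta> * \<alpha> t" using M by (simp add: y_def)
    from exp_two_minus_exp_le[OF this u]
    have "exp (2 * y t) - exp (y t) \<le> \<eta> * \<alpha> t + 5 * (\<eta> * \<alpha> t)\<^sup>2" .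
    then have "q t * (exp (2 * y t) - exp (y t)) \<le> q t * (\<eta> * \<alpha> t + 5 * (\<eta> * \<alpha> t)\<^sup>2)"
      using pq_bounds(2)[of t] t by (intro mult_left_mono) auto
    also have "\<dots> \<le> \<eta> * (q t * \<alpha> t) + 1 * (5 * (\<eta> * \<alpha> t)\<^sup>2)"
      unfolding distrib_left using pq_bounds(2)[of t] t by (intro add_mono mult_right_mono) auto
    also have "5 * (\<eta> * \<alpha> t)\<^sup>2 \<le> \<eta>\<^sup>2 * M * exp t"
    proof -
      have "5 * (\<eta> * \<alpha> t)\<^sup>2 = \<eta>\<^sup>2 * (5 * (\<alpha> t)\<^sup>2) * 1" by (simp add: power_mult_distrib)
      also have "\<dots> \<le> \<eta>\<^sup>2 * (5 * B\<^sup>2) * exp t"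
        using m2(2)[OF t] \<alpha>pos[of t] t unfolding B_def by (intro mult_mono mult_left_mono power_mono) auto
      finally show ?thesis by (simp add: M_def)
    qed
    finally show "q t * (exp (2 * y t) - exp (y t)) \<le> \<eta> * (q t * \<alpha> t) + \<eta>\<^sup>2 * M * exp t" by simp
  next
    have "exp (y 0) \<le> exp \<eta>" using M by (simp add: y_def \<alpha>0)
    also have "\<dots> \<le> 1 + \<eta> + \<eta>\<^sup>2" using exp_bound[of \<eta>] \<eta> \<eta>1 by simp
    also have "\<dots> \<le> V 0"
      using mult_left_mono[of 1 M "\<eta>\<^sup>2"] M by (simp add: V_def \<alpha>0 s0)
    finally show "exp (y 0) \<le> V 0" .
  qed
  define \<rho> where "\<rho> = exp (\<eta> * \<alpha> m1 / 2)"
  have ylow: "\<eta> * \<alpha> m1 / 2 \<le> y t" if t: "t \<in> {0..t0}" for t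
  proof -
    have "\<eta>\<^sup>2 * M * exp t \<le> \<eta>\<^sup>2 * M * exp t0" using t M by (intro mult_left_mono) auto
    also have "\<dots> = \<eta> * (\<eta> * M * exp t0)" by (simp add: power2_eq_square)
    also have "\<dots> \<le> \<eta> * (\<alpha> m1 / 2)" using \<eta> by (intro mult_left_mono) auto
    finally have "\<eta>\<^sup>2 * M * exp t \<le> \<eta> * (\<alpha> m1 / 2)" .
    moreover have "\<eta> * \<alpha> m1 \<le> \<eta> * \<alpha> t" using m1(2)[OF t] \<eta> by (intro mult_left_mono) auto
    ultimately show ?thesis by (simp add: y_def)
  qed
  have Vc: "continuous_on {0..t0} V" by (rule DERIV_continuous_on[OF Vd])
  obtain m3 where m3: "m3 \<in> {0..t0}" "\<And>t. t \<in> {0..t0} \<Longrightarrow> V t \<le> V m3"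
    using continuous_attains_sup[OF compact_Icc _ Vc] t0 by auto
  show thesis
  proof (rule that)
    show "\<rho> > 1" using \<eta> \<alpha>pos[of m1] by (simp add: \<rho>_def)
    fix t i assume t: "t \<in> {0..t0}"
    have nn: "0 \<le> X i t" for i using X_nonneg t by auto
    have "X i t * \<rho> ^ i \<le> X i t * exp (y t) ^ i"
      using ylow[OF t] nn by (intro mult_left_mono power_mono) (auto simp: \<rho>_def)
    also have "\<dots> \<le> (\<Sum>i\<le>i + 2. X i t * exp (y t) ^ i)"
      by (rule member_le_sum) (use nn in auto)
    also have "\<dots> \<le> V t" by (rule bound[OF t]) simp
    also have "\<dots> \<le> V m3" by (rule m3(2)[OF t])
    finally show "X i t * \<rho> ^ i \<le> V m3" .
  qed
qed

end

section \<open>The generating function\<close>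

text \<open>Cubic growth leaves room for the quadratic bound on \<open>rhs\<close> together with one
  more factor i from the first-moment series.\<close>

lemma summable_power_coeff:
  fixes c :: "nat \<Rightarrow> complex" and z :: complex
  assumes c: "\<And>i. norm (c i) * \<rho> ^ i \<le> C * real (Suc i) ^ 3" and z: "norm z < \<rho>"
  shows "summable (\<lambda>i. norm (c i * z ^ i))"
proof (rule summable_comparison_test'[where N = 0])
  have \<rho>: "0 < \<rho>" using z norm_ge_zero[of z] by linarith
  show "summable (\<lambda>i. C * (real (Suc i) ^ 3 * (norm z / \<rho>) ^ i))"
    using z \<rho> by (intro summable_mult summable_cubic_geometric) auto
  fix i :: nat
  have "norm (c i) \<le> C * real (Suc i) ^ 3 / \<rho> ^ i" using c[of i] \<rho> by (simp add: field_simps)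
  then have "norm (c i) * norm z ^ i \<le> C * real (Suc i) ^ 3 / \<rho> ^ i * norm z ^ i"
    by (rule mult_right_mono) simp
  then show "norm (norm (c i * z ^ i)) \<le> C * (real (Suc i) ^ 3 * (norm z / \<rho>) ^ i)"
    by (simp add: norm_mult norm_power power_divide)
qed

lemma continuous_on_Icc_bounded:
  fixes f :: "real \<Rightarrow> 'a::real_normed_vector"
  assumes "continuous_on {a..b} f"
  obtains K where "\<And>t. t \<in> {a..b} \<Longrightarrow> norm (f t) \<le> K"
proof -
  have "bounded (f ` {a..b})" by (intro compact_imp_bounded compact_continuous_image assms compact_Icc)
  then show thesis using that unfolding bounded_iff by blast
qed

context bf_process
begin

text \<open>The j-th iterate of z d/dz on the generating function. j = 1 is needed for transport
  and, at z = 1, for the susceptibility; j = 2 appears when j = 1 is differentiated in time.\<close>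

definition Xg :: "nat \<Rightarrow> real \<Rightarrow> complex \<Rightarrow> complex" where
  "Xg j t z = (\<Sum>i. of_real (real i ^ j * X i t) * z ^ i)"

context
  fixes t \<rho> V :: real and z :: complex
  assumes t: "0 \<le> t" and \<rho>: "1 \<le> \<rho>" and V: "\<And>i. X i t * \<rho> ^ i \<le> V" and z: "norm z < \<rho>"
begin

lemma V_nonneg: "0 \<le> V"
  using V[of 0] by (simp add: X_def)

lemma summable_Xg:
  assumes j: "j \<le> 2"
  shows "summable (\<lambda>i. norm (of_real (real i ^ j * X i t) * z ^ i))"
proof (rule summable_power_coeff[where c = "\<lambda>i. of_real (real i ^ j * X i t)" and C = V and \<rho> = \<rho>])
  fix i :: nat
  have "0 \<le> real i ^ j * X i t" using X_nonneg[OF t, of i] by (intro mult_nonneg_nonneg) auto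
  then have "norm (complex_of_real (real i ^ j * X i t)) * \<rho> ^ i = real i ^ j * (X i t * \<rho> ^ i)"
    by (simp only: norm_of_real abs_of_nonneg mult.assoc)
  also have "\<dots> \<le> real (Suc i) ^ 3 * V"
  proof (intro mult_mono V)
    have "real i ^ j \<le> real (Suc i) ^ j" by (intro power_mono) auto
    also have "\<dots> \<le> real (Suc i) ^ 3" using j by (intro power_increasing) auto
    finally show "real i ^ j \<le> real (Suc i) ^ 3" .
  qed (use X_nonneg[OF t] \<rho> in auto)
  finally show "norm (complex_of_real (real i ^ j * X i t)) * \<rho> ^ i \<le> V * real (Suc i) ^ 3" by (simp add: mult.commute)
qed (rule z)

lemma Xg_sums: "j \<le> 2 \<Longrightarrow> (\<lambda>i. of_real (real i ^ j * X i t) * z ^ i) sums Xg j t z"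
  unfolding Xg_def by (rule summable_sums[OF summable_norm_cancel[OF summable_Xg]])

lemma Xg_Cauchy:
  assumes "j \<le> 2" "l \<le> 2"
  shows "(\<lambda>i. of_real (\<Sum>k\<le>i. real k ^ j * X k t * (real (i - k) ^ l * X (i - k) t)) * z ^ i) sums (Xg j t z * Xg l t z)"
proof -
  have "(\<lambda>i. \<Sum>k\<le>i. (of_real (real k ^ j * X k t) * z ^ k) * (of_real (real (i - k) ^ l * X (i - k) t) * z ^ (i - k)))
      sums (Xg j t z * Xg l t z)"
    unfolding Xg_def by (rule Cauchy_product_sums[OF summable_Xg[OF assms(1)] summable_Xg[OF assms(2)]])
  also have "(\<lambda>i. \<Sum>k\<le>i. (of_real (real k ^ j * X k t) * z ^ k) * (of_real (real (i - k) ^ l * X (i - k) t) * z ^ (i - k)))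
      = (\<lambda>i. of_real (\<Sum>k\<le>i. real k ^ j * X k t * (real (i - k) ^ l * X (i - k) t)) * z ^ i)"
  proof (rule ext, unfold of_real_sum sum_distrib_right, intro sum.cong refl)
    fix i k :: nat assume "k \<in> {..i}"
    then have "z ^ i = z ^ k * z ^ (i - k)" by (simp flip: power_add)
    then show "(of_real (real k ^ j * X k t) * z ^ k) * (of_real (real (i - k) ^ l * X (i - k) t) * z ^ (i - k))
      = of_real (real k ^ j * X k t * (real (i - k) ^ l * X (i - k) t)) * z ^ i"
      by simp
  qed
  finally show ?thesis .
qed

text \<open>The second series is the product rule for z d/dz: a factor i splits as k + (i -
  k).\<close>

lemma Xg_conv_sums:
  shows "(\<lambda>i. of_real (\<Sum>k\<le>i. k * X k t * X (i - k) t) * z ^ i) sums (Xg 1 t z * Xg 0 t z)"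
    and "(\<lambda>i. of_real (real i * (\<Sum>k\<le>i. k * X k t * X (i - k) t)) * z ^ i) sums (Xg 2 t z * Xg 0 t z + Xg 1 t z * Xg 1 t z)"
proof -
  show "(\<lambda>i. of_real (\<Sum>k\<le>i. k * X k t * X (i - k) t) * z ^ i) sums (Xg 1 t z * Xg 0 t z)"
    using Xg_Cauchy[of 1 0] by simp
  have "(\<lambda>i. of_real (\<Sum>k\<le>i. real k ^ 2 * X k t * (real (i - k) ^ 0 * X (i - k) t)) * z ^ i
      + of_real (\<Sum>k\<le>i. real k ^ 1 * X k t * (real (i - k) ^ 1 * X (i - k) t)) * z ^ i) sums (Xg 2 t z * Xg 0 t z + Xg 1 t z * Xg 1 t z)"
    by (intro sums_add Xg_Cauchy) auto
  also have "(\<lambda>i. of_real (\<Sum>k\<le>i. real k ^ 2 * X k t * (real (i - k) ^ 0 * X (i - k) t)) * z ^ i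
      + of_real (\<Sum>k\<le>i. real k ^ 1 * X k t * (real (i - k) ^ 1 * X (i - k) t)) * z ^ i)
     = (\<lambda>i. of_real (real i * (\<Sum>k\<le>i. k * X k t * X (i - k) t)) * z ^ i)"
  proof (rule ext, unfold distrib_right[symmetric] of_real_add[symmetric] sum.distrib[symmetric] sum_distrib_left, intro arg_cong2[where f = "(*)"] arg_cong[where f = of_real] sum.cong refl)
    fix i k :: nat assume "k \<in> {..i}"
    then have "real (i - k) = real i - real k" by (simp add: of_nat_diff)
    then show "real k ^ 2 * X k t * (real (i - k) ^ 0 * X (i - k) t) + real k ^ 1 * X k t * (real (i - k) ^ 1 * X (i - k) t)
       = real i * (k * X k t * X (i - k) t)"
      by (simp add: power2_eq_square algebra_simps)
  qed
  finally show "(\<lambda>i. of_real (real i * (\<Sum>k\<le>i. k * X k t * X (i - k) t)) * z ^ i) sums (Xg 2 t z * Xg 0 t z + Xg 1 t z * Xg 1 t z)" .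
qed

lemma delta_sums: "(\<lambda>i. of_real ((if i = 2 then a else 0) - (if i = 1 then b else 0)) * z ^ i) sums (of_real a * z\<^sup>2 - of_real b * z)"
proof -
  have "(\<lambda>i. (if i = 2 then of_real a * z ^ i else 0) - (if i = 1 then of_real b * z ^ i else 0)) sums (of_real a * z\<^sup>2 - of_real b * z ^ 1)"
    by (intro sums_diff sums_single)
  also have "(\<lambda>i. (if i = 2 then of_real a * z ^ i else 0) - (if i = 1 then of_real b * z ^ i else 0))
     = (\<lambda>i. of_real ((if i = 2 then a else 0) - (if i = 1 then b else 0)) * z ^ i)"
    by (auto simp: left_diff_distrib)
  finally show ?thesis by simp
qed

lemma Xg_rhs_sums:
  fixes v :: complex
  shows "(\<lambda>i. (of_real (rhs i t) + of_real (i * X i t) * v) * z ^ i) sums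
      (p t * (Xg 1 t z * Xg 0 t z - Xg 1 t z) + q t * (z\<^sup>2 - z) + Xg 1 t z * v)"
    and "(\<lambda>i. of_real (real i) * (of_real (rhs i t) + of_real (i * X i t) * v) * z ^ i) sums
      (p t * (Xg 2 t z * Xg 0 t z + Xg 1 t z * Xg 1 t z - Xg 2 t z) + q t * (2 * z\<^sup>2 - z) + Xg 2 t z * v)"
proof -
  let ?S = "\<lambda>i. (\<Sum>k\<le>i. k * X k t * X (i - k) t)"
  have "(\<lambda>i. p t * (of_real (?S i) * z ^ i - of_real (real i ^ 1 * X i t) * z ^ i)
       + q t * (of_real ((if i = 2 then 1 else 0) - (if i = 1 then 1 else 0)) * z ^ i) + (of_real (real i ^ 1 * X i t) * z ^ i) * v) sums
     (p t * (Xg 1 t z * Xg 0 t z - Xg 1 t z) + q t * (of_real 1 * z\<^sup>2 - of_real 1 * z) + Xg 1 t z * v)"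
    by (intro sums_add sums_mult sums_mult2 sums_diff delta_sums Xg_conv_sums Xg_sums) auto
  then show "(\<lambda>i. (of_real (rhs i t) + of_real (i * X i t) * v) * z ^ i) sums
      (p t * (Xg 1 t z * Xg 0 t z - Xg 1 t z) + q t * (z\<^sup>2 - z) + Xg 1 t z * v)"
    unfolding rhs_def of_real_add of_real_mult of_real_diff by (simp add: algebra_simps)
  have "(\<lambda>i. p t * (of_real (real i * ?S i) * z ^ i - of_real (real i ^ 2 * X i t) * z ^ i)
       + q t * (of_real ((if i = 2 then 2 else 0) - (if i = 1 then 1 else 0)) * z ^ i) + (of_real (real i ^ 2 * X i t) * z ^ i) * v) sums
     (p t * (Xg 2 t z * Xg 0 t z + Xg 1 t z * Xg 1 t z - Xg 2 t z) + q t * (of_real 2 * z\<^sup>2 - of_real 1 * z) + Xg 2 t z * v)"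
    by (intro sums_add sums_mult sums_mult2 sums_diff delta_sums Xg_conv_sums Xg_sums) auto
  also have "(\<lambda>i. p t * (of_real (real i * ?S i) * z ^ i - of_real (real i ^ 2 * X i t) * z ^ i)
       + q t * (of_real ((if i = 2 then 2 else 0) - (if i = 1 then 1 else 0)) * z ^ i) + (of_real (real i ^ 2 * X i t) * z ^ i) * v)
     = (\<lambda>i. of_real (real i) * (of_real (rhs i t) + of_real (i * X i t) * v) * z ^ i)"
  proof
    fix i :: nat
    have "((if i = 2 then 2 else 0) - (if i = 1 then 1 else 0)) = real i * ((if i = 2 then 1 else 0) - (if i = 1 then 1 else 0))" by simp
    then show "p t * (of_real (real i * ?S i) * z ^ i - of_real (real i ^ 2 * X i t) * z ^ i)
       + q t * (of_real ((if i = 2 then 2 else 0) - (if i = 1 then 1 else 0)) * z ^ i) + (of_real (real i ^ 2 * X i t) * z ^ i) * v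
     = of_real (real i) * (of_real (rhs i t) + of_real (i * X i t) * v) * z ^ i"
      unfolding rhs_def by (simp only: of_real_add of_real_mult of_real_diff of_real_power) (simp add: algebra_simps power2_eq_square)
  qed
  finally show "(\<lambda>i. of_real (real i) * (of_real (rhs i t) + of_real (i * X i t) * v) * z ^ i) sums
      (p t * (Xg 2 t z * Xg 0 t z + Xg 1 t z * Xg 1 t z - Xg 2 t z) + q t * (2 * z\<^sup>2 - z) + Xg 2 t z * v)"
    by simp
qed

lemma rhs_bound: "\<bar>rhs i t\<bar> * \<rho> ^ i \<le> (V\<^sup>2 + V + \<rho>\<^sup>2) * real (Suc i) ^ 2"
proof -
  have nn: "0 \<le> X k t * \<rho> ^ k" for k using X_nonneg[OF t] \<rho> by simp
  have "\<bar>(\<Sum>k\<le>i. k * X k t * X (i - k) t)\<bar> * \<rho> ^ i = (\<Sum>k\<le>i. k * X k t * X (i - k) t) * \<rho> ^ i"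
    using X_nonneg[OF t] by (simp add: sum_nonneg)
  also have "\<dots> = (\<Sum>k\<le>i. real k * ((X k t * \<rho> ^ k) * (X (i - k) t * \<rho> ^ (i - k))))"
  proof (unfold sum_distrib_right, intro sum.cong refl)
    fix k assume "k \<in> {..i}"
    then have "\<rho> ^ i = \<rho> ^ k * \<rho> ^ (i - k)" by (simp flip: power_add)
    then show "k * X k t * X (i - k) t * \<rho> ^ i = real k * ((X k t * \<rho> ^ k) * (X (i - k) t * \<rho> ^ (i - k)))" by simp
  qed
  also have "\<dots> \<le> (\<Sum>k\<le>i. real (Suc i) * (V * V))"
    by (intro sum_mono mult_mono V nn V_nonneg mult_nonneg_nonneg) auto
  also have "\<dots> = V\<^sup>2 * real (Suc i) ^ 2" by (simp add: power2_eq_square)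
  finally have 1: "\<bar>(\<Sum>k\<le>i. k * X k t * X (i - k) t)\<bar> * \<rho> ^ i \<le> V\<^sup>2 * real (Suc i) ^ 2" .
  have "\<bar>i * X i t\<bar> * \<rho> ^ i = real i * (X i t * \<rho> ^ i)" using X_nonneg[OF t, of i] by (simp add: abs_mult)
  also have "\<dots> \<le> real (Suc i) ^ 2 * V"
  proof (intro mult_mono V nn)
    have "real i \<le> real (Suc i) ^ 1" by simp
    also have "\<dots> \<le> real (Suc i) ^ 2" by (intro power_increasing) auto
    finally show "real i \<le> real (Suc i) ^ 2" .
  qed auto
  finally have 2: "\<bar>i * X i t\<bar> * \<rho> ^ i \<le> V * real (Suc i) ^ 2" by (simp add: mult.commute)
  have 3: "\<bar>(if i = 2 then 1 else 0) - (if i = 1 then 1 else 0)\<bar> * \<rho> ^ i \<le> \<rho>\<^sup>2 * real (Suc i) ^ 2"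
  proof (cases "i \<le> 2")
    case True
    have "\<bar>(if i = 2 then 1 else 0) - (if i = 1 then 1 else 0)\<bar> * \<rho> ^ i \<le> 1 * \<rho> ^ i"
      using \<rho> by (intro mult_right_mono) auto
    also have "\<dots> \<le> \<rho>\<^sup>2 * 1" using True \<rho> power_increasing[of i 2 \<rho>] by simp
    also have "\<dots> \<le> \<rho>\<^sup>2 * real (Suc i) ^ 2" by (intro mult_left_mono one_le_power) auto
    finally show ?thesis .
  qed auto
  have "\<bar>rhs i t\<bar> \<le> 1 * (\<bar>(\<Sum>k\<le>i. k * X k t * X (i - k) t)\<bar> + \<bar>i * X i t\<bar>) + 1 * \<bar>(if i = 2 then 1 else 0) - (if i = 1 then 1 else 0)\<bar>"
  proof -
    define c d e :: real where "c = (\<Sum>k\<le>i. k * X k t * X (i - k) t)" and "d = i * X i t"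
      and "e = (if i = 2 then 1 else 0) - (if i = 1 then 1 else 0)"
    have "\<bar>p t * (c - d) + q t * e\<bar> \<le> \<bar>p t\<bar> * \<bar>c - d\<bar> + \<bar>q t\<bar> * \<bar>e\<bar>"
      using abs_triangle_ineq[of "p t * (c - d)" "q t * e"] by (simp add: abs_mult)
    also have "\<dots> \<le> 1 * (\<bar>c\<bar> + \<bar>d\<bar>) + 1 * \<bar>e\<bar>"
      using pq_bounds(1,2)[OF t] by (intro add_mono mult_mono abs_triangle_ineq4) auto
    finally show ?thesis unfolding rhs_def c_def d_def e_def .
  qed
  then have "\<bar>rhs i t\<bar> * \<rho> ^ i \<le> (1 * (\<bar>(\<Sum>k\<le>i. k * X k t * X (i - k) t)\<bar> + \<bar>i * X i t\<bar>) + 1 * \<bar>(if i = 2 then 1 else 0) - (if i = 1 then 1 else 0)\<bar>) * \<rho> ^ i"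
    using \<rho> by (intro mult_right_mono) auto
  also have "\<dots> \<le> V\<^sup>2 * real (Suc i) ^ 2 + V * real (Suc i) ^ 2 + \<rho>\<^sup>2 * real (Suc i) ^ 2"
    using 1 2 3 by (simp only: distrib_right mult_1_left)
  finally show ?thesis by (simp only: distrib_right)
qed

end

text \<open>Termwise differentiation, dominated by a cubic times a geometric series of ratio r /
  \<rho>. The path enters through its logarithmic velocity v, so that z^n has derivative n z^n v
  without any division by z.\<close>

lemma Xg_deriv:
  fixes z v :: "real \<Rightarrow> complex"
  assumes ab: "0 \<le> a" and \<rho>: "1 \<le> \<rho>" and V: "\<And>s i. s \<in> {a..b} \<Longrightarrow> X i s * \<rho> ^ i \<le> V"
    and z: "\<And>s. s \<in> {a..b} \<Longrightarrow> (z has_vector_derivative z s * v s) (at s within {a..b})"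
    and r: "\<And>s. s \<in> {a..b} \<Longrightarrow> norm (z s) \<le> r" "r < \<rho>" and v: "\<And>s. s \<in> {a..b} \<Longrightarrow> norm (v s) \<le> B"
    and t: "t \<in> {a..b}"
  shows "((\<lambda>t. Xg 0 t (z t)) has_vector_derivative
      (p t * (Xg 1 t (z t) * Xg 0 t (z t) - Xg 1 t (z t)) + q t * ((z t)\<^sup>2 - z t) + Xg 1 t (z t) * v t)) (at t within {a..b})"
    and "((\<lambda>t. Xg 1 t (z t)) has_vector_derivative
      (p t * (Xg 2 t (z t) * Xg 0 t (z t) + Xg 1 t (z t) * Xg 1 t (z t) - Xg 2 t (z t)) + q t * (2 * (z t)\<^sup>2 - z t) + Xg 2 t (z t) * v t)) (at t within {a..b})"
proof -
  have nz: "norm (z s) < \<rho>" if "s \<in> {a..b}" for s using r(1)[OF that] r(2) by simp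
  have s0: "0 \<le> s" if "s \<in> {a..b}" for s using that ab by simp
  have V0: "0 \<le> V" using V[OF t, of 0] by (simp add: X_def)
  have B0: "0 \<le> B" using v[OF t] norm_ge_zero order_trans by blast
  define C where "C = (V\<^sup>2 + V + \<rho>\<^sup>2) + V * B"
  have C0: "C \<ge> 0" using V0 B0 by (simp add: C_def)
  have r0: "0 \<le> r" using r(1)[OF t] norm_ge_zero order_trans by blast
  have *: "((\<lambda>t. \<Sum>i. of_real (real i ^ j * X i t) * z t ^ i) has_vector_derivative
      (\<Sum>i. of_real (real i ^ j) * (of_real (rhs i t) + of_real (i * X i t) * v t) * z t ^ i)) (at t within {a..b})"
    if j: "j \<le> 1" for j
  proof (rule series_has_vector_derivative[OF _ _ _ t _ t])
    fix n s assume s: "s \<in> {a..b}"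
    have "((\<lambda>t. of_real (X n t)) has_vector_derivative of_real (rhs n s)) (at s within {a..b})"
      using X_deriv[OF s ab, of n] by (simp add: has_real_derivative_iff_has_vector_derivative has_vector_derivative_of_real)
    moreover have "((\<lambda>t. z t ^ n) has_vector_derivative of_nat n * (z s ^ n * v s)) (at s within {a..b})"
    proof -
      have "((\<lambda>t. z t ^ n) has_vector_derivative (z s * v s) * (of_nat n * z s ^ (n - 1))) (at s within {a..b})"
      proof -
        have "((\<lambda>w. w ^ n) has_field_derivative of_nat n * z s ^ (n - 1)) (at (z s) within z ` {a..b})"
          by (auto intro!: derivative_eq_intros)
        from field_vector_diff_chain_within[OF z[OF s] this] show ?thesis by (simp add: o_def)
      qed
      then show ?thesis by (cases n) (simp_all add: mult_ac)
    qed
    ultimately have "((\<lambda>t. of_real (X n t) * z t ^ n) has_vector_derivative (of_real (X n s) * (of_nat n * (z s ^ n * v s)) + of_real (rhs n s) * z s ^ n)) (at s within {a..b})"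
      by (rule has_vector_derivative_mult)
    from has_vector_derivative_mult_right[OF this, of "of_real (real n ^ j)"]
    show "((\<lambda>t. of_real (real n ^ j * X n t) * z t ^ n) has_vector_derivative of_real (real n ^ j) * (of_real (rhs n s) + of_real (n * X n s) * v s) * z s ^ n) (at s within {a..b})"
      by (simp add: algebra_simps)
    have c: "norm (complex_of_real (real n ^ j) * (of_real (rhs n s) + of_real (n * X n s) * v s)) * \<rho> ^ n \<le> C * real (Suc n) ^ 3"
    proof -
      have "norm (complex_of_real (rhs n s) + of_real (n * X n s) * v s) \<le> \<bar>rhs n s\<bar> + (n * X n s) * B"
        using v[OF s] X_nonneg[OF s0[OF s], of n]
        by (intro norm_triangle_le add_mono) (auto simp: norm_mult intro!: mult_mono)
      then have "norm (complex_of_real (rhs n s) + of_real (n * X n s) * v s) * \<rho> ^ n \<le> (\<bar>rhs n s\<bar> + (n * X n s) * B) * \<rho> ^ n"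
        using \<rho> by (intro mult_right_mono) auto
      also have "\<dots> = \<bar>rhs n s\<bar> * \<rho> ^ n + (X n s * \<rho> ^ n) * (real n * B)" by (simp add: algebra_simps)
      also have "\<dots> \<le> (V\<^sup>2 + V + \<rho>\<^sup>2) * real (Suc n) ^ 2 + V * (real (Suc n) ^ 2 * B)"
      proof (intro add_mono rhs_bound[OF s0[OF s] \<rho> V[OF s] nz[OF s]] mult_mono V[OF s])
        have "real n \<le> real (Suc n) ^ 1" by simp
        also have "\<dots> \<le> real (Suc n) ^ 2" by (intro power_increasing) auto
        finally show "real n \<le> real (Suc n) ^ 2" .
      qed (use V0 B0 in auto)
      also have "\<dots> = C * real (Suc n) ^ 2" by (simp add: C_def algebra_simps)
      finally have 1: "norm (complex_of_real (rhs n s) + of_real (n * X n s) * v s) * \<rho> ^ n \<le> C * real (Suc n) ^ 2" .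
      have 2: "real n ^ j \<le> real (Suc n)" using j by (cases j) auto
      have "real n ^ j * (norm (complex_of_real (rhs n s) + of_real (n * X n s) * v s) * \<rho> ^ n) \<le> real (Suc n) * (C * real (Suc n) ^ 2)"
        by (rule mult_mono[OF 2 1]) (use \<rho> in auto)
      also have "\<dots> = C * real (Suc n) ^ 3" by (simp add: power2_eq_square power3_eq_cube)
      finally show ?thesis by (simp add: norm_mult norm_power)
    qed
    have "norm (of_real (real n ^ j) * (of_real (rhs n s) + of_real (n * X n s) * v s) * z s ^ n)
        = norm (complex_of_real (real n ^ j) * (of_real (rhs n s) + of_real (n * X n s) * v s)) * norm (z s) ^ n"
      by (simp only: norm_mult norm_power)
    also have "\<dots> \<le> (C * real (Suc n) ^ 3 / \<rho> ^ n) * r ^ n"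
      using c \<rho> r(1)[OF s] C0 by (intro mult_mono power_mono) (auto simp: field_simps)
    finally show "norm (of_real (real n ^ j) * (of_real (rhs n s) + of_real (n * X n s) * v s) * z s ^ n) \<le> C * (real (Suc n) ^ 3 * (r / \<rho>) ^ n)"
      by (simp add: power_divide)
  next
    show "summable (\<lambda>n. C * (real (Suc n) ^ 3 * (r / \<rho>) ^ n))"
      using r(2) r0 \<rho> by (intro summable_mult summable_cubic_geometric) auto
    show "summable (\<lambda>n. of_real (real n ^ j * X n t) * z t ^ n)"
      by (rule summable_norm_cancel[OF summable_Xg[OF s0[OF t] \<rho> V[OF t] nz[OF t]]]) (use j in simp)
  qed
  note R = Xg_rhs_sums[OF s0[OF t] \<rho> V[OF t] nz[OF t], of "v t", THEN sums_unique]
  show "((\<lambda>t. Xg 0 t (z t)) has_vector_derivative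
      (p t * (Xg 1 t (z t) * Xg 0 t (z t) - Xg 1 t (z t)) + q t * ((z t)\<^sup>2 - z t) + Xg 1 t (z t) * v t)) (at t within {a..b})"
    unfolding R(1) using *[of 0] by (simp add: Xg_def[abs_def])
  show "((\<lambda>t. Xg 1 t (z t)) has_vector_derivative
      (p t * (Xg 2 t (z t) * Xg 0 t (z t) + Xg 1 t (z t) * Xg 1 t (z t) - Xg 2 t (z t)) + q t * (2 * (z t)\<^sup>2 - z t) + Xg 2 t (z t) * v t)) (at t within {a..b})"
    unfolding R(2) using *[of 1] by (simp add: Xg_def[abs_def])
qed

text \<open>At z = 1 the forcing vanishes, and the defect of mass satisfies a linear homogeneous
  equation with zero initial value. Once the mass is 1 the second moments cancel, and the first
  moment satisfies the Riccati equation of \<open>s\<close>. This identifies the given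
  \<open>s\<close> with the susceptibility of the solution.\<close>

lemma Xg_at_1:
  assumes t0: "0 \<le> t0"
    and s: "\<And>t. t \<in> {0..t0} \<Longrightarrow> (s has_real_derivative q t + p t * (s t)\<^sup>2) (at t within {0..t0})"
    and s0: "s 0 = 1" and t: "t \<in> {0..t0}"
  shows "Xg 0 t 1 = 1" and "Xg 1 t 1 = of_real (s t)"
proof -
  obtain \<rho> V where \<rho>: "\<rho> > 1" and V: "\<And>t i. t \<in> {0..t0} \<Longrightarrow> X i t * \<rho> ^ i \<le> V"
    using exponential_moment[OF t0 s s0] by metis
  have z: "((\<lambda>_. 1) has_vector_derivative (1::complex) * 0) (at t within {0..t0})" for t by simp
  have D: "((\<lambda>t. Xg 0 t 1) has_vector_derivative p t * (Xg 1 t 1 * Xg 0 t 1 - Xg 1 t 1)) (at t within {0..t0})"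
    "((\<lambda>t. Xg 1 t 1) has_vector_derivative p t * (Xg 2 t 1 * Xg 0 t 1 + Xg 1 t 1 * Xg 1 t 1 - Xg 2 t 1) + q t) (at t within {0..t0})"
    if t: "t \<in> {0..t0}" for t
    using Xg_deriv[where z = "\<lambda>_. 1" and v = "\<lambda>_. 0" and B = 0 and r = 1 and a = 0 and b = t0, OF order_refl less_imp_le[OF \<rho>] V z _ \<rho> _ t]
    by simp_all
  have Xg0: "Xg j 0 1 = 1" for j
  proof -
    have "(\<lambda>i. of_real (real i ^ j * X i 0) * 1 ^ i) = (\<lambda>i. if i = 1 then (1::complex) else 0)" by (auto simp: X_0)
    then show ?thesis unfolding Xg_def using sums_single[of 1 "\<lambda>_. 1::complex"] by (simp add: sums_iff)
  qed
  have c1: "continuous_on {0..t0} (\<lambda>t. Xg 1 t 1)" by (rule continuous_on_vector_derivative[OF D(2)])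
  obtain K where K: "\<And>t. t \<in> {0..t0} \<Longrightarrow> norm (Xg 1 t 1) \<le> K"
    using continuous_on_Icc_bounded[OF c1] by metis
  have mass: "Xg 0 t 1 = 1" if t: "t \<in> {0..t0}" for t
  proof -
    have "Xg 0 t 1 - 1 = 0"
    proof (rule gronwall_zero[where E = "\<lambda>t. Xg 0 t 1 - 1" and K = K, OF _ _ _ t])
      fix s assume s: "s \<in> {0..t0}"
      show "((\<lambda>t. Xg 0 t 1 - 1) has_vector_derivative p s * (Xg 1 s 1 * (Xg 0 s 1 - 1))) (at s within {0..t0})"
        using has_vector_derivative_diff[OF D(1)[OF s] has_vector_derivative_const, of 1] by (simp add: algebra_simps)
      have "norm (p s * (Xg 1 s 1 * (Xg 0 s 1 - 1))) = p s * (norm (Xg 1 s 1) * norm (Xg 0 s 1 - 1))"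
        using pq_bounds(1)[of s] s by (simp add: norm_mult)
      also have "\<dots> \<le> 1 * (K * norm (Xg 0 s 1 - 1))"
        using pq_bounds(1)[of s] K[OF s] s by (intro mult_mono mult_right_mono) auto
      finally show "norm (p s * (Xg 1 s 1 * (Xg 0 s 1 - 1))) \<le> K * norm (Xg 0 s 1 - 1)" by simp
    qed (simp add: Xg0)
    then show ?thesis by simp
  qed
  then show "Xg 0 t 1 = 1" using t .
  have sc: "continuous_on {0..t0} s" by (rule DERIV_continuous_on[OF s])
  obtain L where L: "\<And>t. t \<in> {0..t0} \<Longrightarrow> norm (s t) \<le> L"
    using continuous_on_Icc_bounded[OF sc] by metis
  have "Xg 1 t 1 - of_real (s t) = 0"
  proof (rule gronwall_zero[where E = "\<lambda>t. Xg 1 t 1 - of_real (s t)" and K = "K + L", OF _ _ _ t])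
    fix u assume u: "u \<in> {0..t0}"
    have "((\<lambda>t. complex_of_real (s t)) has_vector_derivative of_real (q u + p u * (s u)\<^sup>2)) (at u within {0..t0})"
      by (rule has_vector_derivative_of_real) (use s[OF u] in \<open>simp add: has_real_derivative_iff_has_vector_derivative\<close>)
    from has_vector_derivative_diff[OF D(2)[OF u] this]
    show "((\<lambda>t. Xg 1 t 1 - of_real (s t)) has_vector_derivative p u * ((Xg 1 u 1 + of_real (s u)) * (Xg 1 u 1 - of_real (s u)))) (at u within {0..t0})"
      by (simp add: mass[OF u] algebra_simps power2_eq_square)
    have "norm (p u * ((Xg 1 u 1 + of_real (s u)) * (Xg 1 u 1 - of_real (s u)))) = p u * (norm (Xg 1 u 1 + of_real (s u)) * norm (Xg 1 u 1 - of_real (s u)))"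
      using pq_bounds(1)[of u] u by (simp add: norm_mult)
    also have "\<dots> \<le> 1 * ((K + L) * norm (Xg 1 u 1 - of_real (s u)))"
      using pq_bounds(1)[of u] K[OF u] L[OF u] u
      by (intro mult_mono mult_right_mono norm_triangle_le add_mono) auto
    finally show "norm (p u * ((Xg 1 u 1 + of_real (s u)) * (Xg 1 u 1 - of_real (s u)))) \<le> (K + L) * norm (Xg 1 u 1 - of_real (s u))" by simp
  qed (simp add: Xg0 s0)
  then show "Xg 1 t 1 = of_real (s t)" by simp
qed

text \<open>The defect Xg 0 - 1 + U along a characteristic satisfies a linear homogeneous equation.
  The restriction to |w| \<le> 1/12 keeps the position within radius 3/12 = 1/4, where the trivial
  bound X i \<le> 1 suffices at every time, including \<open>tc\<close> and later.\<close>

lemma Xg_transport: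
  assumes a: "0 \<le> a" and c: "char_curve p q a b w h U" and U4: "\<And>t. t \<in> {a..b} \<Longrightarrow> norm (U t) \<le> 4"
    and w: "norm w \<le> 1 / 12" and init: "U a = 1 - Xg 0 a w" and t: "t \<in> {a..b}"
  shows "Xg 0 t (w * exp (h t)) = 1 - U t"
proof -
  define z where "z t = w * exp (h t)" for t
  have zr: "norm (z t) \<le> 1 / 4" if "t \<in> {a..b}" for t
  proof -
    have "norm (exp (h t)) \<le> 3" by (rule norm_exp_le_3) (use c that in \<open>auto simp: char_curve_def\<close>)
    then have "norm w * norm (exp (h t)) \<le> 1 / 12 * 3" using w by (intro mult_mono) auto
    then show ?thesis by (simp add: z_def norm_mult)
  qed
  have V: "X i s * 1 ^ i \<le> 1" if "s \<in> {a..b}" for s i using X_le_1[of s i] that a by simp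
  have zd: "(z has_vector_derivative z s * (p s * U s)) (at s within {a..b})" if s: "s \<in> {a..b}" for s
  proof -
    have "(h has_vector_derivative p s * U s) (at s within {a..b})" using c s by (auto simp: char_curve_def)
    from field_vector_diff_chain_within[OF this, of exp "exp (h s)"]
    have "((\<lambda>t. exp (h t)) has_vector_derivative (p s * U s) * exp (h s)) (at s within {a..b})"
      by (simp add: o_def DERIV_exp has_field_derivative_at_within)
    from has_vector_derivative_mult_right[OF this, of w] show ?thesis by (simp add: z_def[abs_def] mult_ac)
  qed
  have v: "norm (p s * U s) \<le> 4" if s: "s \<in> {a..b}" for s
    using pq_bounds(1)[of s] s a U4[OF s] mult_mono[of "p s" 1 "norm (U s)" 4] by (simp add: norm_mult)
  note D = Xg_deriv[where z = z and v = "\<lambda>s. p s * U s" and B = 4 and r = "1/4" and a = a and b = b and \<rho> = 1 and V = 1, OF a order_refl V zd zr _ v]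
  have D0: "((\<lambda>t. Xg 0 t (z t)) has_vector_derivative
      (p s * (Xg 1 s (z s) * Xg 0 s (z s) - Xg 1 s (z s)) + q s * ((z s)\<^sup>2 - z s) + Xg 1 s (z s) * (p s * U s))) (at s within {a..b})"
    if "s \<in> {a..b}" for s using D(1)[OF _ _ _ _ _ that] by simp
  have c1: "continuous_on {a..b} (\<lambda>t. Xg 1 t (z t))"
    by (rule continuous_on_vector_derivative[OF D(2)]) auto
  obtain K where K: "\<And>t. t \<in> {a..b} \<Longrightarrow> norm (Xg 1 t (z t)) \<le> K"
    using continuous_on_Icc_bounded[OF c1] by metis
  have "Xg 0 t (z t) - 1 + U t = 0"
  proof (rule gronwall_zero[where E = "\<lambda>t. Xg 0 t (z t) - 1 + U t" and K = K, OF _ _ _ t])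
    fix s assume s: "s \<in> {a..b}"
    have "(U has_vector_derivative q s * (z s - (z s)\<^sup>2)) (at s within {a..b})" using c s by (auto simp: char_curve_def z_def)
    from has_vector_derivative_add[OF has_vector_derivative_diff[OF D0[OF s] has_vector_derivative_const] this, of 1]
    show "((\<lambda>t. Xg 0 t (z t) - 1 + U t) has_vector_derivative p s * (Xg 1 s (z s) * (Xg 0 s (z s) - 1 + U s))) (at s within {a..b})"
      by (simp add: algebra_simps)
    have "norm (p s * (Xg 1 s (z s) * (Xg 0 s (z s) - 1 + U s))) = p s * (norm (Xg 1 s (z s)) * norm (Xg 0 s (z s) - 1 + U s))"
      using pq_bounds(1)[of s] s a by (simp add: norm_mult)
    also have "\<dots> \<le> 1 * (K * norm (Xg 0 s (z s) - 1 + U s))"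
      using pq_bounds(1)[of s] K[OF s] s a by (intro mult_mono mult_right_mono) auto
    finally show "norm (p s * (Xg 1 s (z s) * (Xg 0 s (z s) - 1 + U s))) \<le> K * norm (Xg 0 s (z s) - 1 + U s)" by simp
  qed (use c init in \<open>auto simp: z_def char_curve_def\<close>)
  then have "Xg 0 t (z t) = 1 - U t" by algebra
  then show ?thesis by (simp add: z_def)
qed

end

section \<open>Saddle points close to the critical time\<close>

text \<open>The complex derivative can be taken along the real axis, where the imaginary part of f
  is locally zero.\<close>

lemma deriv_real_on_reals:
  assumes hol: "f holomorphic_on S" and S: "open S" and re: "\<And>u. u \<in> S \<Longrightarrow> u \<in> \<real> \<Longrightarrow> f u \<in> \<real>"
    and u: "u \<in> S" "u \<in> \<real>"
  shows "deriv f u \<in> \<real>"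
proof -
  obtain r where r: "u = complex_of_real r" using u(2) by (auto elim: Reals_cases)
  have "(f has_field_derivative deriv f u) (at u within complex_of_real ` UNIV)"
    by (rule holomorphic_derivI[OF hol S u(1)])
  then have "(f has_field_derivative deriv f u) (at (complex_of_real r) within complex_of_real ` UNIV)"
    by (simp add: r)
  from field_vector_diff_chain_within[OF has_vector_derivative_of_real[OF DERIV_ident] this]
  have d: "((\<lambda>x. f (complex_of_real x)) has_vector_derivative deriv f u) (at r)" by (simp add: o_def)
  have "((\<lambda>x. Im (f (complex_of_real x))) has_real_derivative Im (deriv f u)) (at r)"
    using has_field_derivative_Im[OF d] .
  moreover have "((\<lambda>x. Im (f (complex_of_real x))) has_real_derivative 0) (at r)"
  proof (rule has_field_derivative_transform_within_open[of "\<lambda>_. 0" 0 r "complex_of_real -` S"])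
    show "open (complex_of_real -` S)" by (intro open_vimage S continuous_intros)
    show "r \<in> complex_of_real -` S" using u r by simp
    fix x assume "x \<in> complex_of_real -` S"
    then have "f (complex_of_real x) \<in> \<real>" by (intro re) auto
    then show "0 = Im (f (complex_of_real x))" by (simp add: complex_is_Real_iff)
  qed simp
  ultimately have "Im (deriv f u) = 0" by (rule DERIV_unique)
  then show ?thesis by (simp add: complex_is_Real_iff)
qed

text \<open>The half-plane is the preimage under exp of a punctured disc of radius exp (4 \<rho>),
  so it contains vertical segments of any length. Saddles will lie in |u| \<le> \<rho> and
  derivatives are controlled for Re u \<le> 2 \<rho>, which leaves room for Cauchy discs of radius
  \<rho>.\<close>

locale strip_family =
  fixes F :: "real \<Rightarrow> complex \<Rightarrow> complex" and T :: "real set" and \<rho> B :: real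
  assumes \<rho>: "\<rho> > 0" and B: "B \<ge> 1"
    and hol: "\<And>t. t \<in> T \<Longrightarrow> F t holomorphic_on {u. Re u < 4 * \<rho>}"
    and bd: "\<And>t u. t \<in> T \<Longrightarrow> Re u < 4 * \<rho> \<Longrightarrow> norm (F t u) \<le> B"
    and lip: "\<And>t t' u. t \<in> T \<Longrightarrow> t' \<in> T \<Longrightarrow> Re u < 4 * \<rho> \<Longrightarrow> norm (F t u - F t' u) \<le> B * \<bar>t - t'\<bar>"
    and real: "\<And>t u. t \<in> T \<Longrightarrow> Re u < 4 * \<rho> \<Longrightarrow> u \<in> \<real> \<Longrightarrow> F t u \<in> \<real>"
begin

text \<open>A single Cauchy bound for all derivatives up to order 5, with 120 = 5!; the power of 1 +
  1/\<rho> covers both small and large \<rho>.\<close>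

definition K :: real where "K = 120 * B * (1 + 1 / \<rho>) ^ 5"

abbreviation D :: "nat \<Rightarrow> real \<Rightarrow> complex \<Rightarrow> complex" where "D n t \<equiv> (deriv ^^ n) (F t)"

lemma open_strip: "open {u. Re u < c}" by (rule open_halfspace_Re_lt)

lemma K_ge: "n \<le> 5 \<Longrightarrow> fact n * B / \<rho> ^ n \<le> K"
proof -
  assume n: "n \<le> 5"
  have "fact n \<le> (fact 5 :: real)" using n by (rule fact_mono)
  also have "\<dots> = 120" by (simp add: fact_numeral)
  finally have 1: "fact n \<le> (120::real)" .
  have "(1 / \<rho>) ^ n \<le> (1 + 1 / \<rho>) ^ n" using \<rho> by (intro power_mono) auto
  also have "\<dots> \<le> (1 + 1 / \<rho>) ^ 5" using \<rho> n by (intro power_increasing) auto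
  finally have "fact n * B * (1 / \<rho>) ^ n \<le> 120 * B * (1 + 1 / \<rho>) ^ 5"
    using 1 B \<rho> by (intro mult_mono) auto
  then show ?thesis by (simp add: K_def power_divide)
qed

lemma K_pos: "K \<ge> 1"
  using K_ge[of 0] B by simp

lemma hol_D: "t \<in> T \<Longrightarrow> D n t holomorphic_on {u. Re u < 4 * \<rho>}"
  by (intro holomorphic_higher_deriv hol open_strip)

lemma cball_strip: "Re u \<le> 2 * \<rho> \<Longrightarrow> cball u \<rho> \<subseteq> {u. Re u < 4 * \<rho>}"
proof
  fix v assume u: "Re u \<le> 2 * \<rho>" and v: "v \<in> cball u \<rho>"
  then have "Re v - Re u \<le> \<rho>" using abs_Re_le_cmod[of "v - u"] by (auto simp: dist_norm norm_minus_commute)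
  then show "v \<in> {u. Re u < 4 * \<rho>}" using u \<rho> by simp
qed

lemma D_bound: "t \<in> T \<Longrightarrow> Re u \<le> 2 * \<rho> \<Longrightarrow> n \<le> 5 \<Longrightarrow> norm (D n t u) \<le> K"
proof -
  assume t: "t \<in> T" and u: "Re u \<le> 2 * \<rho>" and n: "n \<le> 5"
  have "norm (D n t u) \<le> fact n * B / \<rho> ^ n"
    by (rule norm_higher_deriv_le[OF hol[OF t] cball_strip[OF u] \<rho>]) (use cball_strip[OF u] bd[OF t] in auto)
  also have "\<dots> \<le> K" by (rule K_ge[OF n])
  finally show ?thesis .
qed

lemma D_Lipschitz_time:
  assumes t: "t \<in> T" "t' \<in> T" and u: "Re u \<le> 2 * \<rho>" and n: "n \<le> 5"
  shows "norm (D n t u - D n t' u) \<le> K * \<bar>t - t'\<bar>"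
proof -
  have us: "u \<in> {u. Re u < 4 * \<rho>}" using u \<rho> by simp
  have "norm ((deriv ^^ n) (\<lambda>w. F t w - F t' w) u) \<le> fact n * (B * \<bar>t - t'\<bar>) / \<rho> ^ n"
    by (rule norm_higher_deriv_le[OF _ cball_strip[OF u] \<rho>])
      (use cball_strip[OF u] lip[OF t] in \<open>auto intro!: holomorphic_intros hol t\<close>)
  also have "(deriv ^^ n) (\<lambda>w. F t w - F t' w) u = D n t u - D n t' u"
    by (rule higher_deriv_diff[OF hol[OF t(1)] hol[OF t(2)] open_strip us])
  also have "fact n * (B * \<bar>t - t'\<bar>) / \<rho> ^ n = (fact n * B / \<rho> ^ n) * \<bar>t - t'\<bar>" by simp
  also have "\<dots> \<le> K * \<bar>t - t'\<bar>" by (intro mult_right_mono K_ge n) auto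
  finally show ?thesis .
qed

lemma D_has_derivative:
  "t \<in> T \<Longrightarrow> Re u < 4 * \<rho> \<Longrightarrow> (D n t has_field_derivative D (Suc n) t u) (at u within A)"
  using holomorphic_derivI[OF hol_D open_strip, of t u n A] by simp

lemma D_Taylor:
  assumes t: "t \<in> T" and u: "Re u \<le> 2 * \<rho>" "Re v \<le> 2 * \<rho>" and mn: "m + n \<le> 4"
  shows "norm (D m t v - (\<Sum>i\<le>n. D (m + i) t u * (v - u) ^ i / fact i)) \<le> K * norm (v - u) ^ Suc n"
proof -
  have "norm (D (m + 0) t v - (\<Sum>i\<le>n. D (m + i) t u * (v - u) ^ i / fact i)) \<le> K * norm (v - u) ^ Suc n / fact n"
  proof (rule complex_Taylor[where S = "{u. Re u \<le> 2 * \<rho>}" and f = "\<lambda>i. D (m + i) t"])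
    show "convex {u. Re u \<le> 2 * \<rho>}" by (rule convex_halfspace_Re_le)
    show "(D (m + i) t has_field_derivative D (m + Suc i) t x) (at x within {u. Re u \<le> 2 * \<rho>})"
      if "x \<in> {u. Re u \<le> 2 * \<rho>}" for i x
      using D_has_derivative[OF t, of x "m + i"] that \<rho> by simp
    show "norm (D (m + Suc n) t x) \<le> K" if "x \<in> {u. Re u \<le> 2 * \<rho>}" for x
      using that mn by (intro D_bound t) auto
  qed (use u in auto)
  also have "\<dots> \<le> K * norm (v - u) ^ Suc n / 1"
    using K_pos by (intro divide_left_mono mult_nonneg_nonneg) auto
  finally show ?thesis by simp
qed

lemma D_Lipschitz_space:
  assumes "t \<in> T" "Re u \<le> 2 * \<rho>" "Re v \<le> 2 * \<rho>" "m \<le> 4"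
  shows "norm (D m t v - D m t u) \<le> K * norm (v - u)"
  using D_Taylor[OF assms(1-3), of m 0] assms(4) by simp

lemma D_real: "t \<in> T \<Longrightarrow> Re u < 4 * \<rho> \<Longrightarrow> u \<in> \<real> \<Longrightarrow> D n t u \<in> \<real>"
proof (induction n arbitrary: u)
  case (Suc n)
  have "deriv (D n t) u \<in> \<real>"
    by (rule deriv_real_on_reals[OF hol_D open_strip]) (use Suc in auto)
  then show ?case by simp
qed (simp add: real)

end

text \<open>u + G t u is the logarithm of the position of the characteristic from exp u, and V its
  velocity. \<open>crit\<close> puts the saddle of this logarithm at u = 0 when t = tc,
  \<open>slope\<close> says that its first derivative at 0 crosses zero transversally in time, and
  \<open>V0\<close> makes the amplitude of the main term positive.\<close>

locale saddle_family = G: strip_family G "{t1..t2}" \<rho> B + V: strip_family V "{t1..t2}" \<rho> B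
  for G V :: "real \<Rightarrow> complex \<Rightarrow> complex" and t1 t2 \<rho> B :: real +
  fixes tc \<kappa> \<alpha> :: real
  assumes tc: "t1 < tc" "tc < t2" and \<kappa>: "\<kappa> > 0" and \<alpha>: "\<alpha> > 0"
    and G0: "\<And>t. t \<in> {t1..t2} \<Longrightarrow> G t 0 = 0"
    and gap: "\<And>t u \<theta>. t \<in> {t1..t2} \<Longrightarrow> \<bar>u\<bar> \<le> \<rho> \<Longrightarrow> \<bar>\<theta>\<bar> \<le> pi \<Longrightarrow>
       \<kappa> * \<theta>\<^sup>2 \<le> Re (G t (of_real u + \<i> * of_real \<theta>)) - Re (G t (of_real u))"
    and crit: "deriv (G tc) 0 = - 1"
    and slope: "\<And>t. t \<in> {t1..t2} \<Longrightarrow> \<bar>Re (deriv (G t) 0) + 1 + \<alpha> * (t - tc)\<bar> \<le> B * (t - tc)\<^sup>2"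
    and V0: "Re (deriv (V tc) 0) < 0"
begin

text \<open>The Hessian \<open>lam\<close> and the amplitude \<open>w0\<close> of Laplace's method at a saddle \<open>u\<close>.\<close>

definition lam :: "real \<Rightarrow> real \<Rightarrow> real" where "lam t u = - Re (G.D 2 t (of_real u))"
definition w0 :: "real \<Rightarrow> real \<Rightarrow> real" where "w0 t u = - Re (V.D 1 t (of_real u))"
definition lamc :: real where "lamc = lam tc 0"
definition wc :: real where "wc = w0 tc 0"

text \<open>At a saddle the linear term of G (u + i \<theta>) is - i \<theta> and cancels the
  explicit i \<theta>; the second derivative is real because G is real on the real axis.\<close>

lemma phase_expansion:
  assumes t: "t \<in> {t1..t2}" and u: "\<bar>u\<bar> \<le> \<rho>" and sad: "deriv (G t) (of_real u) = - 1"
  defines "\<phi> \<equiv> \<lambda>\<theta>::real. \<i> * of_real \<theta> + G t (of_real u + \<i> * of_real \<theta>) - G t (of_real u)"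
  shows "norm (\<phi> \<theta> - of_real (lam t u * \<theta>\<^sup>2 / 2) - (- \<i> * G.D 3 t (of_real u) / 6) * of_real \<theta> ^ 3) \<le> G.K * \<theta> ^ 4"
proof -
  let ?u = "complex_of_real u"
  have \<rho>: "\<rho> > 0" by (rule G.\<rho>)
  have "norm (G.D 0 t (?u + \<i> * \<theta>) - (\<Sum>i\<le>3. G.D (0 + i) t ?u * ((?u + \<i> * \<theta>) - ?u) ^ i / fact i))
      \<le> G.K * norm ((?u + \<i> * \<theta>) - ?u) ^ Suc 3"
    by (rule G.D_Taylor[OF t]) (use u \<rho> in auto)
  moreover have "norm ((?u + \<i> * \<theta>) - ?u) ^ Suc 3 = \<theta> ^ 4" by (simp add: norm_mult)
  moreover have "(\<Sum>i\<le>3. G.D (0 + i) t ?u * ((?u + \<i> * \<theta>) - ?u) ^ i / fact i)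
      = G t ?u - \<i> * \<theta> - G.D 2 t ?u * of_real (\<theta>\<^sup>2) / 2 - \<i> * G.D 3 t ?u * of_real \<theta> ^ 3 / 6"
    using sad by (simp add: eval_nat_numeral power_mult_distrib algebra_simps)
  moreover have "G.D 2 t ?u = - of_real (lam t u)"
    using G.D_real[OF t, of ?u 2] u \<rho> by (simp add: lam_def of_real_Re)
  ultimately have "norm (G t (?u + \<i> * \<theta>) - (G t ?u - \<i> * \<theta> + of_real (lam t u) * of_real (\<theta>\<^sup>2) / 2 - \<i> * G.D 3 t ?u * of_real \<theta> ^ 3 / 6)) \<le> G.K * \<theta> ^ 4"
    by simp
  also have "G t (?u + \<i> * \<theta>) - (G t ?u - \<i> * \<theta> + of_real (lam t u) * of_real (\<theta>\<^sup>2) / 2 - \<i> * G.D 3 t ?u * of_real \<theta> ^ 3 / 6)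
     = \<phi> \<theta> - of_real (lam t u * \<theta>\<^sup>2 / 2) - (- \<i> * G.D 3 t ?u / 6) * of_real \<theta> ^ 3"
    by (simp add: \<phi>_def)
  finally show ?thesis .
qed

text \<open>The gap is tested at \<theta> and - \<theta>; adding cancels the cubic term, and
  division by \<theta>^2 with \<theta> tending to 0 leaves the Hessian.\<close>

lemma lam_ge:
  assumes t: "t \<in> {t1..t2}" and u: "\<bar>u\<bar> \<le> \<rho>" and sad: "deriv (G t) (of_real u) = - 1"
  shows "\<kappa> \<le> lam t u / 2"
proof (rule field_le_epsilon)
  fix e :: real assume e: "e > 0"
  \<comment> \<open>Chosen so that the quartic remainder, divided by \<theta>^2, is at most
    e.\<close>
  define \<theta> where "\<theta> = min 1 (sqrt (e / G.K))"
  have K: "G.K > 0" using G.K_pos by simp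
  have th: "\<theta> > 0" "\<theta> \<le> 1" using e K by (auto simp: \<theta>_def)
  have "\<theta>\<^sup>2 \<le> (sqrt (e / G.K))\<^sup>2" using th by (intro power_mono) (auto simp: \<theta>_def)
  then have "G.K * \<theta>\<^sup>2 \<le> e" using e K by (simp add: field_simps)
  let ?c = "- \<i> * G.D 3 t (of_real u) / 6"
  have thpi: "\<bar>\<theta>\<bar> \<le> pi" "\<bar>- \<theta>\<bar> \<le> pi" using th pi_gt3 by auto
  have Re3: "Re (z - of_real x - c * of_real y ^ 3) = Re z - x - Re c * y ^ 3" for z c :: complex and x y :: real
    by (simp flip: of_real_power)
  have *: "\<kappa> * s\<^sup>2 \<le> lam t u * s\<^sup>2 / 2 + Re ?c * s ^ 3 + G.K * s ^ 4" if s: "\<bar>s\<bar> \<le> pi" for s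
  proof -
    have "Re (\<i> * of_real s + G t (of_real u + \<i> * of_real s) - G t (of_real u)) - lam t u * s\<^sup>2 / 2 - Re ?c * s ^ 3
       = Re (\<i> * of_real s + G t (of_real u + \<i> * of_real s) - G t (of_real u) - of_real (lam t u * s\<^sup>2 / 2) - ?c * of_real s ^ 3)"
      by (rule Re3[symmetric])
    also have "\<dots> \<le> G.K * s ^ 4"
      using order_trans[OF complex_Re_le_cmod phase_expansion[OF t u sad]] .
    finally show ?thesis using gap[OF t u s] by simp
  qed
  have "2 * (\<kappa> * \<theta>\<^sup>2) \<le> 2 * (lam t u * \<theta>\<^sup>2 / 2 + G.K * \<theta> ^ 4)"
    using *[OF thpi(1)] *[OF thpi(2)] by simp
  then have "\<kappa> * \<theta>\<^sup>2 \<le> (lam t u / 2 + G.K * \<theta>\<^sup>2) * \<theta>\<^sup>2" by (simp add: power4_eq_xxxx power2_eq_square algebra_simps)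
  then have "\<kappa> \<le> lam t u / 2 + G.K * \<theta>\<^sup>2" using th by simp
  then show "\<kappa> \<le> lam t u / 2 + e" using \<open>G.K * \<theta>\<^sup>2 \<le> e\<close> by linarith
qed

lemma lam_le: "t \<in> {t1..t2} \<Longrightarrow> \<bar>u\<bar> \<le> \<rho> \<Longrightarrow> \<bar>lam t u\<bar> \<le> G.K"
proof -
  assume t: "t \<in> {t1..t2}" and u: "\<bar>u\<bar> \<le> \<rho>"
  have "norm (G.D 2 t (of_real u)) \<le> G.K" by (rule G.D_bound[OF t]) (use u G.\<rho> in auto)
  then show ?thesis unfolding lam_def using abs_Re_le_cmod[of "G.D 2 t (of_real u)"] by simp
qed

text \<open>The error constant of \<open>laplace_uniform\<close> with the common derivative bound in
  place of B; it contains neither the time nor the saddle.\<close>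

definition laplace_const :: real where
  "laplace_const = (600 * G.K ^ 3 * (2 / \<kappa> + 8 / \<kappa>\<^sup>2 + 48 / \<kappa> ^ 3) + G.K * (2 / \<kappa>)) * sqrt (2 * pi / \<kappa>)"

lemma saddle_integral:
  fixes n :: real
  assumes t: "t \<in> {t1..t2}" and u: "\<bar>u\<bar> \<le> \<rho>" and sad: "deriv (G t) (of_real u) = - 1" and n: "n > 0"
  shows "norm (integral {-pi..pi} (\<lambda>\<theta>. - deriv (V t) (of_real u + \<i> * of_real \<theta>)
       * exp (- n * (\<i> * of_real \<theta> + G t (of_real u + \<i> * of_real \<theta>) - G t (of_real u))))
     - complex_of_real (w0 t u) * complex_of_real (sqrt (2 * pi / (n * lam t u)))) \<le> laplace_const / (n * sqrt n)"
proof -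
  let ?u = "complex_of_real u"
  have \<rho>: "\<rho> > 0" by (rule G.\<rho>)
  have c: "continuous_on {-pi..pi} (\<lambda>\<theta>. f (?u + \<i> * of_real \<theta>))" if "f holomorphic_on {u. Re u < 4 * \<rho>}" for f :: "complex \<Rightarrow> complex"
    by (rule continuous_on_compose2[OF holomorphic_on_imp_continuous_on[OF that]])
      (use u \<rho> in \<open>auto intro!: continuous_intros\<close>)
  have c3: "norm (- \<i> * G.D 3 t ?u / 6) \<le> G.K"
  proof -
    have "norm (G.D 3 t ?u) \<le> G.K" by (rule G.D_bound[OF t]) (use u \<rho> in auto)
    moreover have "norm (- \<i> * G.D 3 t ?u / 6) = norm (G.D 3 t ?u) / 6" by (simp add: norm_mult norm_divide)
    ultimately show ?thesis using G.K_pos by linarith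
  qed
  have w0: "V.D 1 t ?u = - of_real (w0 t u)"
    using V.D_real[OF t, of ?u 1] u \<rho> by (simp add: w0_def of_real_Re)
  have W: "norm (- deriv (V t) (?u + \<i> * of_real \<theta>) - of_real (w0 t u) - (- \<i> * V.D 2 t ?u) * of_real \<theta>) \<le> G.K * \<theta>\<^sup>2" for \<theta> :: real
  proof -
    have "norm (V.D 1 t (?u + \<i> * \<theta>) - (\<Sum>i\<le>1. V.D (1 + i) t ?u * ((?u + \<i> * \<theta>) - ?u) ^ i / fact i))
      \<le> G.K * norm ((?u + \<i> * \<theta>) - ?u) ^ Suc 1"
      by (rule V.D_Taylor[OF t]) (use u \<rho> in auto)
    also have "G.K * norm ((?u + \<i> * \<theta>) - ?u) ^ Suc 1 = G.K * \<theta>\<^sup>2" by (simp add: norm_mult power2_eq_square)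
    also have "V.D 1 t (?u + \<i> * \<theta>) - (\<Sum>i\<le>1. V.D (1 + i) t ?u * ((?u + \<i> * \<theta>) - ?u) ^ i / fact i)
       = - (- deriv (V t) (?u + \<i> * of_real \<theta>) - of_real (w0 t u) - (- \<i> * V.D 2 t ?u) * of_real \<theta>)"
      using w0 by (simp add: numeral_2_eq_2 algebra_simps)
    finally show ?thesis by (simp only: norm_minus_cancel)
  qed
  show ?thesis
    unfolding laplace_const_def
  proof (rule laplace_uniform[OF G.K_pos n \<kappa> _ _ phase_expansion[OF t u sad] W _ lam_ge[OF t u sad] c3])
    show "continuous_on {-pi..pi} (\<lambda>\<theta>. \<i> * of_real \<theta> + G t (?u + \<i> * of_real \<theta>) - G t ?u)"
      by (intro continuous_intros c G.hol t)
    show "continuous_on {-pi..pi} (\<lambda>\<theta>. - deriv (V t) (?u + \<i> * of_real \<theta>))"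
      by (intro continuous_intros c holomorphic_deriv V.hol t V.open_strip)
    show "\<kappa> * \<theta>\<^sup>2 \<le> Re (\<i> * of_real \<theta> + G t (?u + \<i> * of_real \<theta>) - G t ?u)" if "\<bar>\<theta>\<bar> \<le> pi" for \<theta>
      using gap[OF t u that] by simp
    show "norm (complex_of_real (w0 t u)) \<le> G.K"
    proof -
      have "norm (V.D 1 t ?u) \<le> G.K" by (rule V.D_bound[OF t]) (use u \<rho> in auto)
      then show ?thesis unfolding w0 by simp
    qed
    show "norm (- \<i> * V.D 2 t ?u) \<le> G.K"
    proof -
      have "norm (V.D 2 t ?u) \<le> G.K" by (rule V.D_bound[OF t]) (use u \<rho> in auto)
      then show ?thesis by (simp add: norm_mult)
    qed
  qed
qed

end

lemma inverse_sqrt_diff_le: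
  fixes x y m :: real
  assumes "0 < m" "m \<le> x" "m \<le> y"
  shows "\<bar>1 / sqrt x - 1 / sqrt y\<bar> \<le> \<bar>x - y\<bar> / (m * sqrt m)"
proof -
  have p: "sqrt x > 0" "sqrt y > 0" "sqrt m > 0" using assms by auto
  have "(1 / sqrt x - 1 / sqrt y) * (sqrt x * sqrt y * (sqrt x + sqrt y)) = (sqrt y - sqrt x) * (sqrt x + sqrt y)"
    using p by (simp add: field_simps)
  also have "\<dots> = y - x" using assms by (simp add: algebra_simps)
  finally have eq: "(1 / sqrt x - 1 / sqrt y) * (sqrt x * sqrt y * (sqrt x + sqrt y)) = y - x" .
  have "0 < sqrt x * sqrt y * (sqrt x + sqrt y)" using p by (intro mult_pos_pos add_pos_pos)
  then have "sqrt x * sqrt y * (sqrt x + sqrt y) \<noteq> 0" by (rule less_imp_neq[symmetric])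
  from nonzero_eq_divide_eq[OF this] eq have "1 / sqrt x - 1 / sqrt y = (y - x) / (sqrt x * sqrt y * (sqrt x + sqrt y))"
    by blast
  then have "\<bar>1 / sqrt x - 1 / sqrt y\<bar> = \<bar>x - y\<bar> / (sqrt x * sqrt y * (sqrt x + sqrt y))"
    using p by (simp add: abs_minus_commute)
  also have "\<dots> \<le> \<bar>x - y\<bar> / (m * sqrt m)"
  proof (rule frac_le)
    have "sqrt m * sqrt m * (sqrt m + 0) \<le> sqrt x * sqrt y * (sqrt x + sqrt y)"
      using p assms by (intro mult_mono add_mono) auto
    then show "m * sqrt m \<le> sqrt x * sqrt y * (sqrt x + sqrt y)" using assms by simp
  qed (use assms in auto)
  finally show ?thesis .
qed

section \<open>Location of the saddle, its critical value and the resulting asymptotics\<close>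

context saddle_family
begin

lemma crit_in: "tc \<in> {t1..t2}" using tc by simp

lemma lamc_ge: "2 * \<kappa> \<le> lamc"
  using lam_ge[OF crit_in, of 0] G.\<rho> crit by (simp add: lamc_def)

lemma wc_pos: "wc > 0"
  using V0 by (simp add: wc_def w0_def)

lemma B_le_K: "B \<le> G.K"
  using G.K_ge[of 0] by simp

text \<open>To first order the saddle is at - \<alpha> \<delta> / lamc. The factor 2 provides the
  margin for the intermediate value theorem.\<close>

definition kk :: real where "kk = 2 * \<alpha> / lamc"

lemma kk_pos: "kk > 0" using \<alpha> lamc_ge \<kappa> by (simp add: kk_def)

lemma Re_Taylor:
  fixes u :: real
  assumes t: "t \<in> {t1..t2}" and u: "\<bar>u\<bar> \<le> \<rho>"
  shows "\<bar>Re (deriv (G t) (of_real u)) - Re (deriv (G t) 0) - Re (G.D 2 t 0) * u\<bar> \<le> G.K * u\<^sup>2"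
    and "\<bar>Re (G t (of_real u)) - Re (deriv (G t) 0) * u - Re (G.D 2 t 0) * u\<^sup>2 / 2\<bar> \<le> G.K * \<bar>u\<bar> ^ 3"
proof -
  let ?u = "complex_of_real u"
  have r: "Re (z * of_real y) = Re z * y" for z y by simp
  have "norm (G.D 1 t ?u - (\<Sum>i\<le>1. G.D (1 + i) t 0 * (?u - 0) ^ i / fact i)) \<le> G.K * norm (?u - 0) ^ Suc 1"
    by (rule G.D_Taylor[OF t]) (use u G.\<rho> in auto)
  then have "norm (deriv (G t) ?u - (deriv (G t) 0 + G.D 2 t 0 * ?u)) \<le> G.K * u\<^sup>2"
    by (simp add: numeral_2_eq_2)
  from order_trans[OF abs_Re_le_cmod this]
  show "\<bar>Re (deriv (G t) ?u) - Re (deriv (G t) 0) - Re (G.D 2 t 0) * u\<bar> \<le> G.K * u\<^sup>2"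
    by (simp add: diff_diff_eq)
  have "norm (G.D 0 t ?u - (\<Sum>i\<le>2. G.D (0 + i) t 0 * (?u - 0) ^ i / fact i)) \<le> G.K * norm (?u - 0) ^ Suc 2"
    by (rule G.D_Taylor[OF t]) (use u G.\<rho> in auto)
  then have "norm (G t ?u - (deriv (G t) 0 * of_real u + G.D 2 t 0 / 2 * of_real (u\<^sup>2))) \<le> G.K * \<bar>u\<bar> ^ 3"
    using G0[OF t] by (simp add: numeral_2_eq_2 numeral_3_eq_3)
  from order_trans[OF abs_Re_le_cmod this]
  show "\<bar>Re (G t ?u) - Re (deriv (G t) 0) * u - Re (G.D 2 t 0) * u\<^sup>2 / 2\<bar> \<le> G.K * \<bar>u\<bar> ^ 3"
    by (simp add: diff_diff_eq del: of_real_power)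
qed

lemma curvature_Lipschitz: "t \<in> {t1..t2} \<Longrightarrow> \<bar>Re (G.D 2 t 0) + lamc\<bar> \<le> G.K * \<bar>t - tc\<bar>"
proof -
  assume t: "t \<in> {t1..t2}"
  have "norm (G.D 2 t 0 - G.D 2 tc 0) \<le> G.K * \<bar>t - tc\<bar>"
    by (rule G.D_Lipschitz_time[OF t crit_in]) (use G.\<rho> in auto)
  then show ?thesis using abs_Re_le_cmod[of "G.D 2 t 0 - G.D 2 tc 0"] by (simp add: lamc_def lam_def)
qed

definition Q1 :: real where "Q1 = G.K * (1 + kk + kk\<^sup>2)"

lemma Q1_pos: "Q1 > 0"
  unfolding Q1_def using G.K_pos kk_pos by (intro mult_pos_pos add_pos_nonneg) auto

text \<open>The linear model of the saddle equation. The three parts of \<open>Q1\<close> come from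
  the slope at 0, from the drift of the curvature in time, and from the Taylor remainder in
  u.\<close>

lemma gradient_expansion:
  fixes u \<delta> :: real
  assumes t: "tc + \<delta> \<in> {t1..t2}" and u: "\<bar>u\<bar> \<le> \<rho>" "\<bar>u\<bar> \<le> kk * \<bar>\<delta>\<bar>"
  shows "\<bar>Re (deriv (G (tc + \<delta>)) (of_real u)) + 1 + \<alpha> * \<delta> + lamc * u\<bar> \<le> Q1 * \<delta>\<^sup>2"
proof -
  let ?t = "tc + \<delta>"
  have 1: "\<bar>Re (deriv (G ?t) (of_real u)) - Re (deriv (G ?t) 0) - Re (G.D 2 ?t 0) * u\<bar> \<le> G.K * (kk\<^sup>2 * \<delta>\<^sup>2)"
  proof (rule order_trans[OF Re_Taylor(1)[OF t u(1)]])
    have "\<bar>u\<bar>\<^sup>2 \<le> (kk * \<bar>\<delta>\<bar>)\<^sup>2" using u(2) by (rule power_mono) simp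
    then show "G.K * u\<^sup>2 \<le> G.K * (kk\<^sup>2 * \<delta>\<^sup>2)" using G.K_pos by (simp add: power_mult_distrib)
  qed
  have 2: "\<bar>(Re (G.D 2 ?t 0) + lamc) * u\<bar> \<le> G.K * (kk * \<delta>\<^sup>2)"
  proof -
    have "\<bar>(Re (G.D 2 ?t 0) + lamc) * u\<bar> \<le> (G.K * \<bar>?t - tc\<bar>) * (kk * \<bar>\<delta>\<bar>)"
      unfolding abs_mult using curvature_Lipschitz[OF t] u(2) G.K_pos by (intro mult_mono) auto
    then show ?thesis by (simp add: power2_eq_square mult_ac)
  qed
  have 3: "\<bar>Re (deriv (G ?t) 0) + 1 + \<alpha> * \<delta>\<bar> \<le> G.K * \<delta>\<^sup>2"
    using slope[OF t] mult_right_mono[OF B_le_K, of "\<delta>\<^sup>2"] by simp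
  have "\<bar>Re (deriv (G ?t) (of_real u)) + 1 + \<alpha> * \<delta> + lamc * u\<bar>
     = \<bar>(Re (deriv (G ?t) (of_real u)) - Re (deriv (G ?t) 0) - Re (G.D 2 ?t 0) * u) + (Re (G.D 2 ?t 0) + lamc) * u + (Re (deriv (G ?t) 0) + 1 + \<alpha> * \<delta>)\<bar>"
    by (simp add: algebra_simps)
  also have "\<dots> \<le> G.K * (kk\<^sup>2 * \<delta>\<^sup>2) + G.K * (kk * \<delta>\<^sup>2) + G.K * \<delta>\<^sup>2"
    using 1 2 3 by linarith
  also have "\<dots> = Q1 * \<delta>\<^sup>2" by (simp add: Q1_def algebra_simps)
  finally show ?thesis .
qed

text \<open>The coefficient of \<delta>^2 in the critical value of the model phase - \<alpha>
  \<delta> u - lamc u^2 / 2.\<close>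

definition dc :: real where "dc = \<alpha>\<^sup>2 / (2 * lamc)"
definition Q2 :: real where "Q2 = G.K * (kk + kk\<^sup>2 + kk ^ 3) + Q1\<^sup>2 / (2 * lamc)"
text \<open>The entries ensure in turn: |\<delta>| \<le> 1, a time within range, a saddle with |u|
  \<le> \<rho>, a change of sign of the gradient, and an amplitude of at least half its critical
  value.\<close>

definition \<delta>0 :: real where "\<delta>0 = Min {1, tc - t1, t2 - tc, \<rho> / kk, \<alpha> / Q1, wc / (2 * (G.K * (1 + kk)))}"

lemma \<delta>0_pos: "\<delta>0 > 0"
  unfolding \<delta>0_def using tc G.\<rho> kk_pos \<alpha> Q1_pos wc_pos G.K_pos by simp

lemma \<delta>0_le:
  assumes "\<bar>\<delta>\<bar> < \<delta>0"
  shows "\<bar>\<delta>\<bar> \<le> 1" "tc + \<delta> \<in> {t1..t2}" "kk * \<bar>\<delta>\<bar> \<le> \<rho>" "Q1 * \<bar>\<delta>\<bar> \<le> \<alpha>" "G.K * (1 + kk) * \<bar>\<delta>\<bar> \<le> wc / 2"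
proof -
  have *: "\<bar>\<delta>\<bar> < 1" "\<bar>\<delta>\<bar> < tc - t1" "\<bar>\<delta>\<bar> < t2 - tc" "\<bar>\<delta>\<bar> < \<rho> / kk" "\<bar>\<delta>\<bar> < \<alpha> / Q1" "\<bar>\<delta>\<bar> < wc / (2 * (G.K * (1 + kk)))"
    using assms unfolding \<delta>0_def by simp_all
  show "\<bar>\<delta>\<bar> \<le> 1" "tc + \<delta> \<in> {t1..t2}" using * by auto
  show "kk * \<bar>\<delta>\<bar> \<le> \<rho>" using *(4) kk_pos by (simp add: field_simps)
  show "Q1 * \<bar>\<delta>\<bar> \<le> \<alpha>" using *(5) Q1_pos by (simp add: field_simps)
  have "0 < G.K * (1 + kk)" using G.K_pos kk_pos by (intro mult_pos_pos) auto
  then show "G.K * (1 + kk) * \<bar>\<delta>\<bar> \<le> wc / 2" using *(6) by (simp only: pos_less_divide_eq) (simp add: field_simps)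
qed

lemma saddle_exists:
  assumes \<delta>: "\<bar>\<delta>\<bar> < \<delta>0"
  obtains u :: real where "\<bar>u\<bar> \<le> kk * \<bar>\<delta>\<bar>" "deriv (G (tc + \<delta>)) (of_real u) = - 1"
proof -
  note d = \<delta>0_le[OF \<delta>]
  let ?f = "\<lambda>u. Re (deriv (G (tc + \<delta>)) (of_real u)) + 1" and ?m = "kk * \<bar>\<delta>\<bar>"
  have m0: "0 \<le> ?m" using kk_pos by simp
  have q: "Q1 * \<delta>\<^sup>2 \<le> \<alpha> * \<bar>\<delta>\<bar>"
    using mult_right_mono[OF d(4), of "\<bar>\<delta>\<bar>"] by (simp add: power2_eq_square mult.assoc)
  have lk: "lamc * ?m = 2 * \<alpha> * \<bar>\<delta>\<bar>" using lamc_ge \<kappa> by (simp add: kk_def)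
  have ad: "\<alpha> * \<delta> \<le> \<alpha> * \<bar>\<delta>\<bar>" "- (\<alpha> * \<bar>\<delta>\<bar>) \<le> \<alpha> * \<delta>"
    using \<alpha> mult_left_mono[of \<delta> "\<bar>\<delta>\<bar>" \<alpha>] mult_left_mono[of "- \<bar>\<delta>\<bar>" \<delta> \<alpha>] by auto
  \<comment> \<open>At the endpoints lamc u has size 2 \<alpha> |\<delta>|, which beats \<alpha>
    \<delta> together with the error Q1 \<delta>^2 \<le> \<alpha> |\<delta>|.\<close>
  have "\<exists>u\<ge>- ?m. u \<le> ?m \<and> ?f u = 0"
  proof (rule IVT2'[where f = ?f and a = "- ?m" and b = ?m and y = 0])
    show "?f ?m \<le> 0" using gradient_expansion[OF d(2), of ?m] d(3) m0 lk q ad by (simp add: abs_le_iff)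
    show "0 \<le> ?f (- ?m)" using gradient_expansion[OF d(2), of "- ?m"] d(3) m0 lk q ad by (simp add: abs_le_iff)
    show "- ?m \<le> ?m" using m0 by simp
    have hd: "deriv (G (tc + \<delta>)) holomorphic_on {u. Re u < 4 * \<rho>}"
      using G.hol_D[OF d(2), of 1] by simp
    have "continuous_on {-?m..?m} (\<lambda>u. deriv (G (tc + \<delta>)) (complex_of_real u))"
      by (rule continuous_on_compose2[OF holomorphic_on_imp_continuous_on[OF hd]])
        (use d(3) G.\<rho> in \<open>auto intro!: continuous_intros\<close>)
    then show "continuous_on {-?m..?m} ?f" by (intro continuous_intros)
  qed
  then obtain u where u': "- ?m \<le> u" "u \<le> ?m" "?f u = 0" by blast
  then have u: "\<bar>u\<bar> \<le> ?m" "?f u = 0" by linarith+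
  \<comment> \<open>Being real on the real axis upgrades the zero of the real part to the complex
    saddle equation.\<close>
  have "G.D 1 (tc + \<delta>) (of_real u) \<in> \<real>" by (rule G.D_real[OF d(2)]) (use u d(3) G.\<rho> in auto)
  then have "deriv (G (tc + \<delta>)) (of_real u) = of_real (Re (deriv (G (tc + \<delta>)) (of_real u)))"
    by (simp add: of_real_Re)
  also have "Re (deriv (G (tc + \<delta>)) (of_real u)) = - 1" using u(2) by simp
  finally show thesis using that[OF u(1)] by simp
qed

text \<open>As functions of \<open>\<delta> = t - tc\<close>: the saddle \<open>us\<close> in the logarithmic coordinate, and below the phase
  \<open>Yf\<close>, the amplitude \<open>ampf\<close> and the Hessian \<open>lf\<close> there.\<close>

definition us :: "real \<Rightarrow> real" where
  "us \<delta> = (SOME u. \<bar>u\<bar> \<le> kk * \<bar>\<delta>\<bar> \<and> deriv (G (tc + \<delta>)) (of_real u) = - 1)"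

lemma us:
  assumes \<delta>: "\<bar>\<delta>\<bar> < \<delta>0"
  shows "\<bar>us \<delta>\<bar> \<le> kk * \<bar>\<delta>\<bar>" "deriv (G (tc + \<delta>)) (of_real (us \<delta>)) = - 1" "\<bar>us \<delta>\<bar> \<le> \<rho>"
proof -
  have "\<exists>u. \<bar>u\<bar> \<le> kk * \<bar>\<delta>\<bar> \<and> deriv (G (tc + \<delta>)) (of_real u) = - 1"
    by (rule saddle_exists[OF \<delta>]) blast
  then have "\<bar>us \<delta>\<bar> \<le> kk * \<bar>\<delta>\<bar> \<and> deriv (G (tc + \<delta>)) (of_real (us \<delta>)) = - 1"
    unfolding us_def by (rule someI_ex)
  then show "\<bar>us \<delta>\<bar> \<le> kk * \<bar>\<delta>\<bar>" "deriv (G (tc + \<delta>)) (of_real (us \<delta>)) = - 1" by auto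
  then show "\<bar>us \<delta>\<bar> \<le> \<rho>" using \<delta>0_le(3)[OF \<delta>] by linarith
qed

definition Yf :: "real \<Rightarrow> real" where "Yf \<delta> = us \<delta> + Re (G (tc + \<delta>) (of_real (us \<delta>)))"

text \<open>A critical value does not feel a first-order error in the position of the critical
  point. The saddle is known only up to O(\<delta>^2), yet the value is known up to O(\<delta>^3),
  which is what D = d + O(\<epsilon>) requires after division by \<epsilon>^2.\<close>

lemma Yf_expansion:
  assumes \<delta>: "\<bar>\<delta>\<bar> < \<delta>0"
  shows "\<bar>Yf \<delta> - dc * \<delta>\<^sup>2\<bar> \<le> Q2 * \<bar>\<delta>\<bar> ^ 3"
proof -
  note d = \<delta>0_le[OF \<delta>]
  define u where "u = us \<delta>"
  let ?t = "tc + \<delta>"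
  have u: "\<bar>u\<bar> \<le> kk * \<bar>\<delta>\<bar>" "\<bar>u\<bar> \<le> \<rho>" "deriv (G ?t) (of_real u) = - 1"
    using us[OF \<delta>] by (auto simp: u_def)
  have lc: "lamc > 0" using lamc_ge \<kappa> by simp
  \<comment> \<open>The defect of the saddle in the linear model. Completing the square makes it
    enter the critical value only through e^2 / (2 lamc).\<close>
  define e where "e = lamc * u + \<alpha> * \<delta>"
  have e: "\<bar>e\<bar> \<le> Q1 * \<delta>\<^sup>2" using gradient_expansion[OF d(2) u(2,1)] u(3) by (simp add: e_def add.commute)
  have K0: "G.K \<ge> 0" using G.K_pos by simp
  have d3: "\<bar>\<delta>\<bar> ^ 3 = \<bar>\<delta>\<bar> * \<delta>\<^sup>2" by (simp add: power3_eq_cube power2_eq_square)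
  have u2: "u\<^sup>2 \<le> kk\<^sup>2 * \<delta>\<^sup>2"
    using power_mono[OF u(1), of 2] by (simp add: power_mult_distrib)
  have u3: "\<bar>u\<bar> ^ 3 \<le> kk ^ 3 * \<bar>\<delta>\<bar> ^ 3"
    using power_mono[OF u(1), of 3] by (simp add: power_mult_distrib)
  have 1: "\<bar>Re (G ?t (of_real u)) - Re (deriv (G ?t) 0) * u - Re (G.D 2 ?t 0) * u\<^sup>2 / 2\<bar> \<le> G.K * kk ^ 3 * \<bar>\<delta>\<bar> ^ 3"
    using order_trans[OF Re_Taylor(2)[OF d(2) u(2)] mult_left_mono[OF u3 K0]] by simp
  have 2: "\<bar>(Re (deriv (G ?t) 0) + 1 + \<alpha> * \<delta>) * u\<bar> \<le> G.K * kk * \<bar>\<delta>\<bar> ^ 3"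
  proof -
    have "\<bar>Re (deriv (G ?t) 0) + 1 + \<alpha> * \<delta>\<bar> \<le> G.K * \<delta>\<^sup>2"
      using slope[OF d(2)] mult_right_mono[OF B_le_K, of "\<delta>\<^sup>2"] by simp
    then have "\<bar>(Re (deriv (G ?t) 0) + 1 + \<alpha> * \<delta>) * u\<bar> \<le> (G.K * \<delta>\<^sup>2) * (kk * \<bar>\<delta>\<bar>)"
      unfolding abs_mult using u(1) K0 by (intro mult_mono) auto
    then show ?thesis by (simp add: d3 mult_ac)
  qed
  have 3: "\<bar>(Re (G.D 2 ?t 0) + lamc) * u\<^sup>2 / 2\<bar> \<le> G.K * kk\<^sup>2 * \<bar>\<delta>\<bar> ^ 3"
  proof -
    have "\<bar>(Re (G.D 2 ?t 0) + lamc) * u\<^sup>2\<bar> \<le> (G.K * \<bar>\<delta>\<bar>) * (kk\<^sup>2 * \<delta>\<^sup>2)"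
      unfolding abs_mult using curvature_Lipschitz[OF d(2)] u2 K0 by (intro mult_mono) auto
    then have "\<bar>(Re (G.D 2 ?t 0) + lamc) * u\<^sup>2\<bar> \<le> G.K * kk\<^sup>2 * \<bar>\<delta>\<bar> ^ 3" by (simp add: d3 mult_ac)
    moreover have "\<bar>(Re (G.D 2 ?t 0) + lamc) * u\<^sup>2 / 2\<bar> \<le> \<bar>(Re (G.D 2 ?t 0) + lamc) * u\<^sup>2\<bar>" by simp
    ultimately show ?thesis by linarith
  qed
  have 4: "\<bar>e\<^sup>2 / (2 * lamc)\<bar> \<le> Q1\<^sup>2 / (2 * lamc) * \<bar>\<delta>\<bar> ^ 3"
  proof -
    have "\<bar>e\<bar>\<^sup>2 \<le> (Q1 * \<delta>\<^sup>2)\<^sup>2" using e by (rule power_mono) simp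
    also have "\<dots> = Q1\<^sup>2 * (\<bar>\<delta>\<bar> * \<bar>\<delta>\<bar> ^ 3)" by (simp add: power_mult_distrib power2_eq_square power3_eq_cube)
    also have "\<dots> \<le> Q1\<^sup>2 * (1 * \<bar>\<delta>\<bar> ^ 3)" using d(1) by (intro mult_left_mono mult_right_mono) auto
    finally show ?thesis using lc by (simp add: divide_right_mono)
  qed
  have "\<alpha> * \<delta> = e - lamc * u" by (simp add: e_def)
  then have "dc * \<delta>\<^sup>2 = (e - lamc * u)\<^sup>2 / (2 * lamc)"
    unfolding dc_def by (metis power_mult_distrib times_divide_eq_left)
  also have "\<dots> = e\<^sup>2 / (2 * lamc) - e * u + lamc * u\<^sup>2 / 2"
    using lc by (simp add: power2_eq_square field_simps)
  finally have "dc * \<delta>\<^sup>2 = e\<^sup>2 / (2 * lamc) - \<alpha> * \<delta> * u - lamc * u\<^sup>2 / 2"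
    by (simp add: e_def power2_eq_square algebra_simps)
  then have eq: "Yf \<delta> - dc * \<delta>\<^sup>2 = (Re (G ?t (of_real u)) - Re (deriv (G ?t) 0) * u - Re (G.D 2 ?t 0) * u\<^sup>2 / 2)
      + (Re (deriv (G ?t) 0) + 1 + \<alpha> * \<delta>) * u + (Re (G.D 2 ?t 0) + lamc) * u\<^sup>2 / 2 - e\<^sup>2 / (2 * lamc)"
    by (simp add: Yf_def u_def[symmetric] algebra_simps add_divide_distrib)
  have "\<bar>Yf \<delta> - dc * \<delta>\<^sup>2\<bar> \<le> G.K * kk ^ 3 * \<bar>\<delta>\<bar> ^ 3 + G.K * kk * \<bar>\<delta>\<bar> ^ 3 + G.K * kk\<^sup>2 * \<bar>\<delta>\<bar> ^ 3 + Q1\<^sup>2 / (2 * lamc) * \<bar>\<delta>\<bar> ^ 3"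
    unfolding eq using 1 2 3 4 by linarith
  also have "\<dots> = Q2 * \<bar>\<delta>\<bar> ^ 3"
  proof -
    have "K * c * z + K * a * z + K * b * z + q * z = (K * (a + b + c) + q) * z" for K a b c q z :: real
      by (simp add: algebra_simps)
    then show ?thesis unfolding Q2_def .
  qed
  finally show ?thesis .
qed

definition ampf :: "real \<Rightarrow> real" where "ampf \<delta> = w0 (tc + \<delta>) (us \<delta>)"
definition lf :: "real \<Rightarrow> real" where "lf \<delta> = lam (tc + \<delta>) (us \<delta>)"

lemma ampf_lf_Lipschitz:
  assumes \<delta>: "\<bar>\<delta>\<bar> < \<delta>0"
  shows "\<bar>ampf \<delta> - wc\<bar> \<le> G.K * (1 + kk) * \<bar>\<delta>\<bar>" "\<bar>lf \<delta> - lamc\<bar> \<le> G.K * (1 + kk) * \<bar>\<delta>\<bar>"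
proof -
  note d = \<delta>0_le[OF \<delta>]
  have u: "\<bar>us \<delta>\<bar> \<le> kk * \<bar>\<delta>\<bar>" "\<bar>us \<delta>\<bar> \<le> \<rho>" using us[OF \<delta>] by auto
  have *: "\<bar>Re a - Re c\<bar> \<le> G.K * (1 + kk) * \<bar>\<delta>\<bar>"
    if "norm (a - b) \<le> G.K * norm (complex_of_real (us \<delta>) - 0)" "norm (b - c) \<le> G.K * \<bar>(tc + \<delta>) - tc\<bar>" for a b c :: complex
  proof -
    have "\<bar>Re a - Re c\<bar> \<le> norm (a - c)" using abs_Re_le_cmod[of "a - c"] by simp
    also have "\<dots> \<le> norm (a - b) + norm (b - c)" using norm_triangle_ineq[of "a - b" "b - c"] by simp
    also have "\<dots> \<le> G.K * (kk * \<bar>\<delta>\<bar>) + G.K * \<bar>\<delta>\<bar>"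
    proof (rule add_mono)
      have "G.K * \<bar>us \<delta>\<bar> \<le> G.K * (kk * \<bar>\<delta>\<bar>)" using u(1) G.K_pos by (intro mult_left_mono) auto
      with that(1) show "norm (a - b) \<le> G.K * (kk * \<bar>\<delta>\<bar>)" by simp
      show "norm (b - c) \<le> G.K * \<bar>\<delta>\<bar>" using that(2) by simp
    qed
    finally show ?thesis by (simp add: algebra_simps)
  qed
  have "\<bar>Re (V.D 1 (tc + \<delta>) (of_real (us \<delta>))) - Re (V.D 1 tc 0)\<bar> \<le> G.K * (1 + kk) * \<bar>\<delta>\<bar>"
    by (rule *[OF V.D_Lipschitz_space[OF d(2)] V.D_Lipschitz_time[OF d(2) crit_in]]) (use u G.\<rho> in auto)
  then show "\<bar>ampf \<delta> - wc\<bar> \<le> G.K * (1 + kk) * \<bar>\<delta>\<bar>" by (simp add: ampf_def wc_def w0_def)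
  have "\<bar>Re (G.D 2 (tc + \<delta>) (of_real (us \<delta>))) - Re (G.D 2 tc 0)\<bar> \<le> G.K * (1 + kk) * \<bar>\<delta>\<bar>"
    by (rule *[OF G.D_Lipschitz_space[OF d(2)] G.D_Lipschitz_time[OF d(2) crit_in]]) (use u G.\<rho> in auto)
  then show "\<bar>lf \<delta> - lamc\<bar> \<le> G.K * (1 + kk) * \<bar>\<delta>\<bar>" by (simp add: lf_def lamc_def lam_def)
qed

lemma lf_bounds: "\<bar>\<delta>\<bar> < \<delta>0 \<Longrightarrow> 2 * \<kappa> \<le> lf \<delta>" "\<bar>\<delta>\<bar> < \<delta>0 \<Longrightarrow> lf \<delta> \<le> G.K"
  using lam_ge[of "tc + \<delta>" "us \<delta>"] lam_le[of "tc + \<delta>" "us \<delta>"] us[of \<delta>] \<delta>0_le(2)[of \<delta>] by (auto simp: lf_def)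

lemma ampf_ge: "\<bar>\<delta>\<bar> < \<delta>0 \<Longrightarrow> wc / 2 \<le> ampf \<delta>"
  using ampf_lf_Lipschitz(1)[of \<delta>] \<delta>0_le(5)[of \<delta>] by (simp add: abs_le_iff)

text \<open>Laplace's main term, amplitude times the square root of 2 \<pi> / (n lam), divided by
  the prefactor 2 \<pi> n of the coefficient and stripped of n^(-3/2).\<close>

definition Cf :: "real \<Rightarrow> real" where "Cf \<delta> = ampf \<delta> / sqrt (2 * pi * lf \<delta>)"
definition cc :: real where "cc = wc / sqrt (2 * pi * lamc)"

lemma Cf_ge: "\<bar>\<delta>\<bar> < \<delta>0 \<Longrightarrow> (wc / 2) / sqrt (2 * pi * G.K) \<le> Cf \<delta>"
  unfolding Cf_def using ampf_ge[of \<delta>] lf_bounds[of \<delta>] wc_pos \<kappa> by (intro frac_le real_sqrt_le_mono) auto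

lemma Cf_Lipschitz:
  obtains Q where "\<And>\<delta>. \<bar>\<delta>\<bar> < \<delta>0 \<Longrightarrow> \<bar>Cf \<delta> - cc\<bar> \<le> Q * \<bar>\<delta>\<bar>"
proof
  fix \<delta> assume \<delta>: "\<bar>\<delta>\<bar> < \<delta>0"
  let ?L = "G.K * (1 + kk)" and ?m = "2 * pi * (2 * \<kappa>)"
  have m: "0 < ?m" "?m \<le> 2 * pi * lf \<delta>" "?m \<le> 2 * pi * lamc"
    using \<kappa> lf_bounds(1)[OF \<delta>] lamc_ge by (auto intro!: mult_left_mono)
  have eq: "Cf \<delta> - cc = (ampf \<delta> - wc) / sqrt (2 * pi * lf \<delta>) + wc * (1 / sqrt (2 * pi * lf \<delta>) - 1 / sqrt (2 * pi * lamc))"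
    by (simp add: Cf_def cc_def diff_divide_distrib algebra_simps)
  have "\<bar>Cf \<delta> - cc\<bar> \<le> \<bar>ampf \<delta> - wc\<bar> / sqrt (2 * pi * lf \<delta>) + wc * \<bar>1 / sqrt (2 * pi * lf \<delta>) - 1 / sqrt (2 * pi * lamc)\<bar>"
    unfolding eq
  proof (intro order_trans[OF abs_triangle_ineq] add_mono)
    have "0 \<le> lf \<delta>" using lf_bounds(1)[OF \<delta>] \<kappa> by simp
    then show "\<bar>(ampf \<delta> - wc) / sqrt (2 * pi * lf \<delta>)\<bar> \<le> \<bar>ampf \<delta> - wc\<bar> / sqrt (2 * pi * lf \<delta>)"
      by (simp add: abs_divide)
    show "\<bar>wc * (1 / sqrt (2 * pi * lf \<delta>) - 1 / sqrt (2 * pi * lamc))\<bar> \<le> wc * \<bar>1 / sqrt (2 * pi * lf \<delta>) - 1 / sqrt (2 * pi * lamc)\<bar>"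
      using wc_pos by (simp add: abs_mult del: abs_divide)
  qed
  also have "\<dots> \<le> ?L * \<bar>\<delta>\<bar> / sqrt ?m + wc * (\<bar>2 * pi * lf \<delta> - 2 * pi * lamc\<bar> / (?m * sqrt ?m))"
    using ampf_lf_Lipschitz(1)[OF \<delta>] m wc_pos
    by (intro add_mono frac_le mult_left_mono inverse_sqrt_diff_le real_sqrt_le_mono) auto
  also have "\<bar>2 * pi * lf \<delta> - 2 * pi * lamc\<bar> = 2 * pi * \<bar>lf \<delta> - lamc\<bar>"
    by (simp add: abs_mult flip: right_diff_distrib)
  also have "?L * \<bar>\<delta>\<bar> / sqrt ?m + wc * (2 * pi * \<bar>lf \<delta> - lamc\<bar> / (?m * sqrt ?m)) \<le> ?L * \<bar>\<delta>\<bar> / sqrt ?m + wc * (2 * pi * (?L * \<bar>\<delta>\<bar>) / (?m * sqrt ?m))"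
    using ampf_lf_Lipschitz(2)[OF \<delta>] m wc_pos
    by (intro add_left_mono mult_left_mono divide_right_mono) auto
  also have "\<dots> = (?L / sqrt ?m + wc * (2 * pi * ?L / (?m * sqrt ?m))) * \<bar>\<delta>\<bar>" by (simp add: algebra_simps)
  finally show "\<bar>Cf \<delta> - cc\<bar> \<le> (?L / sqrt ?m + wc * (2 * pi * ?L / (?m * sqrt ?m))) * \<bar>\<delta>\<bar>" .
qed

text \<open>The absolute error is of order n^(-3/2) and the main term of order n^(-1/2), with
  constants bounded above and below uniformly in \<delta>; their quotient is the relative error
  O(1/n).\<close>

lemma coefficient_asymptotics:
  fixes x :: "nat \<Rightarrow> real \<Rightarrow> real" and i :: nat
  assumes \<delta>: "\<bar>\<delta>\<bar> < \<delta>0" and i: "i \<ge> 1"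
    and coeff: "of_real (2 * pi * (real i * x i (tc + \<delta>))) =
      integral {-pi..pi} (\<lambda>\<theta>. - deriv (V (tc + \<delta>)) (of_real (us \<delta>) + \<i> * of_real \<theta>)
         * exp (- of_nat i * (of_real (us \<delta>) + \<i> * of_real \<theta> + G (tc + \<delta>) (of_real (us \<delta>) + \<i> * of_real \<theta>))))"
  shows "\<bar>x i (tc + \<delta>) / (Cf \<delta> * real i powr (- 3 / 2) * exp (- Yf \<delta> * real i)) - 1\<bar>
     \<le> (laplace_const / (2 * pi * ((wc / 2) / sqrt (2 * pi * G.K)))) / real i"
proof -
  note d = \<delta>0_le[OF \<delta>]
  let ?t = "tc + \<delta>" and ?u = "complex_of_real (us \<delta>)" and ?n = "real i"
  have n: "?n > 0" using i by simp
  have ureal: "G ?t ?u = of_real (Re (G ?t ?u))"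
    using G.real[OF d(2), of ?u] us(3)[OF \<delta>] G.\<rho> by (simp add: of_real_Re)
  \<comment> \<open>The exponent at the saddle is real, so exp (- n Y) comes out of the integral as
    a positive factor and leaves the phase in normalised form.\<close>
  have Y: "?u + G ?t ?u = of_real (Yf \<delta>)" by (subst ureal) (simp add: Yf_def)
  let ?g = "\<lambda>\<theta>. - deriv (V ?t) (?u + \<i> * of_real \<theta>) * exp (- ?n * (\<i> * of_real \<theta> + G ?t (?u + \<i> * of_real \<theta>) - G ?t ?u))"
  have "exp (- of_nat i * (?u + \<i> * of_real \<theta> + G ?t (?u + \<i> * of_real \<theta>)))
      = of_real (exp (- ?n * Yf \<delta>)) * exp (- ?n * (\<i> * of_real \<theta> + G ?t (?u + \<i> * of_real \<theta>) - G ?t ?u))" for \<theta> :: real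
  proof -
    have "- of_nat i * (?u + \<i> * of_real \<theta> + G ?t (?u + \<i> * of_real \<theta>))
      = complex_of_real (- ?n * Yf \<delta>) + - ?n * (\<i> * of_real \<theta> + G ?t (?u + \<i> * of_real \<theta>) - G ?t ?u)"
      unfolding of_real_mult Y[symmetric] by (simp add: algebra_simps)
    then show ?thesis by (simp only: exp_add exp_of_real)
  qed
  then have "of_real (2 * pi * (?n * x i ?t)) = integral {-pi..pi} (\<lambda>\<theta>. of_real (exp (- ?n * Yf \<delta>)) * ?g \<theta>)"
    unfolding coeff by (simp add: mult_ac)
  also have "\<dots> = of_real (exp (- ?n * Yf \<delta>)) * integral {-pi..pi} ?g"
    by (rule Henstock_Kurzweil_Integration.integral_mult_right)
  finally have "integral {-pi..pi} ?g = of_real (2 * pi * (?n * x i ?t) * exp (?n * Yf \<delta>))"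
    by (simp add: exp_minus field_simps)
  with saddle_integral[OF d(2) us(3)[OF \<delta>] us(2)[OF \<delta>] n]
  have "norm (complex_of_real (2 * pi * (?n * x i ?t) * exp (?n * Yf \<delta>) - ampf \<delta> * sqrt (2 * pi / (?n * lf \<delta>)))) \<le> laplace_const / (?n * sqrt ?n)"
    by (simp add: ampf_def lf_def)
  then have main: "\<bar>2 * pi * (?n * x i ?t) * exp (?n * Yf \<delta>) - ampf \<delta> * sqrt (2 * pi / (?n * lf \<delta>))\<bar> \<le> laplace_const / (?n * sqrt ?n)"
    by (simp only: norm_of_real)
  have C0: "(wc / 2) / sqrt (2 * pi * G.K) > 0" using wc_pos G.K_pos by simp
  have C1: "Cf \<delta> > 0" using C0 Cf_ge[OF \<delta>] by linarith
  have l0: "lf \<delta> > 0" using lf_bounds(1)[OF \<delta>] \<kappa> by simp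
  have w: "ampf \<delta> * sqrt (2 * pi / (?n * lf \<delta>)) = 2 * pi * Cf \<delta> / sqrt ?n"
  proof -
    have "sqrt (2 * pi / (?n * lf \<delta>)) = sqrt ((2 * pi)\<^sup>2 / ((2 * pi * lf \<delta>) * ?n))"
      using l0 n by (intro arg_cong[where f = sqrt]) (simp add: power2_eq_square field_simps)
    also have "\<dots> = 2 * pi / (sqrt (2 * pi * lf \<delta>) * sqrt ?n)"
      by (simp only: real_sqrt_divide real_sqrt_mult[of "2 * pi * lf \<delta>" ?n] real_sqrt_abs) simp
    finally show ?thesis by (simp add: Cf_def)
  qed
  have pw: "?n powr (- 3 / 2) = 1 / (?n * sqrt ?n)"
  proof -
    have *: "?n powr (1 + 1 / 2) = ?n * sqrt ?n"
      using powr_add[of ?n 1 "1 / 2"] powr_half_sqrt[of ?n] n by simp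
    have "?n powr (- 3 / 2) = inverse (?n powr (1 + 1 / 2))" by (simp flip: powr_minus)
    then show ?thesis unfolding * by (simp only: inverse_eq_divide)
  qed
  define A where "A = 2 * pi * Cf \<delta> / sqrt ?n"
  have A: "A > 0" using C1 n by (simp add: A_def)
  have e: "exp (- Yf \<delta> * ?n) = 1 / exp (?n * Yf \<delta>)" by (simp add: exp_minus divide_inverse mult.commute)
  have "x i ?t / (Cf \<delta> * ?n powr (- 3 / 2) * exp (- Yf \<delta> * ?n)) - 1 = (2 * pi * (?n * x i ?t) * exp (?n * Yf \<delta>) - A) / A"
    unfolding pw e A_def using C1 n by (simp add: field_simps)
  then have "\<bar>x i ?t / (Cf \<delta> * ?n powr (- 3 / 2) * exp (- Yf \<delta> * ?n)) - 1\<bar> = \<bar>2 * pi * (?n * x i ?t) * exp (?n * Yf \<delta>) - A\<bar> / A"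
    using A by simp
  also have "\<dots> \<le> (laplace_const / (?n * sqrt ?n)) / A"
    using main A unfolding w A_def by (intro divide_right_mono) auto
  also have "\<dots> = laplace_const / (2 * pi * Cf \<delta>) / ?n"
    using n C1 by (simp add: A_def field_simps)
  also have "\<dots> \<le> (laplace_const / (2 * pi * ((wc / 2) / sqrt (2 * pi * G.K)))) / ?n"
  proof (intro divide_right_mono frac_le mult_left_mono Cf_ge \<delta> order_refl)
    show "0 < 2 * pi * ((wc / 2) / sqrt (2 * pi * G.K))" using C0 by (intro mult_pos_pos) auto
    show "0 \<le> laplace_const" unfolding laplace_const_def using G.K_pos \<kappa> by simp
  qed auto
  finally show ?thesis .
qed

end

section \<open>Linearisation at the critical time\<close>

text \<open>A and Bf stand for the derivatives of position and velocity in the starting point, at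
  (1, 0). Before \<open>tc\<close> they satisfy Bf = - s A, the linearised form of the Riccati
  equation. Since Bf stays bounded while s blows up, A must vanish at \<open>tc\<close>, and Bf < 0
  there makes the zero simple.\<close>

lemma critical_slope:
  fixes p q A Bf s :: "real \<Rightarrow> real"
  assumes tc: "a < tc" "tc < b"
    and p: "\<And>t. t \<in> {a..b} \<Longrightarrow> 0 \<le> p t \<and> p t \<le> 1" and q: "\<And>t. t \<in> {a..b} \<Longrightarrow> 0 \<le> q t \<and> q t \<le> 1"
    and pc: "continuous_on {a..b} p" and pL: "\<And>t. t \<in> {a..b} \<Longrightarrow> \<bar>p t - p tc\<bar> \<le> P * \<bar>t - tc\<bar>" and ptc: "p tc > 0"
    and A: "\<And>t. t \<in> {a..b} \<Longrightarrow> (A has_real_derivative p t * Bf t) (at t within {a..b})"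
    and Bf: "\<And>t. t \<in> {a..b} \<Longrightarrow> (Bf has_real_derivative - q t * A t) (at t within {a..b})"
    and init: "A a = 1" "Bf a = - s a" "s a > 0"
    and s: "\<And>t' t. t' < tc \<Longrightarrow> t \<in> {a..t'} \<Longrightarrow> (s has_real_derivative q t + p t * (s t)\<^sup>2) (at t within {a..t'})"
    and blow: "filterlim s at_top (at_left tc)"
  obtains Q where "A tc = 0" "Bf tc < 0" "\<And>t. t \<in> {a..b} \<Longrightarrow> \<bar>A t + (- p tc * Bf tc) * (t - tc)\<bar> \<le> Q * (t - tc)\<^sup>2"
proof -
  have Ac: "continuous_on {a..b} A" and Bc: "continuous_on {a..b} Bf"
    by (rule DERIV_continuous_on[OF A], assumption) (rule DERIV_continuous_on[OF Bf], assumption)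
  have before: "Bf t = - s t * A t \<and> 0 < A t \<and> 0 < s t" if t: "t \<in> {a..<tc}" for t
  proof -
    have tt: "t \<in> {a..t}" "t < tc" using t by auto
    have sub: "{a..t} \<subseteq> {a..b}" using t tc by auto
    note s' = s[OF tt(2)]
    have sc: "continuous_on {a..t} s" by (rule DERIV_continuous_on[OF s'])
    have psc: "continuous_on {a..t} (\<lambda>x. p x * s x)" by (intro continuous_intros sc continuous_on_subset[OF pc sub])
    have Ad: "(A has_real_derivative p x * Bf x) (at x within {a..t})" if "x \<in> {a..t}" for x
      using DERIV_subset[OF A sub] that sub by blast
    have Bd: "(Bf has_real_derivative - q x * A x) (at x within {a..t})" if "x \<in> {a..t}" for x
      using DERIV_subset[OF Bf sub] that sub by blast
    \<comment> \<open>Bf + s A satisfies a linear homogeneous equation. The factor c, taken as 1 and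
      - 1, extracts an equality from a one-sided inequality.\<close>
    have E: "((\<lambda>x. c * (Bf x + s x * A x)) has_real_derivative (p x * s x) * (c * (Bf x + s x * A x))) (at x within {a..t})"
      if "x \<in> {a..t}" for x c
      by (auto intro!: derivative_eq_intros Ad[OF that] Bd[OF that] s'[OF that] simp: algebra_simps power2_eq_square)
    have B': "Bf x = - s x * A x" if x: "x \<in> {a..t}" for x
    proof -
      have "0 \<le> c * (Bf x + s x * A x)" for c
        using gronwall_lower[OF E[of _ c] psc order_refl x] by (simp add: init)
      from this[of 1] this[of "- 1"] show ?thesis by simp
    qed
    have "A a * exp (integral {a..t} (\<lambda>x. - (p x * s x))) \<le> A t"
      by (rule gronwall_lower[OF Ad _ _ tt(1)]) (auto intro!: continuous_intros psc simp: B')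
    then have Apos: "0 < A t" unfolding init by (smt (verit) exp_gt_zero mult_1)
    have "s a \<le> s t"
    proof (rule nonneg_derivative_imp_le[OF s' _ tt(1)])
      fix x assume "x \<in> {a..t}"
      then show "0 \<le> q x + p x * (s x)\<^sup>2" using p[of x] q[of x] sub by auto
    qed
    then show ?thesis using B'[OF tt(1)] Apos init by auto
  qed
  have tcab: "tc \<in> {a..b}" using tc by simp
  have Al: "(A \<longlongrightarrow> A tc) (at_left tc)" and Bl: "(Bf \<longlongrightarrow> Bf tc) (at_left tc)"
  proof -
    have "tc \<in> interior {a..b}" using tc by simp
    then have "isCont A tc" "isCont Bf tc" using Ac Bc by (auto intro: continuous_on_interior)
    then show "(A \<longlongrightarrow> A tc) (at_left tc)" "(Bf \<longlongrightarrow> Bf tc) (at_left tc)"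
      by (auto simp: isCont_def intro: filterlim_mono[OF _ order_refl at_le])
  qed
  \<comment> \<open>Here the blow-up defining the critical time is used.\<close>
  have "((\<lambda>t. - Bf t / s t) \<longlongrightarrow> 0) (at_left tc)"
    by (rule tendsto_divide_0[OF tendsto_minus[OF Bl]]) (rule filterlim_at_top_imp_at_infinity[OF blow])
  moreover have "\<forall>\<^sub>F t in at_left tc. A t = - Bf t / s t"
    using eventually_at_left_real[OF tc(1)]
  proof (rule eventually_mono)
    fix t assume "t \<in> {a<..<tc}"
    then show "A t = - Bf t / s t" using before[of t] by auto
  qed
  ultimately have "(A \<longlongrightarrow> 0) (at_left tc)" using tendsto_cong by fastforce
  then have Atc: "A tc = 0" using Al tendsto_unique trivial_limit_at_left_real by blast
  have A0: "0 \<le> A t" if "t \<in> {a..tc}" for t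
    using before[of t] that Atc by (cases "t = tc") auto
  \<comment> \<open>A is nonnegative up to \<open>tc\<close>, so - Bf never falls below its positive
    initial value s a.\<close>
  have "- Bf a \<le> - Bf tc"
  proof (rule nonneg_derivative_imp_le[where f' = "\<lambda>t. q t * A t" and a = a and b = tc])
    fix t assume t: "t \<in> {a..tc}"
    have "(Bf has_real_derivative - q t * A t) (at t within {a..tc})"
      by (rule DERIV_subset[OF Bf]) (use t tc in auto)
    then show "((\<lambda>t. - Bf t) has_real_derivative q t * A t) (at t within {a..tc})"
      by (auto intro!: derivative_eq_intros)
    show "0 \<le> q t * A t" using A0[OF t] q[of t] t tc by auto
  qed (use tc in auto)
  then have Btc: "Bf tc < 0" using init by linarith
  obtain K where K: "\<And>t. t \<in> {a..b} \<Longrightarrow> norm (A t) \<le> K" using continuous_on_Icc_bounded[OF Ac] by metis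
  have K0: "0 \<le> K" using K[OF tcab] norm_ge_zero order_trans by blast
  have BL: "\<bar>Bf t - Bf tc\<bar> \<le> K * \<bar>t - tc\<bar>" if t: "t \<in> {a..b}" for t
  proof -
    have "norm (Bf t - Bf tc) \<le> K * \<bar>t - tc\<bar>"
    proof (rule vector_mvt_bound[of a b Bf "\<lambda>t. - q t * A t"])
      fix x assume x: "x \<in> {a..b}"
      show "(Bf has_vector_derivative - q x * A x) (at x within {a..b})"
        using Bf[OF x] by (simp add: has_real_derivative_iff_has_vector_derivative)
      have "q x * \<bar>A x\<bar> \<le> 1 * K" using q[OF x] K[OF x] by (intro mult_mono) auto
      then show "norm (- q x * A x) \<le> K" using q[OF x] by (simp add: abs_mult)
    qed (use t tcab in auto)
    then show ?thesis by simp
  qed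
  have P0: "0 \<le> P"
    using order_trans[OF abs_ge_zero pL[of b]] tc by (simp add: zero_le_mult_iff)
  define Q where "Q = K + \<bar>Bf tc\<bar> * P"
  have Q0: "0 \<le> Q" using K0 P0 by (simp add: Q_def)
  have pB: "\<bar>p t * Bf t - p tc * Bf tc\<bar> \<le> Q * \<bar>t - tc\<bar>" if t: "t \<in> {a..b}" for t
  proof -
    have "\<bar>p t * Bf t - p tc * Bf tc\<bar> = \<bar>p t * (Bf t - Bf tc) + Bf tc * (p t - p tc)\<bar>" by (simp add: algebra_simps)
    also have "\<dots> \<le> p t * \<bar>Bf t - Bf tc\<bar> + \<bar>Bf tc\<bar> * \<bar>p t - p tc\<bar>"
      using p[OF t] by (intro order_trans[OF abs_triangle_ineq]) (simp add: abs_mult)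
    also have "\<dots> \<le> 1 * (K * \<bar>t - tc\<bar>) + \<bar>Bf tc\<bar> * (P * \<bar>t - tc\<bar>)"
      using p[OF t] BL[OF t] pL[OF t] by (intro add_mono mult_mono) auto
    finally show ?thesis by (simp add: Q_def algebra_simps)
  qed
  show thesis
  proof (rule that[OF Atc Btc])
    fix t assume t: "t \<in> {a..b}"
    let ?l = "min t tc" and ?r = "max t tc"
    have sub: "{?l..?r} \<subseteq> {a..b}" using t tc by auto
    have "norm ((A t + (- p tc * Bf tc) * t) - (A tc + (- p tc * Bf tc) * tc)) \<le> (Q * \<bar>t - tc\<bar>) * \<bar>t - tc\<bar>"
    proof (rule vector_mvt_bound[of ?l ?r "\<lambda>t. A t + (- p tc * Bf tc) * t" "\<lambda>x. p x * Bf x - p tc * Bf tc"])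
      fix x assume x: "x \<in> {?l..?r}"
      have "(A has_real_derivative p x * Bf x) (at x within {?l..?r})" using DERIV_subset[OF A sub] x sub by blast
      then have "((\<lambda>t. A t + (- p tc * Bf tc) * t) has_real_derivative p x * Bf x - p tc * Bf tc) (at x within {?l..?r})"
        by (auto intro!: derivative_eq_intros)
      then show "((\<lambda>t. A t + (- p tc * Bf tc) * t) has_vector_derivative p x * Bf x - p tc * Bf tc) (at x within {?l..?r})"
        by (simp add: has_real_derivative_iff_has_vector_derivative)
      have "\<bar>p x * Bf x - p tc * Bf tc\<bar> \<le> Q * \<bar>x - tc\<bar>" using pB x sub by blast
      also have "\<dots> \<le> Q * \<bar>t - tc\<bar>" using x Q0 by (intro mult_left_mono) (auto simp: min_def max_def split: if_splits)
      finally show "norm (p x * Bf x - p tc * Bf tc) \<le> Q * \<bar>t - tc\<bar>" by simp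
    qed auto
    then show "\<bar>A t + (- p tc * Bf tc) * (t - tc)\<bar> \<le> Q * (t - tc)\<^sup>2"
      by (simp add: Atc power2_eq_square algebra_simps)
  qed
qed

text \<open>Writing F as its initial value plus the time integral of g reduces the exchange of the
  time derivative and the derivative in w to differentiation under the integral.\<close>

lemma deriv_has_vector_derivative_time:
  fixes F g :: "real \<Rightarrow> complex \<Rightarrow> complex"
  assumes S: "open S" "convex S" and ghol: "\<And>t. t \<in> {a..b} \<Longrightarrow> g t holomorphic_on S"
    and gcont: "continuous_on ({a..b} \<times> S) (\<lambda>(t, w). g t w)"
    and F: "\<And>t w. t \<in> {a..b} \<Longrightarrow> w \<in> S \<Longrightarrow> ((\<lambda>t. F t w) has_vector_derivative g t w) (at t within {a..b})"
    and Fa: "F a holomorphic_on S" and w: "w \<in> S" and t: "t \<in> {a..b}"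
  shows "((\<lambda>t. deriv (F t) w) has_vector_derivative deriv (g t) w) (at t within {a..b})"
proof -
  have eq: "F t v = F a v + integral {a..t} (\<lambda>s. g s v)" if t: "t \<in> {a..b}" and v: "v \<in> S" for t v
  proof -
    have "((\<lambda>s. g s v) has_integral (F t v - F a v)) {a..t}"
      by (rule fundamental_theorem_of_calculus) (use t v in \<open>auto intro!: has_vector_derivative_within_subset[OF F]\<close>)
    then show ?thesis by (simp add: integral_unique)
  qed
  have d: "deriv (F t) w = deriv (F a) w + integral {a..t} (\<lambda>s. deriv (g s) w)" if t: "t \<in> {a..b}" for t
  proof -
    have sub: "{a..t} \<times> S \<subseteq> {a..b} \<times> S" using t by auto
    have "((\<lambda>v. integral {a..t} (\<lambda>s. g s v)) has_field_derivative integral {a..t} (\<lambda>s. deriv (g s) w)) (at w)"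
      by (rule integral_has_field_derivative_holomorphic[OF S _ continuous_on_subset[OF gcont sub] w]) (use t ghol in auto)
    from DERIV_add[OF holomorphic_derivI[OF Fa S(1) w] this]
    have "((\<lambda>v. F a v + integral {a..t} (\<lambda>s. g s v)) has_field_derivative deriv (F a) w + integral {a..t} (\<lambda>s. deriv (g s) w)) (at w)" .
    then have "(F t has_field_derivative deriv (F a) w + integral {a..t} (\<lambda>s. deriv (g s) w)) (at w)"
      by (rule has_field_derivative_transform_within_open[OF _ S(1) w]) (use eq[OF t] in auto)
    then show ?thesis by (rule DERIV_imp_deriv)
  qed
  have dc: "continuous_on {a..b} (\<lambda>s. deriv (g s) w)"
  proof -
    have "continuous_on {a..b} (\<lambda>s. case (s, w) of (s, w) \<Rightarrow> deriv (g s) w)"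
      by (rule continuous_on_compose2[OF continuous_on_Times_deriv[OF S(1) ghol gcont]]) (use w in \<open>auto intro!: continuous_intros\<close>)
    then show ?thesis by simp
  qed
  have "((\<lambda>t. deriv (F a) w + integral {a..t} (\<lambda>s. deriv (g s) w)) has_vector_derivative 0 + deriv (g t) w) (at t within {a..b})"
    by (intro has_vector_derivative_add has_vector_derivative_const integral_has_vector_derivative dc t)
  then show ?thesis
    by (intro has_vector_derivative_transform[OF t d]) simp_all
qed

text \<open>The parameter interval is shifted by periodicity so that the positive real point of the
  circle lies in its middle.\<close>

lemma contour_integral_circlepath_symmetric:
  fixes f :: "complex \<Rightarrow> complex"
  assumes r: "r > 0" and f: "continuous_on (sphere 0 r) f"
  shows "contour_integral (circlepath 0 r) f = integral {-pi..pi} (\<lambda>\<theta>. f (r * cis \<theta>) * r * \<i> * cis \<theta>)"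
proof -
  define g where "g \<theta> = f (r * cis \<theta>) * r * \<i> * cis \<theta>" for \<theta>
  have c: "continuous_on A g" for A
    unfolding g_def
    by (intro continuous_intros continuous_on_compose2[OF f]) (use r in \<open>auto simp: norm_mult\<close>)
  have per: "g (\<theta> + 2 * pi) = g \<theta>" for \<theta> by (simp add: g_def cis.ctr)
  have int: "g integrable_on {x..y}" for x y by (intro integrable_continuous_interval c)
  have "contour_integral (circlepath 0 r) f = integral {0..2 * pi} g"
    unfolding circlepath_def g_def by (subst contour_integral_part_circlepath_eq) auto
  also have "\<dots> = integral {0..pi} g + integral {pi..2 * pi} g"
    by (rule Henstock_Kurzweil_Integration.integral_combine[symmetric]) (auto intro: int)
  also have "integral {pi..2 * pi} g = integral {- pi..0} g"
    using integral_shift[of "- pi" "2 * pi" 0 g] c by (simp add: o_def per)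
  also have "integral {0..pi} g + integral {- pi..0} g = integral {- pi..pi} g"
    using Henstock_Kurzweil_Integration.integral_combine[of "- pi" 0 pi g] int by (simp add: add.commute)
  finally show ?thesis unfolding g_def[abs_def] .
qed

section \<open>Consequences of nonnegative coefficients on circles\<close>

context bf_process
begin

context
  fixes t \<rho> V :: real
  assumes t: "0 \<le> t" and \<rho>: "1 \<le> \<rho>" and V: "\<And>i. X i t * \<rho> ^ i \<le> V"
begin

lemma Xg_norm_sums: "norm (z :: complex) < \<rho> \<Longrightarrow> (\<lambda>i. X i t * norm z ^ i) sums Re (Xg 0 t (of_real (norm z)))"
  using sums_Re[OF Xg_sums[OF t \<rho> V, of "of_real (norm z)" 0]] by (simp flip: of_real_power)

lemma norm_Xg_le: "norm z < \<rho> \<Longrightarrow> norm (Xg 0 t z) \<le> Re (Xg 0 t (of_real (norm z)))"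
proof -
  assume z: "norm z < \<rho>"
  have "norm (Xg 0 t z) \<le> (\<Sum>i. norm (of_real (real i ^ 0 * X i t) * z ^ i))"
    unfolding Xg_def by (rule summable_norm[OF summable_Xg[OF t \<rho> V z]]) simp
  also have "\<dots> = (\<Sum>i. X i t * norm z ^ i)"
    using X_nonneg[OF t] by (simp add: norm_mult norm_power)
  also have "\<dots> = Re (Xg 0 t (of_real (norm z)))" using Xg_norm_sums[OF z] by (simp add: sums_iff)
  finally show ?thesis .
qed

lemma Xg_mono: "0 \<le> r \<Longrightarrow> r \<le> r' \<Longrightarrow> r' < \<rho> \<Longrightarrow> Re (Xg 0 t (of_real r)) \<le> Re (Xg 0 t (of_real r'))"
proof -
  assume r: "0 \<le> r" "r \<le> r'" "r' < \<rho>"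
  have 1: "(\<lambda>i. X i t * r ^ i) sums Re (Xg 0 t (of_real r))" using Xg_norm_sums[of "complex_of_real r"] r by simp
  have 2: "(\<lambda>i. X i t * r' ^ i) sums Re (Xg 0 t (of_real r'))" using Xg_norm_sums[of "complex_of_real r'"] r by simp
  show ?thesis
    by (rule sums_le[OF _ 1 2]) (use X_nonneg[OF t] r in \<open>auto intro!: mult_left_mono power_mono\<close>)
qed

lemma Xg_real: "0 \<le> r \<Longrightarrow> r < \<rho> \<Longrightarrow> Xg 0 t (of_real r) \<in> \<real>"
proof -
  assume r: "0 \<le> r" "r < \<rho>"
  have "(\<lambda>i. of_real (X i t * r ^ i)) sums complex_of_real (Re (Xg 0 t (of_real r)))"
    using Xg_norm_sums[of "complex_of_real r"] r by (intro sums_of_real) simp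
  moreover have "(\<lambda>i. of_real (X i t * r ^ i)) sums Xg 0 t (of_real r)"
    using Xg_sums[OF t \<rho> V, of "of_real r" 0] r by simp
  ultimately have "complex_of_real (Re (Xg 0 t (of_real r))) = Xg 0 t (of_real r)" by (rule sums_unique2)
  then show ?thesis by (metis Reals_of_real)
qed

text \<open>All terms of the difference are nonnegative, and the term of index 1 alone is kept.
  Isolated vertices never disappear, so it is positive.\<close>

lemma Xg_gap:
  assumes r: "0 \<le> r" "r < \<rho>"
  shows "X 1 t * r * (1 - cos \<theta>) \<le> Re (Xg 0 t (of_real r)) - Re (Xg 0 t (r * cis \<theta>))"
proof -
  have "(\<lambda>i. Re (of_real (real i ^ 0 * X i t) * (r * cis \<theta>) ^ i)) sums Re (Xg 0 t (r * cis \<theta>))"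
    by (rule sums_Re[OF Xg_sums[OF t \<rho> V]]) (use r in \<open>auto simp: norm_mult\<close>)
  moreover have "Re (of_real (real i ^ 0 * X i t) * (r * cis \<theta>) ^ i) = X i t * r ^ i * cos (i * \<theta>)" for i
  proof -
    have "cis \<theta> ^ i = cis (i * \<theta>)" by (rule Complex.DeMoivre)
    then show ?thesis by (simp add: power_mult_distrib flip: of_real_power)
  qed
  ultimately have 1: "(\<lambda>i. X i t * r ^ i * cos (i * \<theta>)) sums Re (Xg 0 t (r * cis \<theta>))" by (simp only:)
  have "(\<lambda>i. X i t * r ^ i) sums Re (Xg 0 t (of_real r))" using Xg_norm_sums[of "complex_of_real r"] r by simp
  from sums_diff[OF this 1]
  have s: "(\<lambda>i. X i t * r ^ i * (1 - cos (i * \<theta>))) sums (Re (Xg 0 t (of_real r)) - Re (Xg 0 t (r * cis \<theta>)))"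
    by (simp add: algebra_simps)
  have "(\<Sum>i\<in>{1}. X i t * r ^ i * (1 - cos (i * \<theta>))) \<le> (\<Sum>i. X i t * r ^ i * (1 - cos (i * \<theta>)))"
    by (rule sum_le_suminf) (use s X_nonneg[OF t] r in \<open>auto simp: sums_iff intro!: mult_nonneg_nonneg\<close>)
  then show ?thesis using s by (simp add: sums_iff)
qed

lemma Xg_holomorphic: "Xg 0 t holomorphic_on ball 0 \<rho>"
  by (rule power_series_holomorphic[where a = "\<lambda>i. of_real (X i t)"])
    (use Xg_sums[OF t \<rho> V, of _ 0] in auto)

lemma Xg_deriv_1:
  assumes "1 < \<rho>"
  shows "deriv (Xg 0 t) 1 = Xg 1 t 1"
proof -
  let ?c = "\<lambda>i. complex_of_real (X i t)"
  have eq: "Xg 0 t = (\<lambda>z. \<Sum>i. ?c i * z ^ i)" by (simp add: Xg_def[abs_def])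
  have "((\<lambda>z. \<Sum>i. ?c i * z ^ i) has_field_derivative (\<Sum>i. diffs ?c i * 1 ^ i)) (at 1)"
  proof (rule termdiffs_strong'[where K = \<rho>])
    show "summable (\<lambda>n. ?c n * z ^ n)" if "norm z < \<rho>" for z
      using sums_summable[OF Xg_sums[OF t \<rho> V that, of 0]] by simp
  qed (use assms in simp)
  then have "deriv (Xg 0 t) 1 = (\<Sum>i. diffs ?c i)" unfolding eq by (simp add: DERIV_imp_deriv)
  also have "\<dots> = Xg 1 t 1"
  proof -
    have s: "(\<lambda>i. of_real (real i ^ 1 * X i t) * 1 ^ i) sums Xg 1 t 1" by (rule Xg_sums[OF t \<rho> V]) (use assms in auto)
    then have "(\<lambda>i. of_real (real (Suc i) ^ 1 * X (Suc i) t) * 1 ^ (Suc i)) sums Xg 1 t 1"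
      by (subst sums_Suc_iff) simp
    then have "(\<lambda>i. diffs ?c i) sums Xg 1 t 1" by (simp add: diffs_def algebra_simps)
    then show ?thesis by (simp add: sums_iff)
  qed
  finally show ?thesis .
qed

end

end

text \<open>Expanding the square and using |z| \<le> m gives 2 m (m - Re z). Applied to a power
  series with nonnegative coefficients, it shows that the squared difference of the initial
  velocities is controlled by its own real part.\<close>

lemma norm_diff_sq_le:
  fixes z :: complex and m :: real
  assumes "norm z \<le> m" "m \<le> 2"
  shows "(norm (of_real m - z))\<^sup>2 \<le> 4 * (m - Re z)"
proof -
  have re: "Re z \<le> m" using complex_Re_le_cmod[of z] assms by linarith
  have m0: "0 \<le> m" using assms(1) norm_ge_zero order_trans by blast
  have "(norm (of_real m - z))\<^sup>2 = m\<^sup>2 - 2 * m * Re z + (norm z)\<^sup>2"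
    unfolding cmod_power2 by (simp add: power2_eq_square algebra_simps)
  also have "\<dots> \<le> m\<^sup>2 - 2 * m * Re z + m\<^sup>2" using assms by (intro add_left_mono power_mono) auto
  also have "\<dots> = 2 * m * (m - Re z)" by (simp add: power2_eq_square algebra_simps)
  also have "\<dots> \<le> 4 * (m - Re z)" using assms re by (intro mult_right_mono) auto
  finally show ?thesis .
qed

context bf_process
begin

lemma p_Lipschitz:
  assumes "0 \<le> a" "t \<in> {a..b}" "t' \<in> {a..b}"
  shows "\<bar>p t - p t'\<bar> \<le> 6 * \<bar>t - t'\<bar>"
proof -
  have "norm (p t - p t') \<le> 6 * \<bar>t - t'\<bar>"
  proof (rule vector_mvt_bound[OF _ _ assms(2,3), where f' = "\<lambda>s. - (2 * X 1 s * rhs 1 s)"])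
    fix s assume s: "s \<in> {a..b}"
    have "(p has_real_derivative - (2 * X 1 s * rhs 1 s)) (at s within {a..b})"
      unfolding p_eq[abs_def] by (auto intro!: derivative_eq_intros X_deriv[OF s assms(1)])
    then show "(p has_vector_derivative - (2 * X 1 s * rhs 1 s)) (at s within {a..b})"
      by (simp add: has_real_derivative_iff_has_vector_derivative)
    have x: "0 \<le> X 1 s" "X 1 s \<le> 1" using X1_pos[of s] X1_le[of s] s assms(1) by auto
    have "0 \<le> (X 1 s)\<^sup>2" "(X 1 s)\<^sup>2 \<le> 1" "0 \<le> (X 1 s) ^ 3" "(X 1 s) ^ 3 \<le> 1"
      using x by (auto intro: power_le_one)
    then have "\<bar>rhs 1 s\<bar> \<le> 3" unfolding rhs_1 using x by linarith
    then have "X 1 s * \<bar>rhs 1 s\<bar> \<le> 1 * 3" using x by (intro mult_mono) auto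
    then show "norm (- (2 * X 1 s * rhs 1 s)) \<le> 6" using x by (simp add: abs_mult)
  qed
  then show ?thesis by simp
qed

end

text \<open>The bound 2 at R caps the generating function on the whole disc:
  \<open>norm_diff_sq_le\<close> needs it, and it gives |1 - Xg| \<le> 3 as the flow construction
  requires. Total mass 1 makes (1, 0) a point of the initial curve.\<close>

locale bf_flow = bf_process +
  fixes a b R \<rho>0 V0 :: real and h U :: "real \<Rightarrow> complex \<Rightarrow> complex"
  assumes ab: "0 < a" "a < b" "b - a \<le> 1 / 1000"
    and R: "1 < R" "R \<le> 2" "R < \<rho>0"
    and V0: "\<And>i. X i a * \<rho>0 ^ i \<le> V0"
    and XR: "Re (Xg 0 a (of_real R)) \<le> 2" and X1: "Xg 0 a 1 = 1"
    and curve: "\<And>w. w \<in> ball 0 R \<Longrightarrow> char_curve p q a b w (\<lambda>t. h t w) (\<lambda>t. U t w)"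
    and init: "\<And>w. w \<in> ball 0 R \<Longrightarrow> U a w = 1 - Xg 0 a w"
    and hhol: "\<And>t. t \<in> {a..b} \<Longrightarrow> h t holomorphic_on ball 0 R"
    and Uhol: "\<And>t. t \<in> {a..b} \<Longrightarrow> U t holomorphic_on ball 0 R"
    and U4: "\<And>t w. t \<in> {a..b} \<Longrightarrow> w \<in> ball 0 R \<Longrightarrow> norm (U t w) \<le> 4"
    and hcont: "continuous_on ({a..b} \<times> ball 0 R) (\<lambda>(t, w). h t w)"
    and Ucont: "continuous_on ({a..b} \<times> ball 0 R) (\<lambda>(t, w). U t w)"
begin

text \<open>With this value Re u < 4 \<rho> means |exp u| < R.\<close>

definition \<rho> :: real where "\<rho> = ln R / 4"
definition G :: "real \<Rightarrow> complex \<Rightarrow> complex" where "G t u = h t (exp u)"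
definition V :: "real \<Rightarrow> complex \<Rightarrow> complex" where "V t u = U t (exp u)"

lemma \<rho>_pos: "\<rho> > 0" using R by (simp add: \<rho>_def)

lemma exp_in_ball: "Re u < 4 * \<rho> \<Longrightarrow> exp u \<in> ball (0::complex) R"
  using R exp_less_cancel_iff[of "Re u" "ln R"] by (simp add: \<rho>_def)

lemma a_nonneg: "0 \<le> a" "a \<le> b" and rho0: "1 \<le> \<rho>0" using ab R by auto

lemma pq01: "t \<in> {a..b} \<Longrightarrow> 0 \<le> p t \<and> p t \<le> 1" "t \<in> {a..b} \<Longrightarrow> 0 \<le> q t \<and> q t \<le> 1"
  using pq_bounds(1,2)[of t] ab by auto

lemma exp_hol: "f holomorphic_on ball 0 R \<Longrightarrow> (\<lambda>u. f (exp u)) holomorphic_on {u. Re u < 4 * \<rho>}"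
proof -
  assume f: "f holomorphic_on ball 0 R"
  have "exp ` {u. Re u < 4 * \<rho>} \<subseteq> ball (0::complex) R" using exp_in_ball by auto
  from holomorphic_on_compose_gen[OF holomorphic_on_exp f this] show ?thesis by (simp add: o_def)
qed

lemma h_props:
  assumes w: "w \<in> ball 0 R" and t: "t \<in> {a..b}"
  shows "norm (h t w) \<le> 1" "h a w = 0"
    "((\<lambda>t. h t w) has_vector_derivative p t * U t w) (at t within {a..b})"
    "((\<lambda>t. U t w) has_vector_derivative q t * (w * exp (h t w) - (w * exp (h t w))\<^sup>2)) (at t within {a..b})"
  using curve[OF w] t by (auto simp: char_curve_def)

lemma norm_le_2: "w \<in> ball (0::complex) R \<Longrightarrow> norm w \<le> 2" using R by auto

lemma Lipschitz_time:
  assumes w: "w \<in> ball 0 R" and t: "t \<in> {a..b}" "t' \<in> {a..b}"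
  shows "norm (h t w - h t' w) \<le> 4 * \<bar>t - t'\<bar>" "norm (U t w - U t' w) \<le> 42 * \<bar>t - t'\<bar>"
proof -
  show "norm (h t w - h t' w) \<le> 4 * \<bar>t - t'\<bar>"
  proof (rule vector_mvt_bound[OF h_props(3)[OF w] _ t])
    fix s assume s: "s \<in> {a..b}"
    have "norm (p s * U s w) = p s * norm (U s w)" using pq01(1)[OF s] by (simp add: norm_mult)
    also have "\<dots> \<le> 1 * 4" using pq01(1)[OF s] U4[OF s w] by (intro mult_mono) auto
    finally show "norm (p s * U s w) \<le> 4" by simp
  qed
  show "norm (U t w - U t' w) \<le> 42 * \<bar>t - t'\<bar>"
  proof (rule vector_mvt_bound[OF h_props(4)[OF w] _ t])
    fix s assume s: "s \<in> {a..b}"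
    have "norm (q s * (w * exp (h s w) - (w * exp (h s w))\<^sup>2)) = q s * norm (w * exp (h s w) - (w * exp (h s w))\<^sup>2)"
      using pq01(2)[OF s] by (simp add: norm_mult)
    also have "\<dots> \<le> 1 * 42"
      using pq01(2)[OF s] by (intro mult_mono char_force_bound norm_le_2 w h_props(1) s) auto
    finally show "norm (q s * (w * exp (h s w) - (w * exp (h s w))\<^sup>2)) \<le> 42" by simp
  qed
qed

lemma init_real:
  assumes w: "w \<in> ball (0::complex) R" "w \<in> \<real>" "0 \<le> Re w"
  shows "U a w \<in> \<real>"
proof -
  obtain r where r: "w = complex_of_real r" using w(2) by (auto elim: Reals_cases)
  then have "Xg 0 a (of_real r) \<in> \<real>"
    using w R by (intro Xg_real[OF a_nonneg(1) rho0 V0]) auto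
  then show ?thesis using init[OF w(1)] by (simp add: r)
qed

lemma strip:
  assumes B: "42 \<le> B" and sub: "T \<subseteq> {a..b}"
  shows "strip_family G T \<rho> B" "strip_family V T \<rho> B"
proof -
  have re: "exp u \<in> \<real>" "0 \<le> Re (exp u)" if "u \<in> \<real>" for u :: complex
    using that by (auto elim!: Reals_cases simp: exp_of_real)
  have l: "c * \<bar>d\<bar> \<le> B * \<bar>d\<bar>" if "c \<le> 42" for c d :: real using that B by (intro mult_right_mono) auto
  show "strip_family G T \<rho> B"
  proof
    fix t t' u assume t: "t \<in> T" and u: "Re u < 4 * \<rho>"
    have ts: "t \<in> {a..b}" using t sub by auto
    note w = exp_in_ball[OF u]
    show "norm (G t u) \<le> B" using h_props(1)[OF w ts] B by (simp add: G_def)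
    show "norm (G t u - G t' u) \<le> B * \<bar>t - t'\<bar>" if "t' \<in> T"
      using Lipschitz_time(1)[OF w ts, of t'] that sub l[of 4 "t - t'"] by (auto simp: G_def)
    show "G t u \<in> \<real>" if "u \<in> \<real>"
      unfolding G_def
      by (rule char_curve_real(2)[OF a_nonneg(2) ab(3) pq01 curve[OF w] norm_le_2[OF w] re(1)[OF that] init_real[OF w re[OF that]] ts])
  next
    fix t assume t: "t \<in> T"
    then show "G t holomorphic_on {u. Re u < 4 * \<rho>}"
      unfolding G_def[abs_def] using sub by (intro exp_hol hhol) auto
  qed (use B \<rho>_pos in auto)
  show "strip_family V T \<rho> B"
  proof
    fix t t' u assume t: "t \<in> T" and u: "Re u < 4 * \<rho>"
    have ts: "t \<in> {a..b}" using t sub by auto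
    note w = exp_in_ball[OF u]
    show "norm (V t u) \<le> B" using U4[OF ts w] B by (simp add: V_def)
    show "norm (V t u - V t' u) \<le> B * \<bar>t - t'\<bar>" if "t' \<in> T"
      using Lipschitz_time(2)[OF w ts, of t'] that sub l[of 42 "t - t'"] by (auto simp: V_def)
    show "V t u \<in> \<real>" if "u \<in> \<real>"
      unfolding V_def
      by (rule char_curve_real(1)[OF a_nonneg(2) ab(3) pq01 curve[OF w] norm_le_2[OF w] re(1)[OF that] init_real[OF w re[OF that]] ts])
  next
    fix t assume t: "t \<in> T"
    then show "V t holomorphic_on {u. Re u < 4 * \<rho>}"
      unfolding V_def[abs_def] using sub by (intro exp_hol Uhol) auto
  qed (use B \<rho>_pos in auto)
qed

lemma one_in_ball: "(1::complex) \<in> ball 0 R" using R by simp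

lemma at_one: "t \<in> {a..b} \<Longrightarrow> U t 1 = 0" "t \<in> {a..b} \<Longrightarrow> h t 1 = 0"
  using char_curve_at_1[OF a_nonneg(2) ab(3) pq01 curve[OF one_in_ball]] init[OF one_in_ball] X1 by auto

lemma deriv_exp_comp:
  assumes f: "f holomorphic_on ball 0 R" and u: "Re u < 4 * \<rho>"
  shows "deriv (\<lambda>u. f (exp u)) u = deriv f (exp u) * exp u"
proof -
  have "(f has_field_derivative deriv f (exp u)) (at (exp u))"
    by (rule holomorphic_derivI[OF f open_ball exp_in_ball[OF u]])
  from DERIV_chain2[OF this DERIV_exp] show ?thesis by (rule DERIV_imp_deriv)
qed

lemma deriv_G: "t \<in> {a..b} \<Longrightarrow> Re u < 4 * \<rho> \<Longrightarrow> deriv (G t) u = deriv (h t) (exp u) * exp u"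
  unfolding G_def[abs_def] by (intro deriv_exp_comp hhol)

lemma deriv_V: "t \<in> {a..b} \<Longrightarrow> Re u < 4 * \<rho> \<Longrightarrow> deriv (V t) u = deriv (U t) (exp u) * exp u"
  unfolding V_def[abs_def] by (intro deriv_exp_comp Uhol)

text \<open>At w = 1 and h = 0 the position w exp h has derivative 1 + h', and z - z^2 has slope - 1
  at z = 1. Hence the shift by 1 and the sign of the second equation.\<close>

lemma linearised_flow:
  assumes t: "t \<in> {a..b}"
  shows "((\<lambda>t. Re (deriv (h t) 1) + 1) has_real_derivative p t * Re (deriv (U t) 1)) (at t within {a..b})"
    and "((\<lambda>t. Re (deriv (U t) 1)) has_real_derivative - q t * (Re (deriv (h t) 1) + 1)) (at t within {a..b})"
proof -
  have pc: "continuous_on ({a..b} \<times> ball (0::complex) R) (\<lambda>x. p (fst x))"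
    by (rule continuous_on_compose2[OF pq_cont(1)[OF a_nonneg(1)]]) (auto intro!: continuous_intros)
  have qc: "continuous_on ({a..b} \<times> ball (0::complex) R) (\<lambda>x. q (fst x))"
    by (rule continuous_on_compose2[OF pq_cont(2)[OF a_nonneg(1)]]) (auto intro!: continuous_intros)
  let ?f = "\<lambda>t w. complex_of_real (q t) * (w * exp (h t w) - (w * exp (h t w))\<^sup>2)"
  have "((\<lambda>t. deriv (h t) 1) has_vector_derivative deriv (\<lambda>w. of_real (p t) * U t w) 1) (at t within {a..b})"
  proof (rule deriv_has_vector_derivative_time[where g = "\<lambda>t w. of_real (p t) * U t w" and F = h and S = "ball 0 R"])
    show "continuous_on ({a..b} \<times> ball 0 R) (\<lambda>(t, w). of_real (p t) * U t w)"
      using Ucont pc unfolding case_prod_unfold by (intro continuous_intros)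
    show "(\<lambda>w. of_real (p t) * U t w) holomorphic_on ball 0 R" if "t \<in> {a..b}" for t
      using Uhol[OF that] by (intro holomorphic_intros)
    show "((\<lambda>t. h t w) has_vector_derivative of_real (p t) * U t w) (at t within {a..b})" if "t \<in> {a..b}" "w \<in> ball 0 R" for t w
      by (rule h_props(3)[OF that(2,1)])
  qed (use t ab hhol[of a] one_in_ball in auto)
  moreover have "deriv (\<lambda>w. of_real (p t) * U t w) 1 = of_real (p t) * deriv (U t) 1"
    by (rule DERIV_imp_deriv[OF DERIV_cmult[OF holomorphic_derivI[OF Uhol[OF t] open_ball one_in_ball]]])
  ultimately have "((\<lambda>t. deriv (h t) 1) has_vector_derivative of_real (p t) * deriv (U t) 1) (at t within {a..b})" by simp
  from DERIV_add[OF has_field_derivative_Re[OF this] DERIV_const, of 1]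
  show "((\<lambda>t. Re (deriv (h t) 1) + 1) has_real_derivative p t * Re (deriv (U t) 1)) (at t within {a..b})"
    by simp
  have "((\<lambda>t. deriv (U t) 1) has_vector_derivative deriv (?f t) 1) (at t within {a..b})"
  proof (rule deriv_has_vector_derivative_time[where g = ?f and F = U and S = "ball 0 R"])
    show "continuous_on ({a..b} \<times> ball 0 R) (\<lambda>(t, w). ?f t w)"
      using hcont qc unfolding case_prod_unfold by (intro continuous_intros)
    show "?f t holomorphic_on ball 0 R" if "t \<in> {a..b}" for t
      using hhol[OF that] by (intro holomorphic_intros)
    show "((\<lambda>t. U t w) has_vector_derivative ?f t w) (at t within {a..b})" if "t \<in> {a..b}" "w \<in> ball 0 R" for t w
      by (rule h_props(4)[OF that(2,1)])
  qed (use t ab Uhol[of a] one_in_ball in auto)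
  moreover have "deriv (?f t) 1 = of_real (q t) * - (deriv (h t) 1 + 1)"
  proof (rule DERIV_imp_deriv)
    have "(h t has_field_derivative deriv (h t) 1) (at 1)" by (rule holomorphic_derivI[OF hhol[OF t] open_ball one_in_ball])
    then show "(?f t has_field_derivative of_real (q t) * - (deriv (h t) 1 + 1)) (at 1)"
      using at_one(2)[OF t] by (auto intro!: derivative_eq_intros simp: algebra_simps)
  qed
  ultimately have "((\<lambda>t. deriv (U t) 1) has_vector_derivative of_real (q t) * - (deriv (h t) 1 + 1)) (at t within {a..b})" by simp
  from has_field_derivative_Re[OF this]
  show "((\<lambda>t. Re (deriv (U t) 1)) has_real_derivative - q t * (Re (deriv (h t) 1) + 1)) (at t within {a..b})"
    by (simp add: algebra_simps)
qed

lemma linearised_init: "Re (deriv (h a) 1) + 1 = 1" "deriv (U a) 1 = - Xg 1 a 1"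
proof -
  have "((\<lambda>_. 0) has_field_derivative 0) (at (1::complex))" by simp
  then have "(h a has_field_derivative 0) (at 1)"
    by (rule has_field_derivative_transform_within_open[OF _ open_ball one_in_ball]) (use h_props(2)[of _ a] ab in auto)
  then show "Re (deriv (h a) 1) + 1 = 1" by (simp add: DERIV_imp_deriv)
  have "(Xg 0 a has_field_derivative deriv (Xg 0 a) 1) (at 1)"
    by (rule holomorphic_derivI[OF Xg_holomorphic[OF a_nonneg(1) rho0 V0] open_ball]) (use R in auto)
  then have "((\<lambda>w. 1 - Xg 0 a w) has_field_derivative - Xg 1 a 1) (at 1)"
    using Xg_deriv_1[OF a_nonneg(1) rho0 V0] R by (auto intro!: derivative_eq_intros)
  then have "(U a has_field_derivative - Xg 1 a 1) (at 1)"
    by (rule has_field_derivative_transform_within_open[OF _ open_ball one_in_ball]) (simp add: init)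
  then show "deriv (U a) 1 = - Xg 1 a 1" by (rule DERIV_imp_deriv)
qed

lemma exp_polar: "exp (complex_of_real u + \<i> * complex_of_real \<theta>) = of_real (exp u) * cis \<theta>"
  by (simp add: exp_add exp_of_real cis_conv_exp)

lemma exp_u_bounds:
  assumes u: "\<bar>u\<bar> \<le> \<rho>"
  shows "1 / 2 \<le> exp u" "exp u < R"
proof -
  have l: "0 < ln R" using R by simp
  have "- ln R \<le> u" "u < ln R" using u l by (auto simp: \<rho>_def abs_le_iff)
  then have "exp (- ln R) \<le> exp u" "exp u < exp (ln R)" by simp_all
  moreover have "exp (- ln R) = 1 / R" using R by (simp add: exp_minus divide_inverse)
  moreover have "1 / 2 \<le> 1 / R" using R by (intro divide_left_mono) auto
  moreover have "exp (ln R) = R" using R by simp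
  ultimately show "1 / 2 \<le> exp u" "exp u < R" by linarith+
qed

text \<open>The gap of the velocities at time a comes from positivity of the coefficients; the flow
  turns it into a gap of the displacements proportional to the elapsed time t - a.\<close>

lemma circle_gap:
  assumes m0: "0 < m0" "m0 \<le> X 1 a" and p0: "0 \<le> p0" "\<And>t. t \<in> {a..b} \<Longrightarrow> p0 \<le> p t"
    and L: "(b - a) * (400000 * (36 / m0 + 1)) \<le> 1"
    and t: "t \<in> {a..b}" and u: "\<bar>u\<bar> \<le> \<rho>" and \<theta>: "\<bar>\<theta>\<bar> \<le> pi"
  shows "p0 * m0 / 72 * (t - a) * \<theta>\<^sup>2 \<le> Re (G t (of_real u + \<i> * of_real \<theta>)) - Re (G t (of_real u))"
proof -
  define r where "r = exp u"
  note r = exp_u_bounds[OF u, folded r_def]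
  let ?w = "complex_of_real r * cis \<theta>"
  have w: "?w \<in> ball 0 R" "complex_of_real r \<in> ball 0 R" using r by (auto simp: norm_mult)
  have rr: "0 < r" "r \<le> 2" "0 \<le> r" "r < \<rho>0" "r \<le> R" using r R by auto
  note Xf = a_nonneg(1) rho0 V0
  define m where "m = Re (Xg 0 a (of_real r))"
  have mr: "Xg 0 a (of_real r) = of_real m" using Xg_real[OF Xf rr(3,4)] by (simp add: m_def of_real_Re)
  have m2: "m \<le> 2" using Xg_mono[OF Xf rr(3,5) R(3)] XR by (simp add: m_def)
  have mz: "norm (Xg 0 a ?w) \<le> m"
    using norm_Xg_le[OF Xf, of ?w] rr by (simp add: norm_mult m_def)
  have d: "U a ?w - U a (of_real r) = of_real m - Xg 0 a ?w" using init[OF w(1)] init[OF w(2)] mr by simp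
  have g1: "(norm (U a ?w - U a (of_real r)))\<^sup>2 \<le> 4 * Re (U a ?w - U a (of_real r))"
    using norm_diff_sq_le[OF mz m2] unfolding d by simp
  \<comment> \<open>The factor 1/2 is the lower bound of the radius and 1/18 the bound for 1 - cos.
    Their product 1/36 explains M = 36 / m0, and half of it the constant 1/72.\<close>
  have "m0 * (1 / 2) * (\<theta>\<^sup>2 / 18) \<le> X 1 a * r * (1 - cos \<theta>)"
    using m0 r one_minus_cos_ge[OF \<theta>] by (intro mult_mono) auto
  also have "\<dots> \<le> Re (Xg 0 a (of_real r)) - Re (Xg 0 a ?w)" by (rule Xg_gap[OF Xf rr(3,4)])
  finally have g: "m0 * \<theta>\<^sup>2 / 36 \<le> Re (U a ?w - U a (of_real r))" unfolding d by (simp add: m_def)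
  have g2: "\<theta>\<^sup>2 \<le> 36 / m0 * Re (U a ?w - U a (of_real r))"
    using mult_left_mono[OF g, of "36 / m0"] m0 by simp
  have Ur: "U a (of_real r) \<in> \<real>" by (rule init_real[OF w(2)]) (use rr in auto)
  have pp: "p0 \<le> p t \<and> p t \<le> 1" if "t \<in> {a..b}" for t using p0(2)[OF that] pq01(1)[OF that] by auto
  have "p0 / 2 * Re (U a ?w - U a (of_real r)) * (t - a) \<le> Re (h t ?w) - Re (h t (of_real r))"
    by (rule char_curve_circle_gap[OF a_nonneg(2) L _ pp p0(1) pq01(2) curve[OF w(1)] curve[OF w(2)] rr(1,2) Ur g1 g2 \<theta> t])
      (use m0 in auto)
  moreover have "p0 / 2 * (m0 * \<theta>\<^sup>2 / 36) * (t - a) \<le> p0 / 2 * Re (U a ?w - U a (of_real r)) * (t - a)"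
    using g p0(1) t by (intro mult_right_mono mult_left_mono) auto
  ultimately have "p0 / 2 * (m0 * \<theta>\<^sup>2 / 36) * (t - a) \<le> Re (h t ?w) - Re (h t (of_real r))" by linarith
  then show ?thesis by (simp add: G_def exp_polar exp_of_real r_def mult_ac)
qed

text \<open>Lagrange inversion on the circle of radius exp u, parametrised by w = exp (u + i
  \<theta>). The differential i w d\<theta> supplies the factor w that turns the derivative of U at
  w into that of V.\<close>

lemma coefficient_integral:
  assumes t: "t \<in> {a..b}" and u: "\<bar>u\<bar> \<le> \<rho>" and i: "i \<ge> 1"
  shows "of_real (2 * pi * (real i * x i t)) =
      integral {-pi..pi} (\<lambda>\<theta>. - deriv (V t) (of_real u + \<i> * of_real \<theta>)
         * exp (- of_nat i * (of_real u + \<i> * of_real \<theta> + G t (of_real u + \<i> * of_real \<theta>))))"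
proof -
  define r where "r = exp u"
  note r = exp_u_bounds[OF u, folded r_def]
  have r0: "0 < r" by (simp add: r_def)
  have t0: "0 \<le> t" using t ab by simp
  define f where "f w = deriv (\<lambda>w. 1 - U t w) w * exp (- of_nat i * h t w) / w ^ i" for w
  have Ghol: "(\<lambda>w. 1 - U t w) holomorphic_on ball 0 R" using Uhol[OF t] by (intro holomorphic_intros)
  have V1: "X j t * 1 ^ j \<le> 1" for j using X_le_1[OF t0, of j] by simp
  have sums: "(\<lambda>k. of_real (X k t) * v ^ k) sums Xg 0 t v" if "norm v < 1" for v :: complex
    using Xg_sums[OF t0 order_refl V1 that, of 0] by simp
  have small: "norm (w * exp (h t w)) < 1" if "norm w < 1 / 12" for w
  proof -
    have "norm (exp (h t w)) \<le> 3" by (rule norm_exp_le_3[OF h_props(1)[OF _ t]]) (use that R in auto)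
    then have "norm w * norm (exp (h t w)) \<le> 1 / 12 * 3" using that by (intro mult_mono) auto
    then show ?thesis by (simp add: norm_mult)
  qed
  have "contour_integral (circlepath 0 r) f = 2 * pi * \<i> * (of_nat i * of_real (X i t))"
    unfolding f_def
  proof (rule lagrange_inversion_contour[where R = R and ?r1.0 = "1 / 12" and \<xi> = "\<lambda>k. of_real (X k t)"])
    fix w :: complex assume w: "norm w < 1 / 12"
    have wb: "w \<in> ball 0 R" using w R by auto
    have "Xg 0 t (w * exp (h t w)) = 1 - U t w"
      by (rule Xg_transport[OF a_nonneg(1) curve[OF wb] U4[OF _ wb] _ init[OF wb] t]) (use w in auto)
    then show "1 - U t w = (\<Sum>k. of_real (X k t) * (w * exp (h t w)) ^ k)"
      using sums[OF small[OF w]] by (simp add: sums_iff)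
  qed (use hhol[OF t] Ghol R r0 r i small sums in \<open>auto intro: sums_summable\<close>)
  moreover have "contour_integral (circlepath 0 r) f = integral {-pi..pi} (\<lambda>\<theta>. f (r * cis \<theta>) * r * \<i> * cis \<theta>)"
  proof (rule contour_integral_circlepath_symmetric[OF r0])
    have hol: "f holomorphic_on ball 0 R - {0}"
      unfolding f_def[abs_def]
      by (intro holomorphic_intros holomorphic_deriv holomorphic_on_subset[OF Ghol] holomorphic_on_subset[OF hhol[OF t]] open_Diff) auto
    show "continuous_on (sphere 0 r) f"
      by (rule continuous_on_subset[OF holomorphic_on_imp_continuous_on[OF hol]]) (use r r0 in auto)
  qed
  moreover have "f (r * cis \<theta>) * r * \<i> * cis \<theta> = \<i> * (- deriv (V t) (of_real u + \<i> * of_real \<theta>)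
         * exp (- of_nat i * (of_real u + \<i> * of_real \<theta> + G t (of_real u + \<i> * of_real \<theta>))))" for \<theta> :: real
  proof -
    let ?v = "complex_of_real u + \<i> * complex_of_real \<theta>"
    define w where "w = exp ?v"
    have wp: "r * cis \<theta> = w" by (simp add: w_def exp_polar r_def)
    have re: "Re ?v < 4 * \<rho>" using u \<rho>_pos by simp
    have wb: "w \<in> ball 0 R" unfolding w_def by (rule exp_in_ball[OF re])
    have "((\<lambda>w. 1 - U t w) has_field_derivative - deriv (U t) w) (at w)"
      using holomorphic_derivI[OF Uhol[OF t] open_ball wb] by (auto intro!: derivative_eq_intros)
    then have dU: "deriv (\<lambda>w. 1 - U t w) w = - deriv (U t) w" by (rule DERIV_imp_deriv)
    have dV: "deriv (V t) ?v = deriv (U t) w * w" unfolding w_def by (rule deriv_V[OF t re])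
    have "exp (- of_nat i * (?v + G t ?v)) = exp (- of_nat i * G t ?v) / exp (of_nat i * ?v)"
      by (simp add: exp_minus exp_add exp_diff field_simps flip: exp_add)
    also have "exp (of_nat i * ?v) = w ^ i" unfolding w_def by (rule exp_of_nat_mult)
    finally have e: "exp (- of_nat i * (?v + G t ?v)) = exp (- of_nat i * h t w) / w ^ i"
      by (simp add: G_def w_def)
    have "f (r * cis \<theta>) * r * \<i> * cis \<theta> = \<i> * (f w * w)" unfolding wp[symmetric] by (simp add: mult_ac)
    then show ?thesis unfolding f_def dU dV e by (simp add: mult_ac)
  qed
  ultimately have "2 * pi * \<i> * (of_nat i * of_real (X i t)) = integral {-pi..pi} (\<lambda>\<theta>. \<i> * (- deriv (V t) (of_real u + \<i> * of_real \<theta>)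
         * exp (- of_nat i * (of_real u + \<i> * of_real \<theta> + G t (of_real u + \<i> * of_real \<theta>)))))"
    by simp
  also have "\<dots> = \<i> * integral {-pi..pi} (\<lambda>\<theta>. - deriv (V t) (of_real u + \<i> * of_real \<theta>)
         * exp (- of_nat i * (of_real u + \<i> * of_real \<theta> + G t (of_real u + \<i> * of_real \<theta>))))"
    by (rule Henstock_Kurzweil_Integration.integral_mult_right)
  finally have "\<i> * of_real (2 * pi * (real i * X i t)) = \<i> * integral {-pi..pi} (\<lambda>\<theta>. - deriv (V t) (of_real u + \<i> * of_real \<theta>)
         * exp (- of_nat i * (of_real u + \<i> * of_real \<theta> + G t (of_real u + \<i> * of_real \<theta>))))"
    by (simp add: mult_ac)
  then have *: "of_real (2 * pi * (real i * X i t)) = integral {-pi..pi} (\<lambda>\<theta>. - deriv (V t) (of_real u + \<i> * of_real \<theta>)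
         * exp (- of_nat i * (of_real u + \<i> * of_real \<theta> + G t (of_real u + \<i> * of_real \<theta>))))"
    by (simp only: mult_left_cancel[OF complex_i_not_zero])
  have "X i t = x i t" using i by (simp add: X_def)
  then show ?thesis by (rule subst) (rule *)
qed

end

section \<open>The asymptotics\<close>

lemma (in bf_process) saddle_family_exists:
  assumes crit: "bf_critical_time (x 1) tc"
  obtains G V :: "real \<Rightarrow> complex \<Rightarrow> complex" and t1 t2 \<rho> B \<kappa> \<alpha> :: real where
    "saddle_family G V t1 t2 \<rho> B tc \<kappa> \<alpha>"
    "\<And>t u i. t \<in> {t1..t2} \<Longrightarrow> \<bar>u\<bar> \<le> \<rho> \<Longrightarrow> i \<ge> 1 \<Longrightarrow> of_real (2 * pi * (real i * x i t)) =
      integral {-pi..pi} (\<lambda>\<theta>. - deriv (V t) (of_real u + \<i> * of_real \<theta>)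
         * exp (- of_nat i * (of_real u + \<i> * of_real \<theta> + G t (of_real u + \<i> * of_real \<theta>))))"
proof -
  obtain s where tc: "0 < tc" and s0: "s 0 = 1"
    and sd: "\<And>t. t \<in> {0..<tc} \<Longrightarrow> (s has_real_derivative q t + p t * (s t)\<^sup>2) (at t within {0..<tc})"
    and blow: "filterlim s at_top (at_left tc)"
    using crit unfolding bf_critical_time_def p_def q_def by auto
  have X1c: "continuous_on {0..tc + 1} (X 1)" by (rule X_cont) simp
  \<comment> \<open>The lower bounds for X 1 and p are taken on fixed intervals, because the length
    of the time interval is chosen in terms of the first one.\<close>
  obtain m where m: "m \<in> {0..tc + 1}" "\<And>t. t \<in> {0..tc + 1} \<Longrightarrow> X 1 m \<le> X 1 t"
    using continuous_attains_inf[OF compact_Icc _ X1c] tc by auto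
  define m0 where "m0 = X 1 m"
  have m0: "0 < m0" unfolding m0_def using X1_pos m by auto
  have pc': "continuous_on {tc / 2..tc + 1} p" by (rule pq_cont) (use tc in simp)
  \<comment> \<open>The interval stays away from 0, where \<open>p\<close> vanishes.\<close>
  obtain n where n: "n \<in> {tc / 2..tc + 1}" "\<And>t. t \<in> {tc / 2..tc + 1} \<Longrightarrow> p n \<le> p t"
    using continuous_attains_inf[OF compact_Icc _ pc'] tc by auto
  define p0 where "p0 = p n"
  have p0: "0 < p0" unfolding p0_def by (rule pq_bounds(3)) (use n tc in auto)
  \<comment> \<open>The three entries serve the flow construction, the start a \<ge> tc / 2, and the
    circle estimate with M = 36 / m0.\<close>
  define L where "L = Min {1 / 1000, tc, 1 / (400000 * (36 / m0 + 1))}"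
  have "0 < 400000 * (36 / m0 + 1)" using m0 by (intro mult_pos_pos add_pos_pos) auto
  then have L: "0 < L" "L \<le> 1 / 1000" "L \<le> tc" "L * (400000 * (36 / m0 + 1)) \<le> 1"
  proof -
    assume *: "0 < 400000 * (36 / m0 + 1)"
    show "0 < L" "L \<le> 1 / 1000" "L \<le> tc" using * tc by (auto simp: L_def)
    have "L \<le> 1 / (400000 * (36 / m0 + 1))" by (simp add: L_def)
    then show "L * (400000 * (36 / m0 + 1)) \<le> 1" using * by (simp only: pos_le_divide_eq)
  qed
  define a b where "a = tc - L / 2" and "b = tc + L / 2"
  have ab: "0 < a" "a < b" "b - a \<le> 1 / 1000" "tc / 2 \<le> a" "b \<le> tc + 1" "a < tc" "tc < b" "b - a = L"
    using L tc by (auto simp: a_def b_def)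
  have a0: "0 \<le> a" "a \<le> b" using ab by auto
  have s_on: "(s has_real_derivative q t + p t * (s t)\<^sup>2) (at t within {c..t'})"
    if "0 \<le> c" "t' < tc" "t \<in> {c..t'}" for c t t'
    by (rule DERIV_subset[OF sd]) (use that in auto)
  have sa: "s a > 0"
  proof -
    have "s 0 \<le> s a"
    proof (rule nonneg_derivative_imp_le[OF s_on[OF order_refl ab(6)]])
      show "0 \<le> q t + p t * (s t)\<^sup>2" if "t \<in> {0..a}" for t using pq_bounds(1,2)[of t] that by auto
    qed (use a0 in auto)
    then show ?thesis using s0 by simp
  qed
  have aa: "a \<in> {0..a}" using a0 by simp
  note mass = Xg_at_1[OF a0(1) s_on[OF order_refl ab(6)] s0 aa]
  obtain \<rho>0 V0 where \<rho>0: "\<rho>0 > 1" and V0': "\<And>t i. t \<in> {0..a} \<Longrightarrow> X i t * \<rho>0 ^ i \<le> V0"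
    using exponential_moment[OF a0(1) s_on[OF order_refl ab(6)] s0] by metis
  have V0: "X i a * \<rho>0 ^ i \<le> V0" for i by (rule V0'[OF aa])
  have \<rho>1: "1 \<le> \<rho>0" using \<rho>0 by simp
  note Xf = a0(1) \<rho>1 V0
  obtain R where R: "1 < R" "R \<le> 2" "R < \<rho>0" "Re (Xg 0 a (of_real R)) \<le> 2"
  \<comment> \<open>Continuity of the generating function at 1, where its value is 1, allows a
    radius slightly larger than 1 with value at most 2.\<close>
  proof -
    have "continuous_on (ball 0 \<rho>0) (Xg 0 a)" by (rule holomorphic_on_imp_continuous_on[OF Xg_holomorphic[OF Xf]])
    then have "isCont (Xg 0 a) 1" using \<rho>0 by (simp add: continuous_on_eq_continuous_at)
    then obtain d where d: "d > 0" "\<And>z. dist z 1 < d \<Longrightarrow> dist (Xg 0 a z) (Xg 0 a 1) < 1"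
      unfolding continuous_at_eps_delta by (metis zero_less_one)
    define e where "e = Min {d / 2, 1, (\<rho>0 - 1) / 2}"
    have e0: "0 < e" using d(1) \<rho>0 by (simp add: e_def)
    have e: "e \<le> d / 2" "e \<le> 1" "e \<le> (\<rho>0 - 1) / 2"
      unfolding e_def by (rule Min_le; simp)+
    define R where "R = 1 + e"
    have R: "1 < R" "R \<le> 2" "R \<le> 1 + d / 2" "R \<le> 1 + (\<rho>0 - 1) / 2" using e0 e by (auto simp: R_def)
    have "complex_of_real R - 1 = of_real (R - 1)" by simp
    then have "dist (complex_of_real R) 1 = R - 1" using R unfolding dist_norm by (simp only: norm_of_real)
    then have "dist (Xg 0 a (of_real R)) 1 < 1" using d(2)[of "of_real R"] R d(1) mass(1) by simp
    then have "Re (Xg 0 a (of_real R) - 1) < 1"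
      using complex_Re_le_cmod[of "Xg 0 a (of_real R) - 1"] by (simp add: dist_norm)
    then have "Re (Xg 0 a (of_real R)) \<le> 2" by simp
    moreover have "R < \<rho>0" using R(4) \<rho>0 by (simp add: field_simps)
    ultimately show thesis using that[of R] R by simp
  qed
  have U0h: "(\<lambda>w. 1 - Xg 0 a w) holomorphic_on ball 0 R"
    by (intro holomorphic_intros holomorphic_on_subset[OF Xg_holomorphic[OF Xf]]) (use R in auto)
  have U03: "norm (1 - Xg 0 a w) \<le> 3" if w: "w \<in> ball 0 R" for w
  proof -
    have "norm (Xg 0 a w) \<le> Re (Xg 0 a (of_real (norm w)))" by (rule norm_Xg_le[OF Xf]) (use w R in auto)
    also have "\<dots> \<le> Re (Xg 0 a (of_real R))" by (rule Xg_mono[OF Xf]) (use w R in auto)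
    finally have "norm (Xg 0 a w) \<le> 2" using R by simp
    then show ?thesis using norm_triangle_ineq4[of 1 "Xg 0 a w"] by simp
  qed
  have p01: "0 \<le> p t \<and> p t \<le> 1" and q01: "0 \<le> q t \<and> q t \<le> 1" if "t \<in> {a..b}" for t
    using pq_bounds(1,2)[of t] that a0 by auto
  have R0: "0 < R" using R by simp
  obtain h U where flow:
    "\<And>w. w \<in> ball 0 R \<Longrightarrow> char_curve p q a b w (\<lambda>t. h t w) (\<lambda>t. U t w)"
    "\<And>w. w \<in> ball 0 R \<Longrightarrow> U a w = 1 - Xg 0 a w"
    "\<And>t. t \<in> {a..b} \<Longrightarrow> h t holomorphic_on ball 0 R"
    "\<And>t. t \<in> {a..b} \<Longrightarrow> U t holomorphic_on ball 0 R"
    "\<And>t w. t \<in> {a..b} \<Longrightarrow> w \<in> ball 0 R \<Longrightarrow> norm (U t w) \<le> 4"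
    "continuous_on ({a..b} \<times> ball 0 R) (\<lambda>(t, w). h t w)"
    "continuous_on ({a..b} \<times> ball 0 R) (\<lambda>(t, w). U t w)"
  proof (rule char_flow_exists[OF a0(2) ab(3) p01 q01 pq_cont(1)[OF a0(1)] pq_cont(2)[OF a0(1)] R0 R(2) U0h U03])
    fix h U :: "real \<Rightarrow> complex \<Rightarrow> complex"
    assume f: "\<And>w. w \<in> ball 0 R \<Longrightarrow> char_curve p q a b w (\<lambda>t. h t w) (\<lambda>t. U t w)"
    "\<And>w. w \<in> ball 0 R \<Longrightarrow> U a w = 1 - Xg 0 a w"
    "\<And>t. t \<in> {a..b} \<Longrightarrow> h t holomorphic_on ball 0 R"
    "\<And>t. t \<in> {a..b} \<Longrightarrow> U t holomorphic_on ball 0 R"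
    "\<And>t w. t \<in> {a..b} \<Longrightarrow> w \<in> ball 0 R \<Longrightarrow> norm (U t w) \<le> 4"
    "continuous_on ({a..b} \<times> ball 0 R) (\<lambda>(t, w). h t w)"
    "continuous_on ({a..b} \<times> ball 0 R) (\<lambda>(t, w). U t w)"
    show thesis by (rule that) (fact f)+
  qed
  note ab' = ab
  interpret bf_flow x a b R \<rho>0 V0 h U
    by unfold_locales (use ab R V0 mass(1) flow in auto)
  have tcab: "tc \<in> {a..b}" using ab' by simp
  have s_on_a: "(s has_real_derivative q t + p t * (s t)\<^sup>2) (at t within {a..t'})" if "t' < tc" "t \<in> {a..t'}" for t t'
    by (rule s_on[OF a0(1) that])
  have pL: "\<bar>p t - p tc\<bar> \<le> 6 * \<bar>t - tc\<bar>" if "t \<in> {a..b}" for t by (rule p_Lipschitz[OF a0(1) that tcab])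
  have i2: "Re (deriv (U a) 1) = - s a" using linearised_init(2) mass(2) by simp
  obtain Q where Q: "Re (deriv (h tc) 1) + 1 = 0" "Re (deriv (U tc) 1) < 0"
    "\<And>t. t \<in> {a..b} \<Longrightarrow> \<bar>(Re (deriv (h t) 1) + 1) + (- p tc * Re (deriv (U tc) 1)) * (t - tc)\<bar> \<le> Q * (t - tc)\<^sup>2"
    using critical_slope[OF ab'(6,7) p01 q01 pq_cont(1)[OF a0(1)] pL pq_bounds(3)[OF tc] linearised_flow(1) linearised_flow(2)
        linearised_init(1) i2 sa s_on_a blow] by blast
  define \<alpha> where "\<alpha> = - p tc * Re (deriv (U tc) 1)"
  have \<alpha>: "\<alpha> > 0" using Q(2) pq_bounds(3)[OF tc] by (simp add: \<alpha>_def mult_pos_neg)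
  define B where "B = max 42 Q"
  \<comment> \<open>Times stay at distance at least L / 4 from the start a, so the gap of the
    displacements has had time to build up and \<kappa> does not depend on t.\<close>
  define t1 t2 where "t1 = tc - L / 4" and "t2 = tc + L / 4"
  have sub: "{t1..t2} \<subseteq> {a..b}" using L by (auto simp: t1_def t2_def a_def b_def)
  define \<kappa> where "\<kappa> = p0 * m0 / 72 * (L / 4)"
  have dG0: "deriv (G t) 0 = deriv (h t) 1" and dV0: "deriv (V t) 0 = deriv (U t) 1" if "t \<in> {a..b}" for t
    using deriv_G[OF that, of 0] deriv_V[OF that, of 0] \<rho>_pos by simp_all
  have B42: "42 \<le> B" by (simp add: B_def)
  interpret GS: strip_family G "{t1..t2}" \<rho> B by (rule strip(1)[OF B42 sub])
  interpret VS: strip_family V "{t1..t2}" \<rho> B by (rule strip(2)[OF B42 sub])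
  have sf: "saddle_family G V t1 t2 \<rho> B tc \<kappa> \<alpha>"
  proof unfold_locales
    show "t1 < tc" "tc < t2" using L by (auto simp: t1_def t2_def)
    show "0 < \<kappa>" using p0 m0 L by (simp add: \<kappa>_def)
    show "0 < \<alpha>" by (rule \<alpha>)
    show "G t 0 = 0" if "t \<in> {t1..t2}" for t using at_one(2)[of t] that sub by (auto simp: G_def)
    show "\<kappa> * \<theta>\<^sup>2 \<le> Re (G t (of_real u + \<i> * of_real \<theta>)) - Re (G t (of_real u))"
      if t: "t \<in> {t1..t2}" and u: "\<bar>u\<bar> \<le> \<rho>" and \<theta>: "\<bar>\<theta>\<bar> \<le> pi" for t u \<theta>
    proof -
      have m0a: "m0 \<le> X 1 a" unfolding m0_def by (rule m(2)) (use ab' in auto)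
      have p0t: "p0 \<le> p t" if "t \<in> {a..b}" for t unfolding p0_def by (rule n(2)) (use that ab' in auto)
      have ta: "t \<in> {a..b}" using t sub by auto
      have L': "(b - a) * (400000 * (36 / m0 + 1)) \<le> 1" unfolding ab'(8) by (rule L(4))
      have "p0 * m0 / 72 * (L / 4) * \<theta>\<^sup>2 \<le> p0 * m0 / 72 * (t - a) * \<theta>\<^sup>2"
        using t p0 m0 by (intro mult_right_mono mult_left_mono) (auto simp: t1_def a_def)
      also have "\<dots> \<le> Re (G t (of_real u + \<i> * of_real \<theta>)) - Re (G t (of_real u))"
        by (rule circle_gap[OF m0 m0a less_imp_le[OF p0] p0t L' ta u \<theta>])
      finally show ?thesis by (simp add: \<kappa>_def)
    qed
    have "GS.D 1 tc 0 \<in> \<real>" by (rule GS.D_real) (use L \<rho>_pos in \<open>auto simp: t1_def t2_def\<close>)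
    moreover have "Re (deriv (G tc) 0) = - 1" using Q(1) dG0[OF tcab] by simp
    ultimately show "deriv (G tc) 0 = - 1" by (simp add: complex_is_Real_iff complex_eq_iff)
    show "\<bar>Re (deriv (G t) 0) + 1 + \<alpha> * (t - tc)\<bar> \<le> B * (t - tc)\<^sup>2" if t: "t \<in> {t1..t2}" for t
    proof -
      have "\<bar>Re (deriv (G t) 0) + 1 + \<alpha> * (t - tc)\<bar> \<le> Q * (t - tc)\<^sup>2"
        using Q(3)[of t] dG0[of t] t sub by (auto simp: \<alpha>_def)
      also have "\<dots> \<le> B * (t - tc)\<^sup>2" by (intro mult_right_mono) (auto simp: B_def)
      finally show ?thesis .
    qed
    show "Re (deriv (V tc) 0) < 0" using Q(2) dV0[OF tcab] by simp
  qed
  show thesis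
  proof (rule that[OF sf])
    fix t u :: real and i :: nat assume "t \<in> {t1..t2}" "\<bar>u\<bar> \<le> \<rho>" "i \<ge> 1"
    then show "of_real (2 * pi * (real i * x i t)) =
      integral {-pi..pi} (\<lambda>\<theta>. - deriv (V t) (of_real u + \<i> * of_real \<theta>)
         * exp (- of_nat i * (of_real u + \<i> * of_real \<theta> + G t (of_real u + \<i> * of_real \<theta>))))"
      by (intro coefficient_integral) (use sub in auto)
  qed
qed

theorem theorem3:
  fixes x :: "nat \<Rightarrow> real \<Rightarrow> real" and tc :: real
  assumes "bf_solution x"
    and "bf_critical_time (x 1) tc"
  shows "\<exists>c d :: real. \<forall>\<sigma>\<in>{1, -1 :: real}. \<exists>C D :: real \<Rightarrow> real.
           (\<lambda>\<epsilon>. C \<epsilon> - c) \<in> O[at_right 0](\<lambda>\<epsilon>. \<epsilon>) \<and>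
           (\<lambda>\<epsilon>. D \<epsilon> - d) \<in> O[at_right 0](\<lambda>\<epsilon>. \<epsilon>) \<and>
           (\<exists>\<epsilon>0>0. \<exists>K N. \<forall>\<epsilon>. 0 < \<epsilon> \<and> \<epsilon> < \<epsilon>0 \<longrightarrow>
              (\<exists>r :: nat \<Rightarrow> real.
                 (\<forall>i\<ge>1. x i (tc + \<sigma> * \<epsilon>) =
                    C \<epsilon> * real i powr (- 3 / 2) * exp (- D \<epsilon> * \<epsilon>\<^sup>2 * real i) * (1 + r i)) \<and>
                 (\<forall>i\<ge>N. \<bar>r i\<bar> \<le> K / real i)))"
proof -
  interpret bf_process x by unfold_locales (rule assms(1))
  obtain G V t1 t2 \<rho> B \<kappa> \<alpha> where sf: "saddle_family G V t1 t2 \<rho> B tc \<kappa> \<alpha>"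
    and coeff: "\<And>t u i. t \<in> {t1..t2} \<Longrightarrow> \<bar>u\<bar> \<le> \<rho> \<Longrightarrow> i \<ge> 1 \<Longrightarrow> of_real (2 * pi * (real i * x i t)) =
      integral {-pi..pi} (\<lambda>\<theta>. - deriv (V t) (of_real u + \<i> * of_real \<theta>)
         * exp (- of_nat i * (of_real u + \<i> * of_real \<theta> + G t (of_real u + \<i> * of_real \<theta>))))"
    using saddle_family_exists[OF assms(2)] by blast
  interpret S: saddle_family G V t1 t2 \<rho> B tc \<kappa> \<alpha> by (rule sf)
  define E where "E = S.laplace_const / (2 * pi * ((S.wc / 2) / sqrt (2 * pi * S.G.K)))"
  obtain QC where QC: "\<And>\<delta>. \<bar>\<delta>\<bar> < S.\<delta>0 \<Longrightarrow> \<bar>S.Cf \<delta> - S.cc\<bar> \<le> QC * \<bar>\<delta>\<bar>"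
    using S.Cf_Lipschitz by metis
  have near: "\<forall>\<^sub>F \<epsilon> in at_right 0. 0 < \<epsilon> \<and> \<epsilon> < S.\<delta>0"
    using eventually_at_right_real[OF S.\<delta>0_pos] by (rule eventually_mono) auto
  show ?thesis
  proof (rule exI[of _ S.cc], rule exI[of _ S.dc], rule ballI)
    fix \<sigma> :: real assume "\<sigma> \<in> {1, -1}"
    then have \<sigma>: "\<bar>\<sigma>\<bar> = 1" "\<sigma>\<^sup>2 = 1" by auto
    define C where "C \<epsilon> = S.Cf (\<sigma> * \<epsilon>)" for \<epsilon>
    \<comment> \<open>D \<epsilon>^2 is exactly the critical value, so all inaccuracy of the
      expansion goes into D - d and none into the relative error.\<close>
    define D where "D \<epsilon> = S.Yf (\<sigma> * \<epsilon>) / \<epsilon>\<^sup>2" for \<epsilon>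
    have small: "\<bar>\<sigma> * \<epsilon>\<bar> < S.\<delta>0" "\<bar>\<sigma> * \<epsilon>\<bar> = \<epsilon>" "(\<sigma> * \<epsilon>)\<^sup>2 = \<epsilon>\<^sup>2" if "0 < \<epsilon> \<and> \<epsilon> < S.\<delta>0" for \<epsilon>
      using that \<sigma> by (simp_all add: abs_mult power_mult_distrib)
    have OC: "(\<lambda>\<epsilon>. C \<epsilon> - S.cc) \<in> O[at_right 0](\<lambda>\<epsilon>. \<epsilon>)"
    proof (rule bigoI[of _ QC], rule eventually_mono[OF near])
      fix \<epsilon> :: real assume e: "0 < \<epsilon> \<and> \<epsilon> < S.\<delta>0"
      show "norm (C \<epsilon> - S.cc) \<le> QC * norm \<epsilon>" using QC[OF small(1)[OF e]] small(2)[OF e] e by (simp add: C_def)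
    qed
    have OD: "(\<lambda>\<epsilon>. D \<epsilon> - S.dc) \<in> O[at_right 0](\<lambda>\<epsilon>. \<epsilon>)"
    proof (rule bigoI[of _ S.Q2], rule eventually_mono[OF near])
      fix \<epsilon> :: real assume e: "0 < \<epsilon> \<and> \<epsilon> < S.\<delta>0"
      have "D \<epsilon> - S.dc = (S.Yf (\<sigma> * \<epsilon>) - S.dc * \<epsilon>\<^sup>2) / \<epsilon>\<^sup>2" using e by (simp add: D_def field_simps)
      then have "\<bar>D \<epsilon> - S.dc\<bar> = \<bar>S.Yf (\<sigma> * \<epsilon>) - S.dc * \<epsilon>\<^sup>2\<bar> / \<epsilon>\<^sup>2" by simp
      also have "\<dots> \<le> (S.Q2 * \<epsilon> ^ 3) / \<epsilon>\<^sup>2"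
        using S.Yf_expansion[OF small(1)[OF e]] unfolding small(2,3)[OF e] by (intro divide_right_mono) auto
      also have "\<dots> = S.Q2 * \<epsilon>" using e by (simp add: power2_eq_square power3_eq_cube)
      finally show "norm (D \<epsilon> - S.dc) \<le> S.Q2 * norm \<epsilon>" using e by simp
    qed
    have main: "\<exists>r :: nat \<Rightarrow> real. (\<forall>i\<ge>1. x i (tc + \<sigma> * \<epsilon>) =
          C \<epsilon> * real i powr (- 3 / 2) * exp (- D \<epsilon> * \<epsilon>\<^sup>2 * real i) * (1 + r i)) \<and> (\<forall>i\<ge>1. \<bar>r i\<bar> \<le> E / real i)"
      if e: "0 < \<epsilon> \<and> \<epsilon> < S.\<delta>0" for \<epsilon>
    proof -
      note sm = small(1)[OF e]
      have DY: "D \<epsilon> * \<epsilon>\<^sup>2 = S.Yf (\<sigma> * \<epsilon>)" using e by (simp add: D_def)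
      define A where "A i = C \<epsilon> * real i powr (- 3 / 2) * exp (- D \<epsilon> * \<epsilon>\<^sup>2 * real i)" for i
      have A: "A i = S.Cf (\<sigma> * \<epsilon>) * real i powr (- 3 / 2) * exp (- S.Yf (\<sigma> * \<epsilon>) * real i)" for i
        unfolding A_def C_def DY[symmetric] by simp
      have "0 < (S.wc / 2) / sqrt (2 * pi * S.G.K)" using S.wc_pos S.G.K_pos by simp
      then have Cp: "S.Cf (\<sigma> * \<epsilon>) > 0" using S.Cf_ge[OF sm] by linarith
      have Ap: "A i > 0" if "i \<ge> 1" for i unfolding A using Cp that by simp
      define r where "r i = x i (tc + \<sigma> * \<epsilon>) / A i - 1" for i
      have "x i (tc + \<sigma> * \<epsilon>) = A i * (1 + r i)" if "i \<ge> 1" for i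
        using Ap[OF that] by (simp add: r_def)
      moreover have "\<bar>r i\<bar> \<le> E / real i" if i: "i \<ge> 1" for i
        unfolding r_def A E_def
        by (rule S.coefficient_asymptotics[where x = x, OF sm i coeff[OF S.\<delta>0_le(2)[OF sm] S.us(3)[OF sm] i]])
      ultimately show ?thesis unfolding A_def by blast
    qed
    show "\<exists>C D :: real \<Rightarrow> real.
           (\<lambda>\<epsilon>. C \<epsilon> - S.cc) \<in> O[at_right 0](\<lambda>\<epsilon>. \<epsilon>) \<and>
           (\<lambda>\<epsilon>. D \<epsilon> - S.dc) \<in> O[at_right 0](\<lambda>\<epsilon>. \<epsilon>) \<and>
           (\<exists>\<epsilon>0>0. \<exists>K N. \<forall>\<epsilon>. 0 < \<epsilon> \<and> \<epsilon> < \<epsilon>0 \<longrightarrow>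
              (\<exists>r :: nat \<Rightarrow> real.
                 (\<forall>i\<ge>1. x i (tc + \<sigma> * \<epsilon>) =
                    C \<epsilon> * real i powr (- 3 / 2) * exp (- D \<epsilon> * \<epsilon>\<^sup>2 * real i) * (1 + r i)) \<and>
                 (\<forall>i\<ge>N. \<bar>r i\<bar> \<le> K / real i)))"
      using OC OD main S.\<delta>0_pos by blast
  qed
qed

end
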